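(* Let $X$ and $Y$ be separable, reflexive Banach spaces such that, for some $C\ge1$ and some non-decreasing $K:\mathbb N\to\mathbb N$, the value $(K,C)\text{-}ld(X^*,Y^* )(n)$ is finite for every $n$, and let $T\in L(X)$ be compact. Let $(m_k)_{k=0}^\infty$ be natural numbers with $m_0=2$ and $m_k\ge K(3m_{k-1}+2)+1$ for all $k\in\mathbb N$. Put $\Gamma(k):=(2(C+3))^{k+1}$. Let $f:\mathbb N\to\mathbb R^+$ and $h:\mathbb N\to\mathbb R^+$ be defined by $f(n)=h(n)=1$ for $n\le2$ and, for $n>2$, $$f(n)=16\,\Gamma(k(n))^2\,(K,C)\text{-}ld(X^*,Y^* )(3m_{k(n)-1}),\qquad h(n)=\Gamma(k(n))+1,$$ where $k(n)\in\mathbb N$ is such that $m_{k(n)-1}<n\le m_{k(n)}$, and let $g:\mathbb N\to\mathbb N$ be the largest non-decreasing function satisfying $g(k)\le k$ and $g(m_{k+1})=m_k$ for all $k\in\mathbb N$. Assume that for a constant $C'$ and for all $k\in\mathbb N$ $$\Phi(f,g,h)(n)\le (k+1)^{-3}\,C'\,\Gamma(k+1)^{-1}\,\big(a_{m_{k-1}}(T)\big)^{-1}\qquad\text{for all } n\le m_{k+1},$$ where $\Phi$ is taken with respect to the spaces $X$ and $Y$. Then $T=T^{(2)}T^{(1)}$, where $T^{(1)}\in L(X,Y)$, $T^{(2)}\in L(Y,X)$ and $T^{(1)}(X)$ is dense in $Y$. Moreover, the operators $T^{(1)}$ and $T^{(2)}$ are compact.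
   Context: $\mathbb N=\{1,2,3,\dots\}$; Banach spaces are over $\mathbb R$ or $\mathbb C$; $L(X,Y)$ denotes the bounded linear operators and $L(X)=L(X,X)$. $d(M,N)=\inf\{\|\psi\|\|\psi^{-1}\| : \psi:M\to N\text{ isomorphism}\}$ is the Banach--Mazur distance. A subspace $N$ of a Banach space $X$ is $c$-complemented if there is a projection $P$ from $X$ onto $N$ with $\|P\|\le c$. Approximation numbers: $a_n(T)=\inf\{\|T-T_n\| : T_n\in L(X,Y),\ \operatorname{rank}T_n<n\}$ for compact $T\in L(X,Y)$; if $a_n(T)=0$, then $(a_n(T))^{-1}$ is read as $+\infty$. Uniform local distance function: for Banach spaces $X,Y$, $C\ge1$ and non-decreasing $K:\mathbb N\to\mathbb N$, $(K,C)\text{-}ld(X,Y)(n)\in\mathbb R^+\cup\{\infty\}$ is the infimum of $\infty$ and all numbers $r\in\mathbb R^+$ such that: whenever $M\subset X$, $M_Y\subset Y$ are subspaces of dimension at most $n$, there exist $C$-complemented subspaces $N\subset X$, $N_Y\subset Y$ with $M\subset N$, $M_Y\subset N_Y$, $\dim N=\dim N_Y\le K(n)$ and $d(N,N_Y)\le r$. The function $\Phi$: let $X,Y$ be Banach spaces and let $f,h:\mathbb N\to\mathbb R^+$ and $g:\mathbb N\to\mathbb N$, $g(n)\le n$, be positive and non-decreasing. For $n\in\mathbb N$, $\Phi(f,g,h)(n)$ is the supremum, over all pairs $(M,N)$ of at most $n$-dimensional subspaces $M\subset X$, $N\subset Y$ with $\dim M=\dim N$ and $d(M,N)\le f(n)$,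 and over all subspaces $M_1\subset M$, $N_1\subset N$ with $\dim M_1=\dim N_1\le g(n)$ and $d(M_1,N_1)\le f(g(n))$, of the number $\sup\{d(M_2,N_2)\}$, where this last supremum is over all complements $M_2$ with $M_1\oplus M_2=M$ and $N_2$ with $N_1\oplus N_2=N$ such that the projections corresponding to these direct sums (of $M$ onto $M_1$ and onto $M_2$, and of $N$ onto $N_1$ and onto $N_2$) have norms smaller than $h(g(n))$. *)

theory Defs
  imports "HOL-Analysis.Analysis"
begin

section \<open>Normed spaces over the real or the complex numbers\<close>

text \<open>
  The scalar field is a type of the following class, which contains exactly the (isometric) copies
  of the real and of the complex numbers.
\<close>

class real_or_complex = real_normed_field +
  assumes real_or_complex:
    "(\<forall>z. \<exists>a. z = a *\<^sub>R 1) \<or>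
     (\<exists>i. i * i = - 1 \<and> (\<forall>z. \<exists>a b. z = a *\<^sub>R 1 + b *\<^sub>R i) \<and>
          (\<forall>a b. norm (a *\<^sub>R 1 + b *\<^sub>R i) = sqrt (a\<^sup>2 + b\<^sup>2)))"

instance real :: real_or_complex
  by standard auto

instance complex :: real_or_complex
proof
  have "\<exists>a b. z = a *\<^sub>R 1 + b *\<^sub>R \<i>" for z
    by (rule exI[of _ "Re z"], rule exI[of _ "Im z"]) (simp add: complex_eq_iff)
  moreover have "norm (a *\<^sub>R 1 + b *\<^sub>R \<i>) = sqrt (a\<^sup>2 + b\<^sup>2)" for a b
    by (simp add: cmod_def)
  ultimately show "(\<forall>z::complex. \<exists>a. z = a *\<^sub>R 1) \<or>
     (\<exists>i::complex. i * i = - 1 \<and> (\<forall>z. \<exists>a b. z = a *\<^sub>R 1 + b *\<^sub>R i) \<and>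
          (\<forall>a b. norm (a *\<^sub>R 1 + b *\<^sub>R i) = sqrt (a\<^sup>2 + b\<^sup>2)))"
    by (intro disjI2 exI[of _ \<i>]) auto
qed

text \<open>
  The library's normed spaces are real. A space over \<open>'k\<close> is a real normed space with a compatible
  multiplication by scalars from \<open>'k\<close>; for \<open>'k = real\<close> it has to be scaleR.
  It is a Banach space over \<open>'k\<close> if moreover the type \<open>'a\<close> is of class banach.
\<close>

locale normed_space_over = vector_space scale
  for scale :: "'k::real_or_complex \<Rightarrow> 'a::real_normed_vector \<Rightarrow> 'a" +
  assumes scale_of_real: "scale (of_real r) x = r *\<^sub>R x"
    and norm_scale: "norm (scale c x) = norm c * norm x"

definition fin_dim_subspace ::
    "('k::real_or_complex \<Rightarrow> 'a::real_normed_vector \<Rightarrow> 'a) \<Rightarrow> 'a set \<Rightarrow> bool" where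
  "fin_dim_subspace s M \<longleftrightarrow> (\<exists>B. finite B \<and> module.span s B = M)"

definition klinear_on ::
    "('k::real_or_complex \<Rightarrow> 'a::real_normed_vector \<Rightarrow> 'a) \<Rightarrow>
     ('k \<Rightarrow> 'b::real_normed_vector \<Rightarrow> 'b) \<Rightarrow> 'a set \<Rightarrow> ('a \<Rightarrow> 'b) \<Rightarrow> bool" where
  "klinear_on s t M \<psi> \<longleftrightarrow>
     (\<forall>x\<in>M. \<forall>y\<in>M. \<psi> (x + y) = \<psi> x + \<psi> y) \<and> (\<forall>c. \<forall>x\<in>M. \<psi> (s c x) = t c (\<psi> x))"

text \<open>Norm of an operator defined on the subspace \<open>M\<close>; it is \<open>\<infinity>\<close> if the operator is unbounded.\<close>

definition opnorm_on :: "'a::real_normed_vector set \<Rightarrow> ('a \<Rightarrow> 'b::real_normed_vector) \<Rightarrow> ennreal" where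
  "opnorm_on M \<psi> = (SUP x\<in>M. ennreal (norm (\<psi> x) / norm x))"

text \<open>\<open>L(X,Y)\<close>: the members of the blinfun type, which are real-linear, that are \<open>'k\<close>-linear.\<close>

definition bounded_ops ::
    "('k::real_or_complex \<Rightarrow> 'a::real_normed_vector \<Rightarrow> 'a) \<Rightarrow>
     ('k \<Rightarrow> 'b::real_normed_vector \<Rightarrow> 'b) \<Rightarrow> ('a \<Rightarrow>\<^sub>L 'b) set" where
  "bounded_ops s t = {T. \<forall>c x. blinfun_apply T (s c x) = t c (blinfun_apply T x)}"

definition compact_op :: "('a::real_normed_vector \<Rightarrow>\<^sub>L 'b::real_normed_vector) \<Rightarrow> bool" where
  "compact_op T \<longleftrightarrow> compact (closure (blinfun_apply T ` cball 0 1))"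


section \<open>Dual space and reflexivity\<close>

definition dual ::
    "('k::real_or_complex \<Rightarrow> 'a::real_normed_vector \<Rightarrow> 'a) \<Rightarrow> ('a \<Rightarrow>\<^sub>L 'k) set" where
  "dual s = bounded_ops s (*)"

definition dual_scale ::
    "'k::real_or_complex \<Rightarrow> ('a::real_normed_vector \<Rightarrow>\<^sub>L 'k) \<Rightarrow> ('a \<Rightarrow>\<^sub>L 'k)" where
  "dual_scale c \<phi> = blinfun_mult_right c o\<^sub>L \<phi>"

lemma normed_space_over_dual_scale:
  "normed_space_over
     (dual_scale :: 'k::real_or_complex \<Rightarrow> ('a::real_normed_vector \<Rightarrow>\<^sub>L 'k) \<Rightarrow> _)"
proof
  fix a b :: 'k and x y :: "'a \<Rightarrow>\<^sub>L 'k" and r :: real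
  show "dual_scale a (x + y) = dual_scale a x + dual_scale a y"
    "dual_scale (a + b) x = dual_scale a x + dual_scale b x"
    "dual_scale a (dual_scale b x) = dual_scale (a * b) x"
    "dual_scale 1 x = x"
    by (rule blinfun_eqI; simp add: dual_scale_def plus_blinfun.rep_eq algebra_simps)+
  show "dual_scale (of_real r) x = r *\<^sub>R x"
    by (rule blinfun_eqI) (simp add: dual_scale_def scaleR_blinfun.rep_eq scaleR_conv_of_real)
  have le: "norm (dual_scale c z) \<le> norm c * norm z" for c :: 'k and z :: "'a \<Rightarrow>\<^sub>L 'k"
  proof (rule norm_blinfun_bound)
    fix v
    have "norm c * norm (blinfun_apply z v) \<le> norm c * (norm z * norm v)"
      by (intro mult_left_mono norm_blinfun norm_ge_zero)
    then show "norm (blinfun_apply (dual_scale c z) v) \<le> norm c * norm z * norm v"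
      by (simp add: dual_scale_def norm_mult mult.assoc)
  qed simp
  show "norm (dual_scale a x) = norm a * norm x"
  proof (cases "a = 0")
    case True
    then show ?thesis using le[of a x] by simp
  next
    case False
    have "dual_scale (inverse a) (dual_scale a x) = x"
      using False by (intro blinfun_eqI) (simp add: dual_scale_def)
    with le[of "inverse a" "dual_scale a x"]
    have "norm x \<le> norm (dual_scale a x) / norm a"
      by (simp add: norm_inverse divide_inverse mult.commute)
    then have "norm a * norm x \<le> norm (dual_scale a x)"
      using False by (simp add: field_simps)
    with le[of a x] show ?thesis by simp
  qed
qed

lemma subspace_dual:
  fixes s :: "'k::real_or_complex \<Rightarrow> 'a::real_normed_vector \<Rightarrow> 'a"
  shows "module.subspace dual_scale (dual s)"
proof -
  interpret D: normed_space_over "dual_scale :: 'k \<Rightarrow> ('a \<Rightarrow>\<^sub>L 'k) \<Rightarrow> _"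
    by (rule normed_space_over_dual_scale)
  show ?thesis
    by (auto simp: D.subspace_def dual_def bounded_ops_def dual_scale_def
        plus_blinfun.rep_eq algebra_simps)
qed

text \<open>Every bounded linear functional on the dual is evaluation at a point.\<close>

definition reflexive_space ::
    "('k::real_or_complex \<Rightarrow> 'a::real_normed_vector \<Rightarrow> 'a) \<Rightarrow> bool" where
  "reflexive_space s \<longleftrightarrow>
     (\<forall>F. klinear_on dual_scale (*) (dual s) F \<and> opnorm_on (dual s) F < \<infinity> \<longrightarrow>
        (\<exists>x. \<forall>\<phi>\<in>dual s. F \<phi> = blinfun_apply \<phi> x))"


section \<open>Approximation numbers and Banach--Mazur distance\<close>

definition approx_number ::
    "('k::real_or_complex \<Rightarrow> 'a::real_normed_vector \<Rightarrow> 'a) \<Rightarrow>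
     ('k \<Rightarrow> 'b::real_normed_vector \<Rightarrow> 'b) \<Rightarrow> nat \<Rightarrow> ('a \<Rightarrow>\<^sub>L 'b) \<Rightarrow> real" where
  "approx_number s t n T =
     (INF S \<in> {S \<in> bounded_ops s t. fin_dim_subspace t (range (blinfun_apply S)) \<and>
                 vector_space.dim t (range (blinfun_apply S)) < n}.
        norm (T - S))"

definition isomorphisms ::
    "('k::real_or_complex \<Rightarrow> 'a::real_normed_vector \<Rightarrow> 'a) \<Rightarrow>
     ('k \<Rightarrow> 'b::real_normed_vector \<Rightarrow> 'b) \<Rightarrow> 'a set \<Rightarrow> 'b set \<Rightarrow> ('a \<Rightarrow> 'b) set" where
  "isomorphisms s t M N =
     {\<psi>. klinear_on s t M \<psi> \<and> bij_betw \<psi> M N \<and>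
         opnorm_on M \<psi> < \<infinity> \<and> opnorm_on N (inv_into M \<psi>) < \<infinity>}"

definition bm_dist ::
    "('k::real_or_complex \<Rightarrow> 'a::real_normed_vector \<Rightarrow> 'a) \<Rightarrow>
     ('k \<Rightarrow> 'b::real_normed_vector \<Rightarrow> 'b) \<Rightarrow> 'a set \<Rightarrow> 'b set \<Rightarrow> ennreal" where
  "bm_dist s t M N =
     (INF \<psi> \<in> isomorphisms s t M N. opnorm_on M \<psi> * opnorm_on N (inv_into M \<psi>))"


section \<open>The uniform local distance function\<close>

text \<open>
  In the next two definitions the Banach space is the subspace \<open>E\<close> (or \<open>F\<close>) of the ambient type, so
  that they apply to dual spaces.
\<close>

definition complemented ::
    "('k::real_or_complex \<Rightarrow> 'a::real_normed_vector \<Rightarrow> 'a) \<Rightarrow> 'a set \<Rightarrow> real \<Rightarrow> 'a set \<Rightarrow> bool" where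
  "complemented s E c N \<longleftrightarrow>
     (\<exists>P. klinear_on s s E P \<and> P ` E = N \<and> N \<subseteq> E \<and> (\<forall>x\<in>E. P (P x) = P x) \<and>
          opnorm_on E P \<le> ennreal c)"

definition loc_dist ::
    "('k::real_or_complex \<Rightarrow> 'a::real_normed_vector \<Rightarrow> 'a) \<Rightarrow> 'a set \<Rightarrow>
     ('k \<Rightarrow> 'b::real_normed_vector \<Rightarrow> 'b) \<Rightarrow> 'b set \<Rightarrow> (nat \<Rightarrow> nat) \<Rightarrow> real \<Rightarrow> nat \<Rightarrow> ennreal" where
  "loc_dist s E t F K C n =
     Inf (insert \<infinity> {ennreal r | r. 0 < r \<and>
       (\<forall>M M'. M \<subseteq> E \<and> fin_dim_subspace s M \<and> vector_space.dim s M \<le> n \<and>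
               M' \<subseteq> F \<and> fin_dim_subspace t M' \<and> vector_space.dim t M' \<le> n \<longrightarrow>
          (\<exists>N N'. fin_dim_subspace s N \<and> complemented s E C N \<and> M \<subseteq> N \<and>
                  fin_dim_subspace t N' \<and> complemented t F C N' \<and> M' \<subseteq> N' \<and>
                  vector_space.dim s N = vector_space.dim t N' \<and> vector_space.dim t N' \<le> K n \<and>
                  bm_dist s t N N' \<le> ennreal r))})"


section \<open>The function \<open>\<Phi>\<close>\<close>

definition direct_sum ::
    "('k::real_or_complex \<Rightarrow> 'a::real_normed_vector \<Rightarrow> 'a) \<Rightarrow> 'a set \<Rightarrow> 'a set \<Rightarrow> 'a set \<Rightarrow> bool" where
  "direct_sum s M1 M2 M \<longleftrightarrow>
     module.subspace s M1 \<and> module.subspace s M2 \<and> M1 \<inter> M2 = {0} \<and> M = {a + b | a b. a \<in> M1 \<and> b \<in> M2}"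

text \<open>The projection of \<open>M1 \<oplus> M2\<close> onto \<open>M1\<close> along \<open>M2\<close>.\<close>

definition sum_proj :: "'a::real_normed_vector set \<Rightarrow> 'a set \<Rightarrow> 'a \<Rightarrow> 'a" where
  "sum_proj M1 M2 x = (THE a. a \<in> M1 \<and> (\<exists>b\<in>M2. x = a + b))"

definition good_sum ::
    "('k::real_or_complex \<Rightarrow> 'a::real_normed_vector \<Rightarrow> 'a) \<Rightarrow> real \<Rightarrow> 'a set \<Rightarrow> 'a set \<Rightarrow> 'a set \<Rightarrow> bool" where
  "good_sum s c M1 M2 M \<longleftrightarrow>
     direct_sum s M1 M2 M \<and>
     opnorm_on M (sum_proj M1 M2) < ennreal c \<and> opnorm_on M (sum_proj M2 M1) < ennreal c"

definition Phi ::
    "('k::real_or_complex \<Rightarrow> 'a::real_normed_vector \<Rightarrow> 'a) \<Rightarrow>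
     ('k \<Rightarrow> 'b::real_normed_vector \<Rightarrow> 'b) \<Rightarrow>
     (nat \<Rightarrow> real) \<Rightarrow> (nat \<Rightarrow> nat) \<Rightarrow> (nat \<Rightarrow> real) \<Rightarrow> nat \<Rightarrow> ennreal" where
  "Phi s t f g h n =
     Sup {bm_dist s t M2 N2 | M N M1 N1 M2 N2.
       fin_dim_subspace s M \<and> fin_dim_subspace t N \<and>
       vector_space.dim s M = vector_space.dim t N \<and> vector_space.dim t N \<le> n \<and>
       bm_dist s t M N \<le> ennreal (f n) \<and>
       fin_dim_subspace s M1 \<and> M1 \<subseteq> M \<and> fin_dim_subspace t N1 \<and> N1 \<subseteq> N \<and>
       vector_space.dim s M1 = vector_space.dim t N1 \<and> vector_space.dim t N1 \<le> g n \<and>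
       bm_dist s t M1 N1 \<le> ennreal (f (g n)) \<and>
       good_sum s (h (g n)) M1 M2 M \<and> good_sum t (h (g n)) N1 N2 N}"


section \<open>The parameter functions built from a sequence \<open>m\<close>\<close>

text \<open>
  The natural numbers of the source start at 1; the values of the following functions at 0 play
  no role. If \<open>m\<close> is strictly increasing, the index in the next definition is unique for \<open>n > m 0\<close>.
\<close>

definition block_index :: "(nat \<Rightarrow> nat) \<Rightarrow> nat \<Rightarrow> nat" where
  "block_index m n = (LEAST k. 1 \<le> k \<and> m (k - 1) < n \<and> n \<le> m k)"

definition Gam :: "real \<Rightarrow> nat \<Rightarrow> real" where
  "Gam C k = (2 * (C + 3)) ^ (k + 1)"

definition f_fun :: "(nat \<Rightarrow> nat) \<Rightarrow> real \<Rightarrow> (nat \<Rightarrow> ennreal) \<Rightarrow> nat \<Rightarrow> real" where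
  "f_fun m C ld n =
     (if n \<le> 2 then 1
      else 16 * (Gam C (block_index m n))\<^sup>2 * enn2real (ld (3 * m (block_index m n - 1))))"

definition h_fun :: "(nat \<Rightarrow> nat) \<Rightarrow> real \<Rightarrow> nat \<Rightarrow> real" where
  "h_fun m C n = (if n \<le> 2 then 1 else Gam C (block_index m n) + 1)"

text \<open>The order on functions is pointwise; \<open>g 0 \<le> 0\<close> leaves no freedom at 0.\<close>

definition g_fun :: "(nat \<Rightarrow> nat) \<Rightarrow> nat \<Rightarrow> nat" where
  "g_fun m = (GREATEST g. mono g \<and> (\<forall>k\<ge>1. 1 \<le> g k) \<and> (\<forall>k. g k \<le> k) \<and>
                          (\<forall>k\<ge>1. g (m (k + 1)) = m k))"

end

theory Submission
  imports Defs
begin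

text \<open>
  The idea is to cut \<open>X\<close> and \<open>Y\<close> into finite-dimensional blocks that are isomorphic in pairs, to map
  \<open>X\<close> to \<open>Y\<close> by a sum of these isomorphisms \<open>U k\<close> with small weights \<open>l ^ k\<close>, and to return from \<open>Y\<close> by
  the inverse isomorphisms \<open>U' k\<close> with weights \<open>1 / l ^ k\<close>, followed by \<open>T\<close>. The way back converges
  because the \<open>k\<close>-th block lies in the kernel of an operator \<open>A k\<close> of small rank, so that \<open>T\<close> is there
  no larger than \<open>norm (T - A k)\<close>, which is about the approximation number.

  \<^item> Blocks. The local distance function speaks about the duals. By reflexivity its projections and
    isomorphisms are adjoints of operators between \<open>X\<close> and \<open>Y\<close> (\<open>local_step\<close>). One obtains
    projections \<open>R k\<close> of \<open>X\<close> with \<open>norm (R k) \<le> C\<close> and nested kernels, hence \<open>R k \<circ> R (k + 1) = R k\<close>;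
    but their ranges are not nested. In \<open>Y\<close> the projections are corrected so that kernels and ranges
    are nested; their norms then grow like \<open>(2 * C + 2) ^ k\<close> (\<open>block_step\<close>, \<open>block_sequence\<close>). The
    function \<open>\<Phi>\<close> bounds the distance between the complement of \<open>R (k + 1) (range (R k))\<close> in
    the range of \<open>R (k + 1)\<close> and the corresponding complement in \<open>Y\<close> (\<open>block_isomorphism\<close>).

  \<^item> Why only one side is nested. If the projections commuted in both spaces, both norms would grow
    exponentially and both would enter the norms of the terms, while the hypothesis provides only one
    factor \<open>Gam C (k + 1)\<close>, a power of \<open>2 * C + 6\<close>. With bounded projections in \<open>X\<close>
    the map \<open>G k\<close>, the sum of the first weighted isomorphisms, is only triangular. A right inverse
    \<open>W k\<close> is found by recursion, and the errors that the recursion carries along are multiplied by at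
    most \<open>1 + C\<close> in each ordinary step, which is less than the growth of the new terms. So they
    are added to the new terms and do not multiply them, and the total growth stays
    below \<open>(2 * C + 5) ^ k\<close> (\<open>w_bounds\<close>).

  \<^item> Dense range. A vector \<open>u\<close> with \<open>G k u = y\<close> satisfies \<open>T1 u = y\<close> if all later terms vanish at \<open>u\<close>.
    Therefore the terms of \<open>T1\<close> are \<open>U k \<circ> (1 - p k)\<close> with projections \<open>p k\<close> of increasing
    range, and such a \<open>u\<close> is put into the range of \<open>p k\<close> for every member \<open>y\<close> of a dense sequence. One
    enlargement multiplies \<open>1 + norm (p k)\<close> by at most \<open>1 + C\<close>, whatever the norm of \<open>u\<close> is
    (\<open>enlarge_projection\<close>); if it takes place only once in \<open>N\<close> steps, for a large \<open>N\<close>, the weights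
    absorb it.

  If \<open>m\<close> is not increasing, then \<open>K n < n\<close> for some \<open>n\<close>; the spaces are then finite-dimensional, and
  one application of \<open>local_step\<close> yields an isomorphism between them (\<open>factorization_if_total\<close>).
\<close>


section \<open>Norming functionals\<close>

definition sublinear :: "('a::real_vector \<Rightarrow> real) \<Rightarrow> bool" where
  "sublinear p \<longleftrightarrow> (\<forall>x y. p (x + y) \<le> p x + p y) \<and> (\<forall>c>0. \<forall>x. p (c *\<^sub>R x) = c * p x)"

lemma sublinearD:
  assumes "sublinear p"
  shows "p (x + y) \<le> p x + p y" and "c \<ge> 0 \<Longrightarrow> p (c *\<^sub>R x) = c * p x" and "- p (- x) \<le> p x"
    and "p 0 = 0"
proof -
  show a: "p (x + y) \<le> p x + p y" for x y using assms by (auto simp: sublinear_def)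
  have "p (2 *\<^sub>R 0) = 2 * p 0" using assms unfolding sublinear_def by (metis zero_less_numeral)
  then show z: "p 0 = 0" by simp
  show "c \<ge> 0 \<Longrightarrow> p (c *\<^sub>R x) = c * p x"
    using assms z unfolding sublinear_def by (cases "c = 0") auto
  show "- p (- x) \<le> p x" using a[of x "- x"] z by simp
qed

text \<open>
  The linear functionals are the minimal sublinear ones: if a sublinear \<open>p\<close> is minimal, then it equals
  each of its shifts, and this gives the inequality opposite to subadditivity.
\<close>

definition sublinear_shift :: "('a::real_vector \<Rightarrow> real) \<Rightarrow> 'a \<Rightarrow> 'a \<Rightarrow> real" where
  "sublinear_shift p y x = (INF t\<in>{0..}. p (x + t *\<^sub>R y) - t * p y)"

lemma sublinear_shift:
  assumes p: "sublinear p"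
  shows "sublinear (sublinear_shift p y)" and "sublinear_shift p y x \<le> p x"
    and "sublinear_shift p y x \<le> p (x + y) - p y"
proof -
  have lb: "- p (- x) \<le> p (x + t *\<^sub>R y) - t * p y" if "t \<ge> 0" for x t
    using sublinearD(1)[OF p, of "x + t *\<^sub>R y" "- x"] sublinearD(2)[OF p that, of y] by simp
  have bdd: "bdd_below ((\<lambda>t. p (x + t *\<^sub>R y) - t * p y) ` {0..})" for x
    by (rule bdd_belowI[of _ "- p (- x)"]) (auto intro: lb)
  have le: "sublinear_shift p y x \<le> p (x + t *\<^sub>R y) - t * p y" if "t \<ge> 0" for x t
    unfolding sublinear_shift_def by (rule cINF_lower[OF bdd]) (use that in auto)
  have ge: "m \<le> sublinear_shift p y x" if "\<And>t. t \<ge> 0 \<Longrightarrow> m \<le> p (x + t *\<^sub>R y) - t * p y" for x m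
    unfolding sublinear_shift_def by (rule cINF_greatest) (use that in auto)
  show "sublinear_shift p y x \<le> p x" using le[of 0 x] by simp
  show "sublinear_shift p y x \<le> p (x + y) - p y" using le[of 1 x] by simp
  have add: "sublinear_shift p y (u + v) \<le> sublinear_shift p y u + sublinear_shift p y v" for u v
  proof -
    have "sublinear_shift p y (u + v) - (p (v + t *\<^sub>R y) - t * p y) \<le> sublinear_shift p y u"
      if t: "t \<ge> 0" for t
    proof (rule ge)
      fix r :: real assume r: "r \<ge> 0"
      have "p (u + v + (t + r) *\<^sub>R y) \<le> p (u + r *\<^sub>R y) + p (v + t *\<^sub>R y)"
        using sublinearD(1)[OF p, of "u + r *\<^sub>R y" "v + t *\<^sub>R y"] by (simp add: algebra_simps)
      then show "sublinear_shift p y (u + v) - (p (v + t *\<^sub>R y) - t * p y) \<le> p (u + r *\<^sub>R y) - r * p y"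
        using le[of "t + r" "u + v"] r t by (simp add: algebra_simps)
    qed
    then have "sublinear_shift p y (u + v) - sublinear_shift p y u \<le> sublinear_shift p y v"
      by (intro ge) (smt (verit))
    then show ?thesis by simp
  qed
  have hom_le: "sublinear_shift p y (c *\<^sub>R x) \<le> c * sublinear_shift p y x" if c: "c > 0" for c x
  proof -
    have "sublinear_shift p y (c *\<^sub>R x) / c \<le> sublinear_shift p y x"
    proof (rule ge)
      fix t :: real assume t: "t \<ge> 0"
      have "sublinear_shift p y (c *\<^sub>R x) \<le> p (c *\<^sub>R (x + t *\<^sub>R y)) - (c * t) * p y"
        using le[of "c * t" "c *\<^sub>R x"] c t by (simp add: algebra_simps)
      also have "\<dots> = c * (p (x + t *\<^sub>R y) - t * p y)"
        using sublinearD(2)[OF p, of c "x + t *\<^sub>R y"] c by (simp add: algebra_simps)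
      finally show "sublinear_shift p y (c *\<^sub>R x) / c \<le> p (x + t *\<^sub>R y) - t * p y"
        using c by (simp add: field_simps)
    qed
    then show ?thesis using c by (simp add: field_simps)
  qed
  have hom_ge: "c * sublinear_shift p y x \<le> sublinear_shift p y (c *\<^sub>R x)" if c: "c > 0" for c x
    using hom_le[of "inverse c" "c *\<^sub>R x"] c by (simp add: field_simps)
  show "sublinear (sublinear_shift p y)"
    unfolding sublinear_def using add hom_le hom_ge by (auto intro: antisym)
qed

text \<open>Zorn's lemma applies because the pointwise infimum of a chain is finite: a sublinear \<open>p\<close> below \<open>q\<close>
  satisfies \<open>p x \<ge> - q (- x)\<close>.\<close>

lemma minimal_sublinear:
  assumes q: "sublinear q"
  obtains p where "sublinear p" "\<And>x. p x \<le> q x" "\<And>p' . sublinear p' \<Longrightarrow> (\<And>x. p' x \<le> p x) \<Longrightarrow> p' = p"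
proof -
  define A where "A = {p. sublinear p \<and> (\<forall>x. p x \<le> q x)}"
  define ge where "ge p p' \<longleftrightarrow> (\<forall>x. p' x \<le> p x)" for p p' :: "'a \<Rightarrow> real"
  have "\<exists>m\<in>A. \<forall>a\<in>A. ge m a \<longrightarrow> a = m"
  proof (rule predicate_Zorn)
    show "partial_order_on A (relation_of ge A)"
      by (rule partial_order_on_relation_ofI) (auto simp: ge_def intro: order_trans intro!: ext antisym)
    fix Ch assume Ch: "Ch \<in> Chains (relation_of ge A)"
    have sub: "p \<in> A" if "p \<in> Ch" for p
      using Ch that by (auto simp: Chains_def relation_of_def)
    have tot: "ge p p' \<or> ge p' p" if "p \<in> Ch" "p' \<in> Ch" for p p'
      using Ch that by (auto simp: Chains_def relation_of_def)
    show "\<exists>u\<in>A. \<forall>a\<in>Ch. ge a u"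
    proof (cases "Ch = {}")
      case True
      then show ?thesis using q by (auto simp: A_def)
    next
      case False
      define u where "u x = (INF p\<in>Ch. p x)" for x
      have lb: "- q (- x) \<le> p x" if "p \<in> Ch" for p x
        using sub[OF that] sublinearD(3)[of p x] by (smt (verit) A_def mem_Collect_eq)
      have bdd: "bdd_below ((\<lambda>p. p x) ` Ch)" for x
        by (rule bdd_belowI[of _ "- q (- x)"]) (auto intro: lb)
      have le: "u x \<le> p x" if "p \<in> Ch" for p x
        unfolding u_def by (rule cINF_lower[OF bdd that])
      have gr: "m \<le> u x" if "\<And>p. p \<in> Ch \<Longrightarrow> m \<le> p x" for m x
        unfolding u_def by (rule cINF_greatest[OF False that])
      have add: "u (x + y) \<le> u x + u y" for x y
      proof -
        have "u (x + y) - p x \<le> u y" if p: "p \<in> Ch" for p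
        proof (rule gr)
          fix p' assume p': "p' \<in> Ch"
          have "u (x + y) \<le> p x + p' y"
          proof (cases "ge p p'")
            case True
            then show ?thesis using le[OF p', of "x + y"] sub[OF p'] sublinearD(1)[of p' x y]
              by (smt (verit) A_def ge_def mem_Collect_eq)
          next
            case False
            then have "ge p' p" using tot p p' by blast
            then show ?thesis using le[OF p, of "x + y"] sub[OF p] sublinearD(1)[of p x y]
              by (smt (verit) A_def ge_def mem_Collect_eq)
          qed
          then show "u (x + y) - p x \<le> p' y" by simp
        qed
        then have "u (x + y) - u y \<le> u x" by (intro gr) (smt (verit))
        then show ?thesis by simp
      qed
      have hom_le: "u (c *\<^sub>R x) \<le> c * u x" if c: "c > 0" for c x
      proof -
        have "u (c *\<^sub>R x) / c \<le> u x"
        proof (rule gr)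
          fix p assume p: "p \<in> Ch"
          have "p (c *\<^sub>R x) = c * p x" using sub[OF p] c by (auto simp: A_def sublinear_def)
          then show "u (c *\<^sub>R x) / c \<le> p x" using le[OF p, of "c *\<^sub>R x"] c by (simp add: field_simps)
        qed
        then show ?thesis using c by (simp add: field_simps)
      qed
      have hom_ge: "c * u x \<le> u (c *\<^sub>R x)" if c: "c > 0" for c x
        using hom_le[of "inverse c" "c *\<^sub>R x"] c by (simp add: field_simps)
      obtain p0 where "p0 \<in> Ch" using False by blast
      then have "u x \<le> q x" for x using le[of p0 x] sub[of p0] by (auto simp: A_def intro: order_trans)
      then have "u \<in> A" using add hom_le hom_ge by (auto simp: A_def sublinear_def intro: antisym)
      then show ?thesis using le by (auto simp: ge_def)
    qed
  qed
  then obtain p where p: "p \<in> A" "\<And>a. a \<in> A \<Longrightarrow> ge p a \<Longrightarrow> a = p" by blast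
  show thesis
  proof (rule that)
    show "sublinear p" "\<And>x. p x \<le> q x" using p(1) by (auto simp: A_def)
    fix p' assume p': "sublinear p'" "\<And>x. p' x \<le> p x"
    have "p' x \<le> q x" for x using p'(2)[of x] p(1) unfolding A_def by (auto intro: order_trans)
    then show "p' = p" using p(2)[of p'] p' by (simp add: A_def ge_def)
  qed
qed

lemma sublinear_norm: "sublinear (norm :: 'a::real_normed_vector \<Rightarrow> real)"
  by (auto simp: sublinear_def norm_triangle_ineq)

text \<open>
  A minimal sublinear functional \<open>p\<close> is additive, since it coincides with its shifts. Minimality
  below the shift of the norm by \<open>x0\<close> forces it to attain the norm at \<open>x0\<close>.
\<close>

lemma real_norming_functional:
  fixes x0 :: "'a::real_normed_vector"
  obtains p :: "'a \<Rightarrow> real" where "linear p" "\<And>x. p x \<le> norm x" "p x0 = norm x0"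
proof -
  obtain p where p: "sublinear p" "\<And>x. p x \<le> sublinear_shift norm x0 x"
    and min: "\<And>p' . sublinear p' \<Longrightarrow> (\<And>x. p' x \<le> p x) \<Longrightarrow> p' = p"
    using minimal_sublinear[OF sublinear_shift(1)[OF sublinear_norm]] by metis
  have shift_eq: "sublinear_shift p y = p" for y
    by (rule min) (use sublinear_shift[OF p(1)] in auto)
  have "p x + p y \<le> p (x + y)" for x y
    using sublinear_shift(3)[OF p(1), of y x] shift_eq[of y] by simp
  then have add: "p (x + y) = p x + p y" for x y
    using sublinearD(1)[OF p(1), of x y] by (simp add: antisym)
  have neg: "p (- x) = - p x" for x
    using add[of x "- x"] sublinearD(4)[OF p(1)] by simp
  have sc: "p (c *\<^sub>R x) = c * p x" for c x
  proof (cases "c \<ge> 0")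
    case True
    then show ?thesis using sublinearD(2)[OF p(1)] by simp
  next
    case False
    then show ?thesis using sublinearD(2)[OF p(1), of "- c" x] neg[of "c *\<^sub>R x"] by simp
  qed
  have le: "p x \<le> norm x" for x
    using p(2)[of x] sublinear_shift(2)[OF sublinear_norm, of x0 x] by simp
  have "p (- x0) \<le> - norm x0"
    using p(2)[of "- x0"] sublinear_shift(3)[OF sublinear_norm, of x0 "- x0"] by simp
  then have "p x0 = norm x0" using neg[of x0] le[of x0] by simp
  then show thesis using that add sc le by (metis linearI real_scaleR_def)
qed

text \<open>
  The complex case follows from the real one: a real-linear \<open>p\<close> is the real part of the functional
  \<open>x \<mapsto> p x - i p (i x)\<close>, and after a rotation of \<open>x\<close> the modulus of this functional is a value of \<open>p\<close>.
\<close>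

lemma norming_functional:
  fixes s :: "'k::real_or_complex \<Rightarrow> 'a::real_normed_vector \<Rightarrow> 'a" and x0 :: 'a
  assumes "normed_space_over s"
  obtains \<phi> where "\<phi> \<in> dual s" "norm \<phi> \<le> 1" "blinfun_apply \<phi> x0 = of_real (norm x0)"
proof -
  interpret normed_space_over s by fact
  obtain p where lin: "linear p" and le: "\<And>x. p x \<le> norm x" and p0: "p x0 = norm x0"
    using real_norming_functional[of x0] by blast
  interpret p: linear p by (rule lin)
  have abs_p: "\<bar>p x\<bar> \<le> norm x" for x using le[of x] le[of "- x"] p.neg[of x] by simp
  from real_or_complex[where 'a = 'k] show thesis
  proof
    assume real: "\<forall>z::'k. \<exists>a. z = a *\<^sub>R 1"
    define \<phi> where "\<phi> = Blinfun (\<lambda>x. of_real (p x) :: 'k)"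
    have "bounded_linear (\<lambda>x. of_real (p x) :: 'k)"
      by (rule bounded_linear_intro[where K = 1])
        (use abs_p in \<open>auto simp: p.add p.scaleR scaleR_conv_of_real\<close>)
    then have ap: "blinfun_apply \<phi> x = of_real (p x)" for x
      by (simp add: \<phi>_def bounded_linear_Blinfun_apply)
    have "blinfun_apply \<phi> (s c x) = c * blinfun_apply \<phi> x" for c x
    proof -
      obtain a where c: "c = of_real a" using real by (metis of_real_def)
      show ?thesis by (simp add: c ap scale_of_real p.scaleR)
    qed
    then have "\<phi> \<in> dual s" by (simp add: dual_def bounded_ops_def)
    moreover have "norm \<phi> \<le> 1" by (rule norm_blinfun_bound) (use abs_p in \<open>auto simp: ap\<close>)
    ultimately show thesis using that by (simp add: ap p0)
  next
    assume "\<exists>i::'k. i * i = - 1 \<and> (\<forall>z. \<exists>a b. z = a *\<^sub>R 1 + b *\<^sub>R i) \<and>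
          (\<forall>a b. norm (a *\<^sub>R 1 + b *\<^sub>R i) = sqrt (a\<^sup>2 + b\<^sup>2))"
    then obtain i :: 'k where ii: "i * i = - 1" and ex: "\<And>z::'k. \<exists>a b. z = a *\<^sub>R 1 + b *\<^sub>R i"
      and nrm: "\<And>a b. norm (a *\<^sub>R 1 + b *\<^sub>R i) = sqrt (a\<^sup>2 + b\<^sup>2)" by blast
    \<comment> \<open>scalar multiplication by \<open>i\<close> turns the values of \<open>p\<close> into imaginary parts\<close>
    define P where "P x = p x *\<^sub>R 1 + (- p (s i x)) *\<^sub>R i" for x
    have P_add: "P (x + y) = P x + P y" for x y
      by (simp add: P_def p.add scale_right_distrib scaleR_left_distrib algebra_simps)
    have sr: "s i (r *\<^sub>R x) = r *\<^sub>R s i x" for r x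
      by (metis scale_of_real scale_left_commute)
    have P_r: "P (r *\<^sub>R x) = r *\<^sub>R P x" for r x
      by (simp add: P_def sr p.scaleR scaleR_right_distrib scaleR_right_diff_distrib)
    have sii: "s i (s i x) = - x" for x
      by (simp add: ii)
    have P_i: "P (s i x) = i * P x" for x
    proof -
      have "i * P x = p x *\<^sub>R i + (- p (s i x)) *\<^sub>R (i * i)"
        by (simp add: P_def ring_distribs)
      then show ?thesis by (simp add: P_def sii p.neg ii)
    qed
    have P_c: "P (s c x) = c * P x" for c x
    proof -
      obtain a b where c: "c = a *\<^sub>R 1 + b *\<^sub>R i" using ex by blast
      have "s c x = a *\<^sub>R x + b *\<^sub>R s i x"
        unfolding c using scale_left_distrib[of "of_real a" "of_real b * i" x]
        by (metis scaleR_conv_of_real mult.right_neutral scale_of_real scale_scale)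
      then show ?thesis by (simp add: P_add P_r P_i c ring_distribs)
    qed
    have P_norm: "norm (P x) \<le> norm x" for x
    proof (cases "P x = 0")
      case False
      define n where "n = norm (P x)"
      have n: "n > 0" using False by (simp add: n_def)
      define u where "u = (p x / n) *\<^sub>R 1 + (p (s i x) / n) *\<^sub>R i"
      have nsq: "n\<^sup>2 = (p x)\<^sup>2 + (p (s i x))\<^sup>2" by (simp add: n_def P_def nrm[of "p x" "- p (s i x)", simplified])
      have "norm u = sqrt ((p x)\<^sup>2 / n\<^sup>2 + (p (s i x))\<^sup>2 / n\<^sup>2)" by (simp add: u_def nrm power_divide)
      also have "(p x)\<^sup>2 / n\<^sup>2 + (p (s i x))\<^sup>2 / n\<^sup>2 = n\<^sup>2 / n\<^sup>2"
        using arg_cong[OF nsq, of "\<lambda>z. z / n\<^sup>2"] by (simp only: add_divide_distrib)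
      also have "sqrt (n\<^sup>2 / n\<^sup>2) = 1" using n by simp
      finally have nu: "norm u = 1" .
      have "u * P x = ((p x)\<^sup>2 / n) *\<^sub>R 1 - ((p (s i x))\<^sup>2 / n) *\<^sub>R (i * i)"
        by (simp add: u_def P_def ring_distribs power2_eq_square mult.commute)
      also have "\<dots> = (n\<^sup>2 / n) *\<^sub>R 1" by (simp add: ii nsq add_divide_distrib scaleR_left_distrib)
      finally have "P (s u x) = n *\<^sub>R 1 + 0 *\<^sub>R i" using n by (simp add: P_c power2_eq_square)
      then have eq: "(p (s u x) - n) *\<^sub>R 1 + (- p (s i (s u x))) *\<^sub>R i = 0"
        by (simp add: P_def algebra_simps)
      then have "sqrt ((p (s u x) - n)\<^sup>2 + (p (s i (s u x)))\<^sup>2) = 0"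
        using nrm[of "p (s u x) - n" "- p (s i (s u x))"] by (metis norm_zero power2_minus)
      then have "p (s u x) = n" by (simp add: sum_power2_eq_zero_iff)
      then show ?thesis using le[of "s u x"] by (simp add: norm_scale nu n_def)
    qed simp
    define \<phi> where "\<phi> = Blinfun P"
    have "bounded_linear P" by (rule bounded_linear_intro[where K = 1]) (use P_norm in \<open>auto simp: P_add P_r\<close>)
    then have ap: "blinfun_apply \<phi> x = P x" for x
      by (simp add: \<phi>_def bounded_linear_Blinfun_apply)
    have "\<phi> \<in> dual s" by (simp add: dual_def bounded_ops_def ap P_c)
    moreover have "norm \<phi> \<le> 1" by (rule norm_blinfun_bound) (use P_norm in \<open>auto simp: ap\<close>)
    moreover have "P x0 = of_real (norm x0)"
    proof -
      have "sqrt ((norm x0)\<^sup>2 + (p (s i x0))\<^sup>2) \<le> norm x0"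
        using P_norm[of x0] nrm[of "p x0" "- p (s i x0)"] by (simp add: P_def p0)
      then have "(norm x0)\<^sup>2 + (p (s i x0))\<^sup>2 \<le> (norm x0)\<^sup>2"
        using real_sqrt_le_iff sqrt_le_D by blast
      then have "p (s i x0) = 0" by simp
      then show ?thesis by (simp add: P_def p0 of_real_def)
    qed
    ultimately show thesis using that by (simp add: ap)
  qed
qed


lemma dual_eqI:
  fixes s :: "'k::real_or_complex \<Rightarrow> 'a::real_normed_vector \<Rightarrow> 'a"
  assumes "normed_space_over s" and "\<And>\<phi>. \<phi> \<in> dual s \<Longrightarrow> blinfun_apply \<phi> x = blinfun_apply \<phi> y"
  shows "x = y"
proof -
  obtain \<phi> where "\<phi> \<in> dual s" "blinfun_apply \<phi> (x - y) = of_real (norm (x - y))"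
    using norming_functional[OF assms(1)] by metis
  then show ?thesis using assms(2)[of \<phi>] by (simp add: blinfun.diff_right)
qed

lemma norm_le_if_dual:
  fixes s :: "'k::real_or_complex \<Rightarrow> 'a::real_normed_vector \<Rightarrow> 'a"
  assumes "normed_space_over s"
    and "\<And>\<phi>. \<phi> \<in> dual s \<Longrightarrow> norm \<phi> \<le> 1 \<Longrightarrow> norm (blinfun_apply \<phi> x) \<le> c"
  shows "norm x \<le> c"
proof -
  obtain \<phi> where "\<phi> \<in> dual s" "norm \<phi> \<le> 1" "blinfun_apply \<phi> x = of_real (norm x)"
    using norming_functional[OF assms(1)] by metis
  then show ?thesis using assms(2)[of \<phi>] by simp
qed


section \<open>Bounded operators over the scalar field\<close>

context normed_space_over
begin

lemma scale_scaleR: "scale c (r *\<^sub>R x) = r *\<^sub>R scale c x"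
  by (metis scale_of_real scale_left_commute)

lemma scaleR_scale: "r *\<^sub>R scale c x = scale (of_real r * c) x"
  by (metis scale_of_real scale_scale)

lemma scale_scaleR_left: "scale (r *\<^sub>R c) x = r *\<^sub>R scale c x"
  by (simp add: scaleR_scale scaleR_conv_of_real)

lemma bounded_linear_scale: "bounded_linear (scale c)"
  by (rule bounded_linear_intro[where K = "norm c"])
    (auto simp: scale_right_distrib scale_scaleR norm_scale mult.commute)

lemma bounded_linear_scale_left: "bounded_linear (\<lambda>c. scale c x)"
  by (rule bounded_linear_intro[where K = "norm x"])
    (auto simp: scale_left_distrib scale_scaleR_left norm_scale)

end

lemma bounded_ops_scale:
  "T \<in> bounded_ops s t \<Longrightarrow> blinfun_apply T (s c x) = t c (blinfun_apply T x)"
  by (simp add: bounded_ops_def)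

lemma bounded_opsI:
  "(\<And>c x. blinfun_apply T (s c x) = t c (blinfun_apply T x)) \<Longrightarrow> T \<in> bounded_ops s t"
  by (simp add: bounded_ops_def)

lemma bounded_ops_id [simp]: "id_blinfun \<in> bounded_ops s s"
  by (rule bounded_opsI) simp

lemma bounded_ops_compose [simp]:
  "S \<in> bounded_ops t u \<Longrightarrow> T \<in> bounded_ops s t \<Longrightarrow> S o\<^sub>L T \<in> bounded_ops s u"
  by (simp add: bounded_ops_def)

lemma dual_compose: "\<phi> \<in> dual t \<Longrightarrow> T \<in> bounded_ops s t \<Longrightarrow> \<phi> o\<^sub>L T \<in> dual s"
  by (simp add: dual_def)

context
  fixes s :: "'k::real_or_complex \<Rightarrow> 'a::real_normed_vector \<Rightarrow> 'a"
    and t :: "'k \<Rightarrow> 'b::real_normed_vector \<Rightarrow> 'b"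
  assumes t: "normed_space_over t"
begin

interpretation t: normed_space_over t by (rule t)

lemma bounded_ops_zero: "0 \<in> bounded_ops s t"
  by (simp add: bounded_ops_def)

lemma bounded_ops_add: "S \<in> bounded_ops s t \<Longrightarrow> T \<in> bounded_ops s t \<Longrightarrow> S + T \<in> bounded_ops s t"
  by (simp add: bounded_ops_def blinfun.add_left t.scale_right_distrib)

lemma bounded_ops_diff: "S \<in> bounded_ops s t \<Longrightarrow> T \<in> bounded_ops s t \<Longrightarrow> S - T \<in> bounded_ops s t"
  by (simp add: bounded_ops_def blinfun.diff_left t.scale_right_diff_distrib)

lemma bounded_ops_scaleR: "S \<in> bounded_ops s t \<Longrightarrow> r *\<^sub>R S \<in> bounded_ops s t"
  by (simp add: bounded_ops_def blinfun.scaleR_left t.scale_scaleR)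

lemma bounded_ops_sum: "(\<And>i. i \<in> I \<Longrightarrow> S i \<in> bounded_ops s t) \<Longrightarrow> sum S I \<in> bounded_ops s t"
  by (induction I rule: infinite_finite_induct) (auto simp: bounded_ops_zero bounded_ops_add)

lemma bounded_ops_limit:
  assumes "S \<longlonglongrightarrow> L" and "\<And>n. S n \<in> bounded_ops s t"
  shows "L \<in> bounded_ops s t"
proof (rule bounded_opsI)
  fix c x
  have "(\<lambda>n. blinfun_apply (S n) (s c x)) \<longlonglongrightarrow> blinfun_apply L (s c x)"
    by (intro tendsto_intros assms)
  moreover have "(\<lambda>n. t c (blinfun_apply (S n) x)) \<longlonglongrightarrow> t c (blinfun_apply L x)"
    by (intro bounded_linear.tendsto[OF t.bounded_linear_scale] tendsto_intros assms)
  moreover have "(\<lambda>n. t c (blinfun_apply (S n) x)) = (\<lambda>n. blinfun_apply (S n) (s c x))"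
    using assms(2) by (simp add: bounded_ops_def)
  ultimately show "blinfun_apply L (s c x) = t c (blinfun_apply L x)"
    using LIMSEQ_unique by metis
qed

definition rank_one :: "('a \<Rightarrow>\<^sub>L 'k) \<Rightarrow> 'b \<Rightarrow> 'a \<Rightarrow>\<^sub>L 'b" where
  "rank_one \<phi> e = Blinfun (\<lambda>x. t (blinfun_apply \<phi> x) e)"

lemma rank_one_apply: "blinfun_apply (rank_one \<phi> e) x = t (blinfun_apply \<phi> x) e"
  unfolding rank_one_def
  by (subst bounded_linear_Blinfun_apply)
    (auto intro: bounded_linear_compose[OF t.bounded_linear_scale_left] blinfun.bounded_linear_right)

lemma rank_one_op: "\<phi> \<in> dual s \<Longrightarrow> rank_one \<phi> e \<in> bounded_ops s t"
  by (rule bounded_opsI) (simp add: rank_one_apply dual_def bounded_ops_def)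

lemma norm_rank_one_le: "norm (rank_one \<phi> e) \<le> norm \<phi> * norm e"
proof (rule norm_blinfun_bound)
  fix x
  have "norm (blinfun_apply \<phi> x) * norm e \<le> (norm \<phi> * norm x) * norm e"
    by (intro mult_right_mono norm_blinfun) simp
  then show "norm (blinfun_apply (rank_one \<phi> e) x) \<le> norm \<phi> * norm e * norm x"
    by (simp add: rank_one_apply t.norm_scale mult_ac)
qed simp

end

lemma bounded_ops_linear:
  fixes s :: "'k::real_or_complex \<Rightarrow> 'a::real_normed_vector \<Rightarrow> 'a"
  assumes "normed_space_over s" "normed_space_over t" "T \<in> bounded_ops s t"
  shows "Vector_Spaces.linear s t (blinfun_apply T)"
proof -
  interpret s: normed_space_over s by fact
  interpret t: normed_space_over t by fact
  show ?thesis
    unfolding Vector_Spaces.linear_iff using assms(3) s.vector_space_axioms t.vector_space_axioms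
    by (auto simp: blinfun.add_right bounded_ops_scale)
qed

lemma dual_scale_apply [simp]: "blinfun_apply (dual_scale c \<phi>) x = c * blinfun_apply \<phi> x"
  by (simp add: dual_scale_def)


section \<open>Operators on subsets and adjoints\<close>

lemma opnorm_on_le:
  assumes "\<And>x. x \<in> M \<Longrightarrow> norm (\<psi> x) \<le> c * norm x" and "0 \<le> c"
  shows "opnorm_on M \<psi> \<le> ennreal c"
  unfolding opnorm_on_def
proof (rule SUP_least)
  fix x assume "x \<in> M"
  then show "ennreal (norm (\<psi> x) / norm x) \<le> ennreal c"
    using assms by (cases "x = 0") (auto intro!: ennreal_leI simp: field_simps)
qed

lemma opnorm_on_bound:
  assumes "opnorm_on M \<psi> < \<infinity>" "x \<in> M" "x = 0 \<Longrightarrow> \<psi> x = 0"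
  shows "norm (\<psi> x) \<le> enn2real (opnorm_on M \<psi>) * norm x"
proof (cases "x = 0")
  case False
  have "ennreal (norm (\<psi> x) / norm x) \<le> opnorm_on M \<psi>"
    unfolding opnorm_on_def by (rule SUP_upper) (rule assms)
  also have "\<dots> = ennreal (enn2real (opnorm_on M \<psi>))" using assms(1) by simp
  finally show ?thesis using False by (simp add: field_simps)
qed (use assms in auto)

lemma klinear_on_zero:
  fixes t :: "'k::real_or_complex \<Rightarrow> 'b::real_normed_vector \<Rightarrow> 'b"
  assumes "klinear_on s t M \<psi>" "0 \<in> M"
  shows "\<psi> 0 = 0"
proof -
  have "\<psi> (0 + 0) = \<psi> 0 + \<psi> 0" using assms unfolding klinear_on_def by blast
  then show ?thesis by simp
qed

text \<open>
  A bounded operator between duals is an adjoint if the predual of its domain is reflexive: for each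
  \<open>x\<close> the functional \<open>\<phi> \<mapsto> H \<phi> x\<close> is evaluation at a point, and this point depends linearly on \<open>x\<close>
  because the dual separates points.
\<close>

lemma predual_operator:
  fixes s :: "'k::real_or_complex \<Rightarrow> 'a::real_normed_vector \<Rightarrow> 'a"
    and t :: "'k \<Rightarrow> 'b::real_normed_vector \<Rightarrow> 'b"
  assumes s: "normed_space_over s" and t: "normed_space_over t" and refl: "reflexive_space t"
    and H: "\<And>\<phi>. \<phi> \<in> dual t \<Longrightarrow> H \<phi> \<in> dual s"
    and lin: "klinear_on dual_scale dual_scale (dual t) H"
    and bound: "\<And>\<phi>. \<phi> \<in> dual t \<Longrightarrow> norm (H \<phi>) \<le> c * norm \<phi>" and c: "0 \<le> c"
  obtains A where "A \<in> bounded_ops s t" "norm A \<le> c"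
    "\<And>\<phi> x. \<phi> \<in> dual t \<Longrightarrow> blinfun_apply \<phi> (blinfun_apply A x) = blinfun_apply (H \<phi>) x"
proof -
  interpret s: normed_space_over s by fact
  interpret t: normed_space_over t by fact
  have ex: "\<exists>y. \<forall>\<phi>\<in>dual t. blinfun_apply (H \<phi>) x = blinfun_apply \<phi> y" for x
  proof -
    define F where "F \<phi> = blinfun_apply (H \<phi>) x" for \<phi>
    have "klinear_on dual_scale (*) (dual t) F"
      using lin by (auto simp: klinear_on_def F_def blinfun.add_left)
    moreover have "opnorm_on (dual t) F \<le> ennreal (c * norm x)"
    proof (rule opnorm_on_le)
      fix \<phi> assume \<phi>: "\<phi> \<in> dual t"
      have "norm (F \<phi>) \<le> norm (H \<phi>) * norm x" unfolding F_def by (rule norm_blinfun)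
      also have "\<dots> \<le> (c * norm \<phi>) * norm x" by (intro mult_right_mono bound \<phi>) simp
      finally show "norm (F \<phi>) \<le> c * norm x * norm \<phi>" by (simp add: mult_ac)
    qed (use c in auto)
    then have "opnorm_on (dual t) F < \<infinity>"
      using ennreal_less_top infinity_ennreal_def le_less_trans by metis
    ultimately show ?thesis using refl unfolding reflexive_space_def F_def by blast
  qed
  define A where "A x = (SOME y. \<forall>\<phi>\<in>dual t. blinfun_apply (H \<phi>) x = blinfun_apply \<phi> y)" for x
  have A: "blinfun_apply \<phi> (A x) = blinfun_apply (H \<phi>) x" if "\<phi> \<in> dual t" for \<phi> x
    using someI_ex[OF ex[of x]] that unfolding A_def by simp
  have sc: "A (s k x) = t k (A x)" for k x
  proof (rule dual_eqI[OF t])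
    fix \<phi> assume "\<phi> \<in> dual t"
    then show "blinfun_apply \<phi> (A (s k x)) = blinfun_apply \<phi> (t k (A x))"
      using H[of \<phi>] A by (auto simp: dual_def bounded_ops_def)
  qed
  have nrm: "norm (A x) \<le> c * norm x" for x
  proof (rule norm_le_if_dual[OF t])
    fix \<phi> assume \<phi>: "\<phi> \<in> dual t" "norm \<phi> \<le> 1"
    have "norm (blinfun_apply \<phi> (A x)) \<le> norm (H \<phi>) * norm x" by (simp add: A \<phi> norm_blinfun)
    also have "\<dots> \<le> (c * norm \<phi>) * norm x" by (intro mult_right_mono bound \<phi>) simp
    also have "\<dots> \<le> (c * 1) * norm x" by (intro mult_right_mono mult_left_mono \<phi> c) simp
    finally show "norm (blinfun_apply \<phi> (A x)) \<le> c * norm x" by simp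
  qed
  have "bounded_linear A"
  proof (rule bounded_linear_intro[where K = c])
    show "A (x + y) = A x + A y" for x y
      by (rule dual_eqI[OF t]) (simp add: A blinfun.add_right)
    show "A (r *\<^sub>R x) = r *\<^sub>R A x" for r x
      by (rule dual_eqI[OF t]) (simp add: A blinfun.scaleR_right)
    show "norm (A x) \<le> norm x * c" for x using nrm[of x] by (simp add: mult.commute)
  qed
  then have ap: "blinfun_apply (Blinfun A) = A" by (rule bounded_linear_Blinfun_apply)
  show thesis
  proof (rule that[of "Blinfun A"])
    show "Blinfun A \<in> bounded_ops s t" by (rule bounded_opsI) (simp add: ap sc)
    show "norm (Blinfun A) \<le> c" by (rule norm_blinfun_bound[OF c]) (simp add: ap nrm)
  qed (simp add: ap A)
qed


section \<open>Biorthogonal systems and finite rank\<close>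

text \<open>
  The pairing is between a subspace \<open>V\<close> and a subspace \<open>D\<close> that separates the points of \<open>V\<close>; it is
  applied with \<open>D\<close> the dual space, and, the roles being exchanged, with \<open>V\<close> the dual space.
\<close>

lemma biorthogonal_system:
  fixes s1 :: "'k::field \<Rightarrow> 'a::ab_group_add \<Rightarrow> 'a" and s2 :: "'k \<Rightarrow> 'b::ab_group_add \<Rightarrow> 'b"
    and pr :: "'b \<Rightarrow> 'a \<Rightarrow> 'k"
  assumes "vector_space s1" and "vector_space s2"
    and V: "module.subspace s1 V" and D: "module.subspace s2 D"
    and lin1: "\<And>d x y c. d \<in> D \<Longrightarrow> x \<in> V \<Longrightarrow> y \<in> V \<Longrightarrow> pr d (x + s1 c y) = pr d x + c * pr d y"
    and lin2: "\<And>d e x c. d \<in> D \<Longrightarrow> e \<in> D \<Longrightarrow> x \<in> V \<Longrightarrow> pr (d + s2 c e) x = pr d x + c * pr e x"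
    and sep: "\<And>x. x \<in> V \<Longrightarrow> x \<noteq> 0 \<Longrightarrow> \<exists>d\<in>D. pr d x \<noteq> 0"
    and B: "finite B" "\<not> module.dependent s1 B" "B \<subseteq> V"
  shows "\<exists>\<beta>. (\<forall>b\<in>B. \<beta> b \<in> D) \<and> (\<forall>b\<in>B. \<forall>c\<in>B. pr (\<beta> b) c = (if b = c then 1 else 0))"
  using B
proof (induction B rule: finite_induct)
  case empty
  then show ?case by simp
next
  interpret s1: vector_space s1 by fact
  interpret s2: vector_space s2 by fact
  case (insert a B)
  have indep: "\<not> s1.dependent B" and a: "a \<notin> s1.span B"
    using insert.prems insert.hyps by (auto simp: s1.independent_insert)
  obtain \<beta> where \<beta>: "\<And>b. b \<in> B \<Longrightarrow> \<beta> b \<in> D"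
    "\<And>b c. b \<in> B \<Longrightarrow> c \<in> B \<Longrightarrow> pr (\<beta> b) c = (if b = c then 1 else 0)"
    using insert.IH indep insert.prems by blast
  have aV: "a \<in> V" and BV: "B \<subseteq> V" using insert.prems by auto
  have pr_sum: "pr d (x + (\<Sum>i\<in>I. s1 (f i) i)) = pr d x + (\<Sum>i\<in>I. f i * pr d i)"
    if "d \<in> D" "x \<in> V" "I \<subseteq> V" "finite I" for d x f I
    using that(4,3)
  proof (induction I rule: finite_induct)
    case (insert i I)
    have "x + (\<Sum>i\<in>I. s1 (f i) i) \<in> V"
      using that insert.prems by (intro s1.subspace_add s1.subspace_sum s1.subspace_scale V) auto
    then have "pr d ((x + (\<Sum>i\<in>I. s1 (f i) i)) + s1 (f i) i) = pr d (x + (\<Sum>i\<in>I. s1 (f i) i)) + f i * pr d i"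
      using lin1 that insert.prems by auto
    then show ?case using insert by (simp add: algebra_simps)
  qed simp
  have pr_sum2: "pr (d + (\<Sum>b\<in>I. s2 (f b) (\<beta> b))) x = pr d x + (\<Sum>b\<in>I. f b * pr (\<beta> b) x)"
    if "d \<in> D" "x \<in> V" "finite I" "I \<subseteq> B" for d x f I
    using that(3,4)
  proof (induction I rule: finite_induct)
    case (insert i I)
    have "d + (\<Sum>b\<in>I. s2 (f b) (\<beta> b)) \<in> D"
      using that insert.prems \<beta> by (intro s2.subspace_add s2.subspace_sum s2.subspace_scale D) auto
    then have "pr ((d + (\<Sum>b\<in>I. s2 (f b) (\<beta> b))) + s2 (f i) (\<beta> i)) x
        = pr (d + (\<Sum>b\<in>I. s2 (f b) (\<beta> b))) x + f i * pr (\<beta> i) x"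
      using lin2 that insert.prems \<beta> by auto
    then show ?case using insert by (simp add: algebra_simps)
  qed simp
  define v where "v = a + (\<Sum>b\<in>B. s1 (- pr (\<beta> b) a) b)"
  have vV: "v \<in> V" unfolding v_def
    using aV BV by (intro s1.subspace_add s1.subspace_sum s1.subspace_scale V) auto
  have "v \<noteq> 0"
  proof
    assume "v = 0"
    then have "a = - (\<Sum>b\<in>B. s1 (- pr (\<beta> b) a) b)" unfolding v_def by (simp add: eq_neg_iff_add_eq_0)
    moreover have "- (\<Sum>b\<in>B. s1 (- pr (\<beta> b) a) b) \<in> s1.span B"
      by (intro s1.span_neg s1.span_sum s1.span_scale s1.span_base)
    ultimately show False using a by simp
  qed
  then obtain d where d: "d \<in> D" "pr d v \<noteq> 0" using sep vV by blast
  define e where "e = d + (\<Sum>b\<in>B. s2 (- pr d b) (\<beta> b))"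
  have eD: "e \<in> D" unfolding e_def
    using d \<beta> by (intro s2.subspace_add s2.subspace_sum s2.subspace_scale D) auto
  have e: "pr e x = pr d x + (\<Sum>b\<in>B. - pr d b * pr (\<beta> b) x)" if "x \<in> V" for x
    unfolding e_def using pr_sum2[OF d(1) that insert.hyps(1) subset_refl] .
  have e0: "pr e c = 0" if "c \<in> B" for c
    using e[of c] that BV \<beta>(2) insert.hyps(1) by (simp add: sum_negf if_distrib sum.delta cong: if_cong) (auto simp: sum.delta)
  have ea: "pr e a = pr d v"
  proof -
    have "pr d v = pr d a + (\<Sum>b\<in>B. - pr (\<beta> b) a * pr d b)"
      unfolding v_def by (rule pr_sum[OF d(1) aV BV insert.hyps(1)])
    then show ?thesis using e[OF aV] by (simp add: mult.commute)
  qed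
  define \<gamma> where "\<gamma> b = (if b = a then s2 (inverse (pr d v)) e
      else \<beta> b + s2 (- pr (\<beta> b) a / pr d v) e)" for b
  have pr_scale: "pr (s2 c e) x = c * pr e x" if "x \<in> V" for c x
  proof -
    have "pr (e + s2 (c - 1) e) x = pr e x + (c - 1) * pr e x" using lin2 eD that by blast
    then show ?thesis by (simp add: s2.scale_left_diff_distrib algebra_simps)
  qed
  show ?case
  proof (intro exI[of _ \<gamma>] conjI ballI)
    fix b assume b: "b \<in> insert a B"
    show "\<gamma> b \<in> D" using b \<beta>(1) eD D
      by (auto simp: \<gamma>_def intro!: s2.subspace_diff s2.subspace_scale)
    fix c assume c: "c \<in> insert a B"
    have cV: "c \<in> V" using c aV BV by auto
    show "pr (\<gamma> b) c = (if b = c then 1 else 0)"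
    proof (cases "b = a")
      case True
      then show ?thesis using c pr_scale[OF cV] e0 ea d insert.hyps by (auto simp: \<gamma>_def)
    next
      case False
      then have bB: "b \<in> B" using b by simp
      have "pr (\<gamma> b) c = pr (\<beta> b) c + (- pr (\<beta> b) a / pr d v) * pr e c"
        using False lin2[OF \<beta>(1)[OF bB] eD cV, of "- pr (\<beta> b) a / pr d v"] by (simp add: \<gamma>_def)
      then show ?thesis using c False bB \<beta>(2) e0 ea d insert.hyps by (cases "c = a") auto
    qed
  qed
qed


text \<open>A spanning set of the range, rather than the dimension, because such bounds pass to compositions
  at once.\<close>

definition rank_le :: "('k::real_or_complex \<Rightarrow> 'b::real_normed_vector \<Rightarrow> 'b) \<Rightarrow>
    ('a::real_normed_vector \<Rightarrow>\<^sub>L 'b) \<Rightarrow> nat \<Rightarrow> bool" where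
  "rank_le t A n \<longleftrightarrow> (\<exists>B. finite B \<and> card B \<le> n \<and> range (blinfun_apply A) \<subseteq> module.span t B)"

lemma (in vector_space) finite_spanned_subspace:
  assumes "subspace V" "V \<subseteq> span B" "finite B"
  obtains C where "finite C" "C \<subseteq> V" "independent C" "span C = V" "card C = dim V" "dim V \<le> card B"
proof -
  obtain C where C: "C \<subseteq> V" "independent C" "V \<subseteq> span C" "card C = dim V"
    using basis_exists by blast
  then have "finite C" "card C \<le> card B" using independent_span_bound[OF assms(3), of C] assms(2) by auto
  then show thesis using C assms that span_subspace[of C V] by auto
qed

lemma rank_le_compose_right: "rank_le t A n \<Longrightarrow> rank_le t (A o\<^sub>L S) n"
  unfolding rank_le_def by (auto simp: image_subset_iff)

lemma rank_le_mono: "rank_le t A n \<Longrightarrow> n \<le> m \<Longrightarrow> rank_le t A m"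
  unfolding rank_le_def by (meson order_trans)

lemma rank_le_compose_left:
  fixes t :: "'k::real_or_complex \<Rightarrow> 'b::real_normed_vector \<Rightarrow> 'b"
  assumes "normed_space_over t" "normed_space_over u" "A \<in> bounded_ops t u" "rank_le t S n"
  shows "rank_le u (A o\<^sub>L S) n"
proof -
  interpret t: normed_space_over t by fact
  interpret u: normed_space_over u by fact
  obtain B where B: "finite B" "card B \<le> n" "range (blinfun_apply S) \<subseteq> t.span B"
    using assms(4) by (auto simp: rank_le_def)
  interpret lin: Vector_Spaces.linear t u "blinfun_apply A"
    by (rule bounded_ops_linear) fact+
  have "range (blinfun_apply (A o\<^sub>L S)) \<subseteq> u.span (blinfun_apply A ` B)"
    using B(3) by (auto simp: lin.span_image)
  then show ?thesis unfolding rank_le_def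
    using B card_image_le[OF B(1), of "blinfun_apply A"] by (meson finite_imageI order_trans)
qed

lemma subspace_range_op:
  fixes s :: "'k::real_or_complex \<Rightarrow> 'a::real_normed_vector \<Rightarrow> 'a"
  assumes "normed_space_over s" "normed_space_over t" "A \<in> bounded_ops s t"
  shows "module.subspace t (range (blinfun_apply A))"
proof -
  interpret s: normed_space_over s by fact
  interpret lin: Vector_Spaces.linear s t "blinfun_apply A"
    by (rule bounded_ops_linear) fact+
  show ?thesis by (rule lin.subspace_image[OF s.subspace_UNIV])
qed

lemma rank_le_dim:
  fixes s :: "'k::real_or_complex \<Rightarrow> 'a::real_normed_vector \<Rightarrow> 'a"
  assumes "normed_space_over s" "normed_space_over t" "A \<in> bounded_ops s t" "rank_le t A n"
  shows "fin_dim_subspace t (range (blinfun_apply A))"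
    and "vector_space.dim t (range (blinfun_apply A)) \<le> n"
proof -
  interpret t: normed_space_over t by fact
  obtain B where B: "finite B" "card B \<le> n" "range (blinfun_apply A) \<subseteq> t.span B"
    using assms(4) by (auto simp: rank_le_def)
  obtain C where "finite C" "t.span C = range (blinfun_apply A)"
      "t.dim (range (blinfun_apply A)) \<le> card B"
    using t.finite_spanned_subspace[OF subspace_range_op[OF assms(1-3)] B(3,1)] by metis
  then show "fin_dim_subspace t (range (blinfun_apply A))" "t.dim (range (blinfun_apply A)) \<le> n"
    using B(2) by (auto simp: fin_dim_subspace_def)
qed

lemma rank_le_dim_range:
  assumes "normed_space_over t" "fin_dim_subspace t (range (blinfun_apply A))"
  shows "rank_le t A (vector_space.dim t (range (blinfun_apply A)))"
proof -
  interpret t: normed_space_over t by fact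
  obtain B where B: "finite B" "t.span B = range (blinfun_apply A)"
    using assms(2) by (auto simp: fin_dim_subspace_def)
  have "t.subspace (range (blinfun_apply A))" using B(2) t.subspace_span by metis
  then obtain C where "finite C" "t.span C = range (blinfun_apply A)"
      "card C = t.dim (range (blinfun_apply A))"
    using t.finite_spanned_subspace[of "range (blinfun_apply A)" B] B by (metis subset_refl)
  then show ?thesis unfolding rank_le_def by (metis order_refl)
qed

lemma dual_biorthogonal:
  fixes s :: "'k::real_or_complex \<Rightarrow> 'a::real_normed_vector \<Rightarrow> 'a"
  assumes "normed_space_over s" "finite B" "\<not> module.dependent s B"
  obtains \<beta> where "\<And>b. b \<in> B \<Longrightarrow> \<beta> b \<in> dual s"
    "\<And>b c. b \<in> B \<Longrightarrow> c \<in> B \<Longrightarrow> blinfun_apply (\<beta> b) c = (if b = c then 1 else 0)"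
proof -
  interpret s: normed_space_over s by fact
  interpret d: normed_space_over "dual_scale :: 'k \<Rightarrow> ('a \<Rightarrow>\<^sub>L 'k) \<Rightarrow> _"
    by (rule normed_space_over_dual_scale)
  have sep: "\<exists>d\<in>dual s. blinfun_apply d x \<noteq> 0" if x: "x \<noteq> 0" for x
  proof -
    obtain \<phi> where \<phi>: "\<phi> \<in> dual s" "blinfun_apply \<phi> x = of_real (norm x)"
      using norming_functional[OF assms(1)] by metis
    show ?thesis using x by (intro bexI[OF _ \<phi>(1)]) (simp add: \<phi>(2))
  qed
  have "\<exists>\<beta>. (\<forall>b\<in>B. \<beta> b \<in> dual s) \<and>
      (\<forall>b\<in>B. \<forall>c\<in>B. blinfun_apply (\<beta> b) c = (if b = c then 1 else 0))"
    by (rule biorthogonal_system[OF s.vector_space_axioms d.vector_space_axioms s.subspace_UNIV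
          subspace_dual[of s]])
      (use assms(2,3) sep in \<open>simp_all add: blinfun.add_right blinfun.add_left dual_def bounded_ops_def\<close>)
  then show thesis using that by blast
qed

lemma predual_biorthogonal:
  fixes s :: "'k::real_or_complex \<Rightarrow> 'a::real_normed_vector \<Rightarrow> 'a"
  assumes "normed_space_over s" "finite F" "\<not> module.dependent dual_scale F" "F \<subseteq> dual s"
  obtains e where
    "\<And>\<phi> \<psi>. \<phi> \<in> F \<Longrightarrow> \<psi> \<in> F \<Longrightarrow> blinfun_apply \<psi> (e \<phi>) = (if \<phi> = \<psi> then 1 else 0)"
proof -
  interpret s: normed_space_over s by fact
  interpret d: normed_space_over "dual_scale :: 'k \<Rightarrow> ('a \<Rightarrow>\<^sub>L 'k) \<Rightarrow> _"
    by (rule normed_space_over_dual_scale)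
  have sep: "\<exists>x\<in>UNIV. blinfun_apply \<phi> x \<noteq> 0" if "\<phi> \<noteq> 0" for \<phi> :: "'a \<Rightarrow>\<^sub>L 'k"
    using that by (metis UNIV_I blinfun_eqI zero_blinfun.rep_eq)
  have "\<exists>\<beta>. (\<forall>b\<in>F. \<beta> b \<in> UNIV) \<and>
      (\<forall>b\<in>F. \<forall>c\<in>F. blinfun_apply c (\<beta> b) = (if b = c then 1 else 0))"
    by (rule biorthogonal_system[OF d.vector_space_axioms s.vector_space_axioms subspace_dual[of s]
          s.subspace_UNIV, where pr = "\<lambda>x \<phi>. blinfun_apply \<phi> x"])
      (use assms(2-4) sep in \<open>simp_all add: blinfun.add_right blinfun.add_left dual_def bounded_ops_def\<close>)
  then show thesis using that by blast
qed

lemma finite_rank_decomposition: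
  fixes s :: "'k::real_or_complex \<Rightarrow> 'a::real_normed_vector \<Rightarrow> 'a"
  assumes "normed_space_over s" "normed_space_over t" "A \<in> bounded_ops s t" "rank_le t A n"
  obtains B \<beta> where "finite B" "card B \<le> n" "\<And>b. b \<in> B \<Longrightarrow> \<beta> b \<in> dual s"
    "A = (\<Sum>b\<in>B. rank_one t (\<beta> b) b)"
proof -
  interpret t: normed_space_over t by fact
  obtain D where D: "finite D" "card D \<le> n" "range (blinfun_apply A) \<subseteq> t.span D"
    using assms(4) by (auto simp: rank_le_def)
  obtain B where B: "finite B" "t.independent B" "t.span B = range (blinfun_apply A)" "card B \<le> n"
  proof (rule t.finite_spanned_subspace[OF subspace_range_op[OF assms(1-3)] D(3,1)])
    fix B assume "finite B" "t.independent B" "t.span B = range (blinfun_apply A)"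
      "card B = t.dim (range (blinfun_apply A))" "t.dim (range (blinfun_apply A)) \<le> card D"
    then show thesis using D(2) by (intro that[of B]) auto
  qed
  obtain \<beta> where \<beta>: "\<And>b. b \<in> B \<Longrightarrow> \<beta> b \<in> dual t"
    "\<And>b c. b \<in> B \<Longrightarrow> c \<in> B \<Longrightarrow> blinfun_apply (\<beta> b) c = (if b = c then 1 else 0)"
    using dual_biorthogonal[OF assms(2) B(1,2)] by blast
  have A: "A = (\<Sum>b\<in>B. rank_one t (\<beta> b o\<^sub>L A) b)"
  proof (rule blinfun_eqI)
    fix x
    have "blinfun_apply A x \<in> t.span B" using B(3) by auto
    then obtain c where c: "blinfun_apply A x = (\<Sum>b\<in>B. t (c b) b)"
      using t.span_finite[OF B(1)] by auto
    have "blinfun_apply (\<beta> b) (blinfun_apply A x) = c b" if b: "b \<in> B" for b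
    proof -
      have "blinfun_apply (\<beta> b) (t z b') = z * blinfun_apply (\<beta> b) b'" for z b'
        using \<beta>(1)[OF b] by (simp add: dual_def bounded_ops_def)
      then have "blinfun_apply (\<beta> b) (blinfun_apply A x) = (\<Sum>b'\<in>B. c b' * blinfun_apply (\<beta> b) b')"
        by (simp only: c blinfun.sum_right)
      also have "\<dots> = (\<Sum>b'\<in>B. if b = b' then c b' else 0)"
        by (intro sum.cong refl) (simp add: \<beta>(2)[OF b])
      also have "\<dots> = c b" using b B(1) by simp
      finally show ?thesis .
    qed
    then have "(\<Sum>b\<in>B. t (blinfun_apply (\<beta> b) (blinfun_apply A x)) b) = blinfun_apply A x"
      unfolding c by (intro sum.cong refl) simp
    then show "blinfun_apply A x = blinfun_apply (\<Sum>b\<in>B. rank_one t (\<beta> b o\<^sub>L A) b) x"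
      by (simp add: blinfun.sum_left rank_one_apply[OF assms(2)])
  qed
  show thesis
    by (rule that[OF B(1,4) _ A]) (rule dual_compose[OF \<beta>(1) assms(3)])
qed

text \<open>So finitely many functionals, as many as the rank, detect when a finite-rank operator is
  unchanged by an operator acting first.\<close>

lemma finite_rank_functionals:
  fixes s :: "'k::real_or_complex \<Rightarrow> 'a::real_normed_vector \<Rightarrow> 'a"
  assumes "normed_space_over s" "normed_space_over t" "A \<in> bounded_ops s t" "rank_le t A n"
  obtains F where "finite F" "card F \<le> n" "F \<subseteq> dual s"
    "\<And>R. (\<And>\<phi>. \<phi> \<in> F \<Longrightarrow> \<phi> o\<^sub>L R = \<phi>) \<Longrightarrow> A o\<^sub>L R = A"
proof -
  obtain B \<beta> where B: "finite B" "card B \<le> n" "\<And>b. b \<in> B \<Longrightarrow> \<beta> b \<in> dual s"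
    "A = (\<Sum>b\<in>B. rank_one t (\<beta> b) b)"
    using finite_rank_decomposition[OF assms] by metis
  show thesis
  proof (rule that[of "\<beta> ` B"])
    show "finite (\<beta> ` B)" "\<beta> ` B \<subseteq> dual s" using B by auto
    show "card (\<beta> ` B) \<le> n" using card_image_le[OF B(1), of \<beta>] B(2) by simp
    fix R assume R: "\<And>\<phi>. \<phi> \<in> \<beta> ` B \<Longrightarrow> \<phi> o\<^sub>L R = \<phi>"
    have "blinfun_apply (\<beta> b) (blinfun_apply R x) = blinfun_apply (\<beta> b) x" if "b \<in> B" for b x
      using R[of "\<beta> b"] that by (metis blinfun_apply_blinfun_compose imageI)
    then show "A o\<^sub>L R = A"
      by (intro blinfun_eqI) (simp add: B(4) blinfun.sum_left rank_one_apply[OF assms(2)])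
  qed
qed


section \<open>Compact operators\<close>

lemma compact_opI:
  assumes "compact K" "blinfun_apply T ` cball 0 1 \<subseteq> K"
  shows "compact_op T"
proof -
  have "closure (blinfun_apply T ` cball 0 1) \<subseteq> K"
    by (rule closure_minimal[OF assms(2) compact_imp_closed[OF assms(1)]])
  then have eq: "K \<inter> closure (blinfun_apply T ` cball 0 1) = closure (blinfun_apply T ` cball 0 1)" by blast
  show ?thesis unfolding compact_op_def
    using compact_Int_closed[OF assms(1) closed_closure, of "blinfun_apply T ` cball 0 1"] by (simp only: eq)
qed

lemma compact_op_add:
  assumes "compact_op A" "compact_op B"
  shows "compact_op (A + B)"
proof -
  let ?S = "\<lambda>T. closure (blinfun_apply T ` cball 0 1)"
  have c: "compact {x + y | x y. x \<in> ?S A \<and> y \<in> ?S B}"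
    using assms by (intro compact_sums) (auto simp: compact_op_def)
  show ?thesis
  proof (rule compact_opI[OF c], safe)
    fix v :: 'a assume "v \<in> cball 0 1"
    then have "blinfun_apply A v \<in> ?S A" "blinfun_apply B v \<in> ?S B"
      by (auto intro: closure_subset[THEN subsetD])
    then show "\<exists>x y. blinfun_apply (A + B) v = x + y \<and> x \<in> ?S A \<and> y \<in> ?S B"
      by (auto simp: blinfun.add_left)
  qed
qed

text \<open>The class of scalars contains all isometric copies of the two fields, so compactness is obtained
  from real coordinates.\<close>

lemma compact_scalar_ball: "compact (cball (0::'k::real_or_complex) r)"
proof -
  have "\<exists>K. compact K \<and> cball (0::'k) r \<subseteq> K"
    using real_or_complex[where 'a = 'k]
  proof
    assume real: "\<forall>z::'k. \<exists>a. z = a *\<^sub>R 1"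
    have "cball (0::'k) r \<subseteq> (\<lambda>a. a *\<^sub>R 1) ` {- r..r}"
    proof
      fix z :: 'k assume z: "z \<in> cball 0 r"
      obtain a where "z = a *\<^sub>R 1" using real by blast
      with z show "z \<in> (\<lambda>a. a *\<^sub>R 1) ` {- r..r}" by (auto simp: abs_le_iff)
    qed
    moreover have "compact ((\<lambda>a. a *\<^sub>R (1::'k)) ` {- r..r})"
      by (intro compact_continuous_image continuous_intros) simp
    ultimately show ?thesis by blast
  next
    assume "\<exists>i::'k. i * i = - 1 \<and> (\<forall>z. \<exists>a b. z = a *\<^sub>R 1 + b *\<^sub>R i) \<and>
          (\<forall>a b. norm (a *\<^sub>R 1 + b *\<^sub>R i) = sqrt (a\<^sup>2 + b\<^sup>2))"
    then obtain i :: 'k where ex: "\<And>z::'k. \<exists>a b. z = a *\<^sub>R 1 + b *\<^sub>R i"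
      and nrm: "\<And>a b. norm (a *\<^sub>R 1 + b *\<^sub>R i) = sqrt (a\<^sup>2 + b\<^sup>2)" by blast
    have "cball (0::'k) r \<subseteq> (\<lambda>(a, b). a *\<^sub>R 1 + b *\<^sub>R i) ` ({- r..r} \<times> {- r..r})"
    proof
      fix z :: 'k assume z: "z \<in> cball 0 r"
      obtain a b where ab: "z = a *\<^sub>R 1 + b *\<^sub>R i" using ex by blast
      have "sqrt (a\<^sup>2 + b\<^sup>2) \<le> r" using z nrm ab by simp
      moreover have "\<bar>a\<bar> \<le> sqrt (a\<^sup>2 + b\<^sup>2)" "\<bar>b\<bar> \<le> sqrt (a\<^sup>2 + b\<^sup>2)"
        by (rule real_le_rsqrt; simp)+
      ultimately have "- r \<le> a" "a \<le> r" "- r \<le> b" "b \<le> r" by linarith+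
      then show "z \<in> (\<lambda>(a, b). a *\<^sub>R 1 + b *\<^sub>R i) ` ({- r..r} \<times> {- r..r})"
        unfolding ab by (intro image_eqI[of _ _ "(a, b)"]) auto
    qed
    moreover have "compact ((\<lambda>(a, b). a *\<^sub>R (1::'k) + b *\<^sub>R i) ` ({- r..r} \<times> {- r..r}))"
      by (intro compact_continuous_image compact_Times)
        (auto simp: case_prod_beta intro!: continuous_intros)
    ultimately show ?thesis by blast
  qed
  then show ?thesis using compact_Int_closed[OF _ closed_cball] by (metis inf.absorb2)
qed

lemma compact_op_rank_one:
  fixes t :: "'k::real_or_complex \<Rightarrow> 'b::real_normed_vector \<Rightarrow> 'b"
  assumes "normed_space_over t"
  shows "compact_op (rank_one t \<phi> e)"
proof -
  interpret t: normed_space_over t by fact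
  have K: "compact ((\<lambda>c. t c e) ` cball 0 (norm \<phi>))"
    using linear_continuous_on[OF t.bounded_linear_scale_left]
    by (intro compact_continuous_image compact_scalar_ball) blast
  show ?thesis
  proof (rule compact_opI[OF K], rule subsetI)
    fix y assume "y \<in> blinfun_apply (rank_one t \<phi> e) ` cball 0 1"
    then obtain x where x: "norm x \<le> 1" "y = t (blinfun_apply \<phi> x) e"
      by (auto simp: rank_one_apply[OF assms])
    have "norm (blinfun_apply \<phi> x) \<le> norm \<phi> * 1"
      using norm_blinfun[of \<phi> x] x(1) by (meson mult_left_mono norm_ge_zero order_trans)
    with x show "y \<in> (\<lambda>c. t c e) ` cball 0 (norm \<phi>)" by auto
  qed
qed

lemma compact_op_zero: "compact_op 0"
  by (simp add: compact_op_def image_constant_conv)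

lemma compact_op_finite_rank:
  fixes s :: "'k::real_or_complex \<Rightarrow> 'a::real_normed_vector \<Rightarrow> 'a"
  assumes "normed_space_over s" "normed_space_over t" "A \<in> bounded_ops s t" "rank_le t A n"
  shows "compact_op A"
proof -
  obtain B \<beta> where B: "finite B" "A = (\<Sum>b\<in>B. rank_one t (\<beta> b) b)"
    using finite_rank_decomposition[OF assms] by metis
  have "compact_op (\<Sum>b\<in>B. rank_one t (\<beta> b) b)"
    using B(1)
  proof (induction B rule: finite_induct)
    case (insert b B)
    then show ?case by (simp add: compact_op_add compact_op_rank_one[OF assms(2)])
  qed (simp add: compact_op_zero)
  then show ?thesis by (simp add: B(2))
qed

text \<open>A finite cover of the image of the unit ball under a close operator yields one for the limit.\<close>

lemma compact_op_limit:
  fixes A :: "'a::real_normed_vector \<Rightarrow>\<^sub>L 'b::banach"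
  assumes lim: "S \<longlonglongrightarrow> A" and "\<And>n. compact_op (S n)"
  shows "compact_op A"
proof -
  have "\<exists>k. finite k \<and> closure (blinfun_apply A ` cball 0 1) \<subseteq> (\<Union>x\<in>k. ball x e)" if e: "e > 0" for e
  proof -
    obtain n where n: "norm (S n - A) < e / 3"
      using LIMSEQ_D[OF lim, of "e / 3"] e by auto
    have "compact (closure (blinfun_apply (S n) ` cball 0 1))"
      using assms(2) by (simp add: compact_op_def)
    then have "\<forall>e>0. \<exists>k. finite k \<and> closure (blinfun_apply (S n) ` cball 0 1) \<subseteq> (\<Union>x\<in>k. ball x e)"
      unfolding compact_eq_totally_bounded by (rule conjunct2)
    then have "\<exists>k. finite k \<and> closure (blinfun_apply (S n) ` cball 0 1) \<subseteq> (\<Union>x\<in>k. ball x (e / 3))"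
      using e by (simp only: divide_pos_pos zero_less_numeral)
    then obtain k where k: "finite k" "closure (blinfun_apply (S n) ` cball 0 1) \<subseteq> (\<Union>x\<in>k. ball x (e / 3))"
      by blast
    have "blinfun_apply A ` cball 0 1 \<subseteq> (\<Union>x\<in>k. cball x (2 * e / 3))"
    proof safe
      fix v :: 'a assume v: "v \<in> cball 0 1"
      then have "blinfun_apply (S n) v \<in> (\<Union>x\<in>k. ball x (e / 3))"
        by (rule subsetD[OF k(2) subsetD[OF closure_subset imageI]])
      then obtain x where x: "x \<in> k" "dist x (blinfun_apply (S n) v) < e / 3" by auto
      have "norm (blinfun_apply (S n - A) v) \<le> norm (S n - A) * 1"
        by (rule order_trans[OF norm_blinfun mult_left_mono]) (use v in simp_all)
      then have "dist (blinfun_apply (S n) v) (blinfun_apply A v) < e / 3"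
        using n by (simp add: dist_norm blinfun.diff_left)
      then have "dist x (blinfun_apply A v) \<le> 2 * e / 3"
        using x(2) dist_triangle[of x "blinfun_apply A v" "blinfun_apply (S n) v"] by simp
      then show "blinfun_apply A v \<in> (\<Union>x\<in>k. cball x (2 * e / 3))" using x(1) by auto
    qed
    then have "closure (blinfun_apply A ` cball 0 1) \<subseteq> (\<Union>x\<in>k. cball x (2 * e / 3))"
      by (rule closure_minimal) (intro closed_UN k(1) ballI closed_cball)
    also have "\<dots> \<subseteq> (\<Union>x\<in>k. ball x e)" using e by (intro UN_mono) auto
    finally show ?thesis using k(1) by blast
  qed
  then have "\<forall>e>0. \<exists>k. finite k \<and> closure (blinfun_apply A ` cball 0 1) \<subseteq> (\<Union>x\<in>k. ball x e)"
    by (intro allI impI)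
  moreover have "complete (closure (blinfun_apply A ` cball 0 1))" by (simp only: complete_eq_closed closed_closure)
  ultimately show ?thesis unfolding compact_op_def compact_eq_totally_bounded by (intro conjI)
qed


section \<open>Vanishing approximation numbers\<close>

lemma approx_number_approx:
  fixes s :: "'k::real_or_complex \<Rightarrow> 'a::real_normed_vector \<Rightarrow> 'a"
    and t :: "'k \<Rightarrow> 'b::real_normed_vector \<Rightarrow> 'b"
  assumes s: "normed_space_over s" and t: "normed_space_over t" and n: "n > 0"
  shows approx_number_nonneg: "0 \<le> approx_number s t n T"
    and "0 < e \<Longrightarrow> \<exists>S\<in>bounded_ops s t. rank_le t S (n - 1) \<and> norm (T - S) < approx_number s t n T + e"
proof -
  interpret t: normed_space_over t by fact
  let ?A = "{S \<in> bounded_ops s t. fin_dim_subspace t (range (blinfun_apply S)) \<and>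
                 t.dim (range (blinfun_apply S)) < n}"
  have "rank_le t (0 :: 'a \<Rightarrow>\<^sub>L 'b) 0"
    unfolding rank_le_def by (rule exI[of _ "{}"]) auto
  note zero = rank_le_dim[OF s t bounded_ops_zero[OF t] this]
  have "(0::'a \<Rightarrow>\<^sub>L 'b) \<in> ?A"
    using zero n bounded_ops_zero[OF t] by simp
  then have ne: "?A \<noteq> {}" by blast
  show "0 \<le> approx_number s t n T" unfolding approx_number_def by (rule cINF_greatest[OF ne]) simp
  have bdd: "bdd_below ((\<lambda>S. norm (T - S)) ` ?A)" by (rule bdd_belowI[of _ 0]) auto
  assume e: "0 < e"
  then have "(INF S\<in>?A. norm (T - S)) < approx_number s t n T + e"
    by (simp add: approx_number_def)
  then obtain S where S: "S \<in> ?A" "norm (T - S) < approx_number s t n T + e"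
    unfolding cINF_less_iff[OF ne bdd] by blast
  then have "rank_le t S (n - 1)"
    using rank_le_mono[OF rank_le_dim_range[OF t, of S], of "n - 1"] by auto
  then show "\<exists>S\<in>bounded_ops s t. rank_le t S (n - 1) \<and> norm (T - S) < approx_number s t n T + e"
    using S by (intro bexI[of _ S] conjI) auto
qed

text \<open>
  If the vectors \<open>T v\<close> for \<open>v\<close> in a finite set \<open>V\<close> are independent, then so are their perturbations
  \<open>S v\<close>: a relation \<open>\<Sum> c v S v = 0\<close> gives \<open>\<Sum> c v T v = \<Sum> c v (T - S) v\<close>, and the biorthogonal
  functional that belongs to the largest coefficient yields a contradiction.
\<close>

lemma approx_number_zero_imp_rank:
  fixes s :: "'k::real_or_complex \<Rightarrow> 'a::real_normed_vector \<Rightarrow> 'a"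
    and t :: "'k \<Rightarrow> 'b::real_normed_vector \<Rightarrow> 'b"
  assumes s: "normed_space_over s" and t: "normed_space_over t" and T: "T \<in> bounded_ops s t"
    and n: "n > 0" and zero: "approx_number s t n T = 0"
  shows "rank_le t T (n - 1)"
proof (rule ccontr)
  assume nr: "\<not> rank_le t T (n - 1)"
  interpret s: normed_space_over s by fact
  interpret t: normed_space_over t by fact
  let ?V = "range (blinfun_apply T)"
  obtain D where D: "D \<subseteq> ?V" "t.independent D" "?V \<subseteq> t.span D" 
    by (rule t.basis_exists[of ?V]) (rule that)
  have "infinite D \<or> n \<le> card D" 
  proof (rule ccontr)
    assume "\<not> (infinite D \<or> n \<le> card D)"
    then have "finite D" "card D \<le> n - 1" by auto
    then show False using nr D(3) unfolding rank_le_def by blast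
  qed
  then obtain B where B: "B \<subseteq> D" "finite B" "card B = n"
  proof (cases "finite D")
    case True
    then show thesis
      using that \<open>infinite D \<or> n \<le> card D\<close> obtain_subset_with_card_n[of n D] finite_subset by metis
  next
    case False
    then show thesis using that infinite_arbitrarily_large[of D n] by metis
  qed
  have indB: "t.independent B" using D(2) B(1) t.independent_mono by blast
  obtain \<beta> where \<beta>: "\<And>b. b \<in> B \<Longrightarrow> \<beta> b \<in> dual t"
    "\<And>b c. b \<in> B \<Longrightarrow> c \<in> B \<Longrightarrow> blinfun_apply (\<beta> b) c = (if b = c then 1 else 0)"
    using dual_biorthogonal[OF t B(2) indB] by metis
  have "\<forall>b\<in>B. \<exists>x. blinfun_apply T x = b" using B(1) D(1) by auto
  then obtain x where x: "\<And>b. b \<in> B \<Longrightarrow> blinfun_apply T (x b) = b" by metis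
  define M where "M = 1 + (\<Sum>a\<in>B. \<Sum>b\<in>B. norm (\<beta> a) * norm (x b))"
  have M: "M > 0" unfolding M_def by (intro add_pos_nonneg sum_nonneg) auto
  obtain S where Sop: "S \<in> bounded_ops s t" and rS: "rank_le t S (n - 1)" and S: "norm (T - S) < 1 / M"
    using approx_number_approx(2)[OF s t n, of "1 / M" T] M zero by auto
  obtain E where E: "finite E" "card E \<le> n - 1" "range (blinfun_apply S) \<subseteq> t.span E"
    using rS by (auto simp: rank_le_def)
  \<comment> \<open>a nontrivial relation between the vectors \<open>S (x b)\<close>\<close>
  have "\<exists>c. (\<Sum>b\<in>B. t (c b) (blinfun_apply S (x b))) = 0 \<and> (\<exists>b\<in>B. c b \<noteq> 0)"
  proof (cases "inj_on (\<lambda>b. blinfun_apply S (x b)) B")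
    case True
    have "\<not> t.independent ((\<lambda>b. blinfun_apply S (x b)) ` B)"
    proof
      assume "t.independent ((\<lambda>b. blinfun_apply S (x b)) ` B)"
      then have "card ((\<lambda>b. blinfun_apply S (x b)) ` B) \<le> card E"
        using t.independent_span_bound[OF E(1)] E(3) by blast
      then show False using card_image[OF True] B(3) E(2) n by simp
    qed
    then obtain u where u: "(\<Sum>v\<in>(\<lambda>b. blinfun_apply S (x b)) ` B. t (u v) v) = 0"
        "\<exists>v\<in>(\<lambda>b. blinfun_apply S (x b)) ` B. u v \<noteq> 0"
      using t.dependent_finite[of "(\<lambda>b. blinfun_apply S (x b)) ` B"] B(2) by auto
    then have "(\<Sum>b\<in>B. t (u (blinfun_apply S (x b))) (blinfun_apply S (x b))) = 0"
      by (simp add: sum.reindex[OF True])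
    then show ?thesis using u(2) by (intro exI[of _ "\<lambda>b. u (blinfun_apply S (x b))"]) auto
  next
    case False
    then obtain a b where ab: "a \<in> B" "b \<in> B" "a \<noteq> b" "blinfun_apply S (x a) = blinfun_apply S (x b)"
      by (auto simp: inj_on_def)
    define c where "c d = (if d = a then 1 else if d = b then - 1 else (0::'k))" for d
    have "(\<Sum>d\<in>B. t (c d) (blinfun_apply S (x d))) = (\<Sum>d\<in>{a, b}. t (c d) (blinfun_apply S (x d)))"
      by (rule sum.mono_neutral_right) (use ab B(2) in \<open>auto simp: c_def\<close>)
    also have "\<dots> = 0" using ab by (simp add: c_def)
    finally show ?thesis using ab by (intro exI[of _ c]) (auto simp: c_def)
  qed
  then obtain c where c: "(\<Sum>b\<in>B. t (c b) (blinfun_apply S (x b))) = 0" "\<exists>b\<in>B. c b \<noteq> 0" by blast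
  obtain a where a: "a \<in> B" "\<And>b. b \<in> B \<Longrightarrow> norm (c b) \<le> norm (c a)"
  proof -
    have "Max ((\<lambda>b. norm (c b)) ` B) \<in> (\<lambda>b. norm (c b)) ` B" using B c(2) by (intro Max_in) auto
    then obtain a where "a \<in> B" "Max ((\<lambda>b. norm (c b)) ` B) = norm (c a)" by auto
    moreover have "norm (c b) \<le> Max ((\<lambda>b. norm (c b)) ` B)" if "b \<in> B" for b
      using that B(2) by (intro Max_ge) auto
    ultimately show thesis using that by simp
  qed
  have ca: "norm (c a) > 0"
  proof -
    obtain b where "b \<in> B" "c b \<noteq> 0" using c(2) by blast
    then show ?thesis using a(2)[of b] by (smt (verit) zero_less_norm_iff)
  qed
  have "(\<Sum>b\<in>B. t (c b) b) = (\<Sum>b\<in>B. t (c b) (blinfun_apply (T - S) (x b)))"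
    using c(1) x by (simp add: blinfun.diff_left t.scale_right_diff_distrib sum_subtractf)
  then have "blinfun_apply (\<beta> a) (\<Sum>b\<in>B. t (c b) b)
      = blinfun_apply (\<beta> a) (\<Sum>b\<in>B. t (c b) (blinfun_apply (T - S) (x b)))" by simp
  then have "(\<Sum>b\<in>B. c b * blinfun_apply (\<beta> a) b)
      = (\<Sum>b\<in>B. c b * blinfun_apply (\<beta> a) (blinfun_apply (T - S) (x b)))"
    using \<beta>(1)[OF a(1)] by (simp add: blinfun.sum_right dual_def bounded_ops_def)
  moreover have "(\<Sum>b\<in>B. c b * blinfun_apply (\<beta> a) b) = c a"
  proof -
    have "(\<Sum>b\<in>B. c b * blinfun_apply (\<beta> a) b) = (\<Sum>b\<in>B. if a = b then c b else 0)"
      by (intro sum.cong refl) (simp add: \<beta>(2)[OF a(1)])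
    then show ?thesis using a(1) B(2) by simp
  qed
  ultimately have "norm (c a) = norm (\<Sum>b\<in>B. c b * blinfun_apply (\<beta> a) (blinfun_apply (T - S) (x b)))"
    by simp
  also have "\<dots> \<le> (\<Sum>b\<in>B. norm (c a) * (norm (\<beta> a) * norm (x b)) * (1 / M))"
  proof (rule sum_norm_le)
    fix b assume b: "b \<in> B"
    have "norm (blinfun_apply (\<beta> a) (blinfun_apply (T - S) (x b))) \<le> norm (\<beta> a) * (norm (T - S) * norm (x b))"
      by (meson mult_left_mono norm_blinfun norm_ge_zero order_trans)
    also have "\<dots> \<le> norm (\<beta> a) * (1 / M * norm (x b))"
      using S by (intro mult_left_mono mult_right_mono) auto
    finally have "norm (c b) * norm (blinfun_apply (\<beta> a) (blinfun_apply (T - S) (x b)))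
        \<le> norm (c a) * (norm (\<beta> a) * (1 / M * norm (x b)))"
      using a(2)[OF b] by (intro mult_mono) auto
    then show "norm (c b * blinfun_apply (\<beta> a) (blinfun_apply (T - S) (x b)))
        \<le> norm (c a) * (norm (\<beta> a) * norm (x b)) * (1 / M)"
      by (simp add: norm_mult mult_ac)
  qed
  also have "\<dots> = norm (c a) * ((\<Sum>b\<in>B. norm (\<beta> a) * norm (x b)) / M)"
    by (simp add: sum_distrib_left sum_divide_distrib mult_ac)
  also have "\<dots> < norm (c a) * 1"
  proof (rule mult_strict_left_mono[OF _ ca])
    have "(\<Sum>b\<in>B. norm (\<beta> a) * norm (x b)) \<le> (\<Sum>a\<in>B. \<Sum>b\<in>B. norm (\<beta> a) * norm (x b))"
      using a(1) B(2) by (intro member_le_sum[of a B "\<lambda>a. \<Sum>b\<in>B. norm (\<beta> a) * norm (x b)"]) (auto intro: sum_nonneg)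
    also have "\<dots> < M" by (simp add: M_def)
    finally show "(\<Sum>b\<in>B. norm (\<beta> a) * norm (x b)) / M < 1" using M by simp
  qed
  finally show False by simp
qed


section \<open>From the duals to the spaces\<close>

lemma complemented_projection:
  fixes s :: "'k::real_or_complex \<Rightarrow> 'a::real_normed_vector \<Rightarrow> 'a"
  assumes c: "complemented s E C N" and E: "0 \<in> E" and C: "0 \<le> C"
  obtains P where "klinear_on s s E P" "\<forall>x\<in>E. P x \<in> N" "N \<subseteq> E"
    "\<forall>x\<in>N. P x = x" "\<forall>x\<in>E. norm (P x) \<le> C * norm x"
proof -
  obtain P where P: "klinear_on s s E P" "P ` E = N" "N \<subseteq> E" "\<And>x. x \<in> E \<Longrightarrow> P (P x) = P x"
    "opnorm_on E P \<le> ennreal C"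
    using c unfolding complemented_def by blast
  show thesis
  proof (rule that[OF P(1) _ P(3)])
    show "\<forall>x\<in>E. P x \<in> N" using P(2) by blast
    show "\<forall>x\<in>N. P x = x" using P(2,4) by blast
    show "\<forall>x\<in>E. norm (P x) \<le> C * norm x"
    proof
      fix x assume x: "x \<in> E"
      have fin: "opnorm_on E P < \<infinity>" using P(5) by (rule le_less_trans) simp
      have "norm (P x) \<le> enn2real (opnorm_on E P) * norm x"
        by (rule opnorm_on_bound[OF fin x]) (use klinear_on_zero[OF P(1) E] in simp)
      also have "\<dots> \<le> C * norm x"
        using enn2real_mono[OF P(5)] C by (intro mult_right_mono) auto
      finally show "norm (P x) \<le> C * norm x" .
    qed
  qed
qed

lemma isomorphism_inverse:
  fixes s :: "'k::real_or_complex \<Rightarrow> 'a::real_normed_vector \<Rightarrow> 'a"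
    and t :: "'k \<Rightarrow> 'b::real_normed_vector \<Rightarrow> 'b"
  assumes "normed_space_over s" and M: "module.subspace s M"
    and \<psi>: "\<psi> \<in> isomorphisms s t M N"
  shows "klinear_on s t M \<psi>" "klinear_on t s N (inv_into M \<psi>)"
    "\<And>x. x \<in> M \<Longrightarrow> \<psi> x \<in> N" "\<And>y. y \<in> N \<Longrightarrow> inv_into M \<psi> y \<in> M"
    "\<And>x. x \<in> M \<Longrightarrow> inv_into M \<psi> (\<psi> x) = x" "\<And>y. y \<in> N \<Longrightarrow> \<psi> (inv_into M \<psi> y) = y"
    "\<And>x. x \<in> M \<Longrightarrow> norm (\<psi> x) \<le> enn2real (opnorm_on M \<psi>) * norm x"
    "\<And>y. y \<in> N \<Longrightarrow> norm (inv_into M \<psi> y) \<le> enn2real (opnorm_on N (inv_into M \<psi>)) * norm y"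
proof -
  interpret s: normed_space_over s by fact
  have bij: "bij_betw \<psi> M N" and lin: "klinear_on s t M \<psi>" and fin: "opnorm_on M \<psi> < \<infinity>"
    and fin': "opnorm_on N (inv_into M \<psi>) < \<infinity>"
    using \<psi> by (auto simp: isomorphisms_def)
  have inj: "inj_on \<psi> M" and im: "\<psi> ` M = N" using bij by (auto simp: bij_betw_def)
  show "klinear_on s t M \<psi>" by (rule lin)
  show 1: "\<psi> x \<in> N" if "x \<in> M" for x using im that by blast
  show 2: "inv_into M \<psi> y \<in> M" if "y \<in> N" for y using im that inv_into_into by metis
  show 3: "inv_into M \<psi> (\<psi> x) = x" if "x \<in> M" for x using inj that by simp
  show 4: "\<psi> (inv_into M \<psi> y) = y" if "y \<in> N" for y using im that f_inv_into_f by metis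
  have 5: "inv_into M \<psi> y = x" if "x \<in> M" "\<psi> x = y" for x y using 3[OF that(1)] that(2) by simp
  show lin': "klinear_on t s N (inv_into M \<psi>)"
    unfolding klinear_on_def
  proof (intro conjI ballI allI)
    fix x y assume "x \<in> N" "y \<in> N"
    then show "inv_into M \<psi> (x + y) = inv_into M \<psi> x + inv_into M \<psi> y"
      by (intro 5 s.subspace_add[OF M] 2) (use lin 2 4 in \<open>auto simp: klinear_on_def\<close>)
  next
    fix c x assume "x \<in> N"
    then show "inv_into M \<psi> (t c x) = s c (inv_into M \<psi> x)"
      by (intro 5 s.subspace_scale[OF M] 2) (use lin 2 4 in \<open>auto simp: klinear_on_def\<close>)
  qed
  have 0: "\<psi> 0 = 0" by (rule klinear_on_zero[OF lin s.subspace_0[OF M]])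
  show "norm (\<psi> x) \<le> enn2real (opnorm_on M \<psi>) * norm x" if "x \<in> M" for x
    by (rule opnorm_on_bound[OF fin that]) (use 0 in simp)
  show "norm (inv_into M \<psi> y) \<le> enn2real (opnorm_on N (inv_into M \<psi>)) * norm y" if "y \<in> N" for y
    by (rule opnorm_on_bound[OF fin' that]) (rule 5[OF s.subspace_0[OF M]], simp add: 0)
qed

lemma fin_dim_subspace_basis:
  assumes "normed_space_over s" "fin_dim_subspace s N"
  obtains B where "finite B" "\<not> module.dependent s B" "module.span s B = N"
    "card B = vector_space.dim s N" "B \<subseteq> N" "module.subspace s N"
proof -
  interpret s: normed_space_over s by fact
  obtain D where D: "finite D" "s.span D = N" using assms(2) by (auto simp: fin_dim_subspace_def)
  have sub: "s.subspace N" using D(2) s.subspace_span by metis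
  obtain B where B: "finite B" "B \<subseteq> N" "s.independent B" "s.span B = N" "card B = s.dim N"
    using s.finite_spanned_subspace[OF sub _ D(1)] D(2) by (metis subset_refl)
  show thesis by (rule that[OF B(1,3,4,5,2) sub])
qed

text \<open>Passes from the extended to the real product of the two norms, which is where finiteness of both
  is needed: the extended product of \<open>0\<close> and \<open>\<infinity>\<close> is \<open>0\<close>.\<close>

lemma opnorm_product_less:
  assumes "a * b < ennreal r" "a < \<infinity>" "b < \<infinity>"
  shows "enn2real a * enn2real b < r"
proof -
  have "ennreal (enn2real a * enn2real b) = a * b"
    using assms(2,3) by (simp add: ennreal_mult)
  then show ?thesis using assms(1) by (metis enn2real_nonneg ennreal_less_iff mult_nonneg_nonneg)
qed

text \<open>
  Finiteness of the local distance function is a statement about the duals. By reflexivity the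
  projections and the isomorphism that it provides are adjoint to operators between \<open>X\<close> and \<open>Y\<close>:
  \<open>R\<close> and \<open>S\<close> are the preadjoints of the projections, and \<open>W\<close> and \<open>G\<close> those of the isomorphism and
  of its inverse, each preceded by the projection onto its domain.
\<close>

lemma local_step:
  fixes sX :: "'k::real_or_complex \<Rightarrow> 'x::banach \<Rightarrow> 'x"
    and sY :: "'k \<Rightarrow> 'y::banach \<Rightarrow> 'y"
  assumes X: "normed_space_over sX" and Y: "normed_space_over sY"
    and rX: "reflexive_space sX" and rY: "reflexive_space sY" and C: "0 \<le> C"
    and ld: "loc_dist dual_scale (dual sX) dual_scale (dual sY) K C n < ennreal r"
    and FX: "FX \<subseteq> dual sX" "finite FX" "card FX \<le> n"
    and FY: "FY \<subseteq> dual sY" "finite FY" "card FY \<le> n"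
  obtains R S G W where
    "R \<in> bounded_ops sX sX" "S \<in> bounded_ops sY sY" "G \<in> bounded_ops sX sY" "W \<in> bounded_ops sY sX"
    "R o\<^sub>L R = R" "S o\<^sub>L S = S" "W o\<^sub>L G = R" "G o\<^sub>L W = S" "G o\<^sub>L R = G" "W o\<^sub>L S = W"
    "norm R \<le> C" "norm S \<le> C" "norm G * norm W \<le> C\<^sup>2 * r" "rank_le sX R (K n)"
    "\<And>\<phi>. \<phi> \<in> FX \<Longrightarrow> \<phi> o\<^sub>L R = \<phi>" "\<And>\<phi>. \<phi> \<in> FY \<Longrightarrow> \<phi> o\<^sub>L S = \<phi>"
    "\<not> module.dependent dual_scale FX \<Longrightarrow> card FX \<le> K n"
    "\<not> module.dependent dual_scale FY \<Longrightarrow> card FY \<le> K n"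
proof -
  interpret X: normed_space_over sX by fact
  interpret Y: normed_space_over sY by fact
  interpret dX: normed_space_over "dual_scale :: 'k \<Rightarrow> ('x \<Rightarrow>\<^sub>L 'k) \<Rightarrow> _"
    by (rule normed_space_over_dual_scale)
  interpret dY: normed_space_over "dual_scale :: 'k \<Rightarrow> ('y \<Rightarrow>\<^sub>L 'k) \<Rightarrow> _"
    by (rule normed_space_over_dual_scale)
  note nX = normed_space_over_dual_scale[where 'k = 'k and 'a = 'x]
  note nY = normed_space_over_dual_scale[where 'k = 'k and 'a = 'y]
  have zX: "0 \<in> dual sX" using dX.subspace_0[OF subspace_dual] .
  have zY: "0 \<in> dual sY" using dY.subspace_0[OF subspace_dual] .
  obtain r' where r': "ennreal r' < ennreal r"
    and step: "\<forall>M M'. M \<subseteq> dual sX \<and> fin_dim_subspace dual_scale M \<and> dX.dim M \<le> n \<and>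
               M' \<subseteq> dual sY \<and> fin_dim_subspace dual_scale M' \<and> dY.dim M' \<le> n \<longrightarrow>
          (\<exists>N N'. fin_dim_subspace dual_scale N \<and> complemented dual_scale (dual sX) C N \<and> M \<subseteq> N \<and>
                  fin_dim_subspace dual_scale N' \<and> complemented dual_scale (dual sY) C N' \<and> M' \<subseteq> N' \<and>
                  dX.dim N = dY.dim N' \<and> dY.dim N' \<le> K n \<and>
                  bm_dist dual_scale dual_scale N N' \<le> ennreal r')"
    using ld unfolding loc_dist_def Inf_less_iff by auto
  have "dX.span FX \<subseteq> dual sX" "dX.dim (dX.span FX) \<le> n" "fin_dim_subspace dual_scale (dX.span FX)"
    using FX dX.span_minimal[OF FX(1) subspace_dual] dX.dim_le_card[OF subset_refl FX(2)]
    by (auto simp: fin_dim_subspace_def)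
  moreover have "dY.span FY \<subseteq> dual sY" "dY.dim (dY.span FY) \<le> n" "fin_dim_subspace dual_scale (dY.span FY)"
    using FY dY.span_minimal[OF FY(1) subspace_dual] dY.dim_le_card[OF subset_refl FY(2)]
    by (auto simp: fin_dim_subspace_def)
  ultimately obtain N N' where N: "fin_dim_subspace dual_scale N" "complemented dual_scale (dual sX) C N"
      "dX.span FX \<subseteq> N" and N': "fin_dim_subspace dual_scale N'"
      "complemented dual_scale (dual sY) C N'" "dY.span FY \<subseteq> N'"
      and dims: "dX.dim N = dY.dim N'" "dY.dim N' \<le> K n"
      and bm: "bm_dist dual_scale dual_scale N N' \<le> ennreal r'"
    using step by blast
  have FXN: "FX \<subseteq> N" and FYN: "FY \<subseteq> N'"
    using N(3) N'(3) dX.span_superset dY.span_superset by blast+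
  obtain P where P_ex: "klinear_on dual_scale dual_scale (dual sX) P" "\<forall>x\<in>dual sX. P x \<in> N"
      "N \<subseteq> dual sX" "\<forall>x\<in>N. P x = x" "\<forall>x\<in>dual sX. norm (P x) \<le> C * norm x"
    by (rule complemented_projection[OF N(2) zX C]) (rule that)
  have P: "klinear_on dual_scale dual_scale (dual sX) P" "\<And>x. x \<in> dual sX \<Longrightarrow> P x \<in> N"
      "N \<subseteq> dual sX" "\<And>x. x \<in> N \<Longrightarrow> P x = x" "\<And>x. x \<in> dual sX \<Longrightarrow> norm (P x) \<le> C * norm x"
    using P_ex by simp_all
  obtain P' where P'_ex: "klinear_on dual_scale dual_scale (dual sY) P'" "\<forall>x\<in>dual sY. P' x \<in> N'"
      "N' \<subseteq> dual sY" "\<forall>x\<in>N'. P' x = x" "\<forall>x\<in>dual sY. norm (P' x) \<le> C * norm x"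
    by (rule complemented_projection[OF N'(2) zY C]) (rule that)
  have P': "klinear_on dual_scale dual_scale (dual sY) P'" "\<And>x. x \<in> dual sY \<Longrightarrow> P' x \<in> N'"
      "N' \<subseteq> dual sY" "\<And>x. x \<in> N' \<Longrightarrow> P' x = x" "\<And>x. x \<in> dual sY \<Longrightarrow> norm (P' x) \<le> C * norm x"
    using P'_ex by simp_all
  obtain B where B: "finite B" "dX.independent B" "dX.span B = N" "card B = dX.dim N" "B \<subseteq> N" "dX.subspace N"
    by (rule fin_dim_subspace_basis[OF nX N(1)]) (rule that)
  obtain B' where B': "finite B'" "dY.independent B'" "dY.span B' = N'" "card B' = dY.dim N'" "B' \<subseteq> N'" "dY.subspace N'"
    by (rule fin_dim_subspace_basis[OF nY N'(1)]) (rule that)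
  have "bm_dist dual_scale dual_scale N N' < ennreal r" using bm r' by (rule le_less_trans)
  then obtain \<theta> where \<theta>: "\<theta> \<in> isomorphisms dual_scale dual_scale N N'"
      "opnorm_on N \<theta> * opnorm_on N' (inv_into N \<theta>) < ennreal r"
    unfolding bm_dist_def INF_less_iff by blast
  define \<theta>' where "\<theta>' = inv_into N \<theta>"
  define a where "a = enn2real (opnorm_on N \<theta>)"
  define b where "b = enn2real (opnorm_on N' \<theta>')"
  note iso = isomorphism_inverse[OF nX B(6) \<theta>(1), folded \<theta>'_def, folded a_def b_def]
  have ab: "0 \<le> a" "0 \<le> b" "a * b < r"
    using opnorm_product_less[OF \<theta>(2)] \<theta>(1) by (auto simp: a_def b_def \<theta>'_def isomorphisms_def)
  obtain R where R: "R \<in> bounded_ops sX sX" "norm R \<le> C"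
    "\<And>\<phi> x. \<phi> \<in> dual sX \<Longrightarrow> blinfun_apply \<phi> (blinfun_apply R x) = blinfun_apply (P \<phi>) x"
    using predual_operator[OF X X rX subsetD[OF P(3) P(2)] P(1) P(5) C] by metis
  obtain S where S: "S \<in> bounded_ops sY sY" "norm S \<le> C"
    "\<And>\<phi> x. \<phi> \<in> dual sY \<Longrightarrow> blinfun_apply \<phi> (blinfun_apply S x) = blinfun_apply (P' \<phi>) x"
    using predual_operator[OF Y Y rY subsetD[OF P'(3) P'(2)] P'(1) P'(5) C] by metis
  have linG: "klinear_on dual_scale dual_scale (dual sY) (\<lambda>\<phi>. \<theta>' (P' \<phi>))"
    using P'(1,2) iso(2) by (simp add: klinear_on_def)
  have linW: "klinear_on dual_scale dual_scale (dual sX) (\<lambda>\<phi>. \<theta> (P \<phi>))"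
    using P(1,2) iso(1) by (simp add: klinear_on_def)
  have nG: "norm (\<theta>' (P' \<phi>)) \<le> b * C * norm \<phi>" if "\<phi> \<in> dual sY" for \<phi>
  proof -
    have "norm (\<theta>' (P' \<phi>)) \<le> b * norm (P' \<phi>)" by (rule iso(8)) (rule P'(2)[OF that])
    also have "\<dots> \<le> b * (C * norm \<phi>)" by (intro mult_left_mono P'(5) that ab)
    finally show ?thesis by (simp add: mult.assoc)
  qed
  have nW: "norm (\<theta> (P \<phi>)) \<le> a * C * norm \<phi>" if "\<phi> \<in> dual sX" for \<phi>
  proof -
    have "norm (\<theta> (P \<phi>)) \<le> a * norm (P \<phi>)" by (rule iso(7)) (rule P(2)[OF that])
    also have "\<dots> \<le> a * (C * norm \<phi>)" by (intro mult_left_mono P(5) that ab)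
    finally show ?thesis by (simp add: mult.assoc)
  qed
  have mapG: "\<theta>' (P' \<phi>) \<in> N" if "\<phi> \<in> dual sY" for \<phi> by (rule iso(4)) (rule P'(2)[OF that])
  have mapW: "\<theta> (P \<phi>) \<in> N'" if "\<phi> \<in> dual sX" for \<phi> by (rule iso(3)) (rule P(2)[OF that])
  obtain G where G: "G \<in> bounded_ops sX sY" "norm G \<le> b * C"
    "\<And>\<phi> x. \<phi> \<in> dual sY \<Longrightarrow> blinfun_apply \<phi> (blinfun_apply G x) = blinfun_apply (\<theta>' (P' \<phi>)) x"
    using predual_operator[OF X Y rY subsetD[OF P(3) mapG] linG nG mult_nonneg_nonneg[OF ab(2) C]] by metis
  obtain W where W: "W \<in> bounded_ops sY sX" "norm W \<le> a * C"
    "\<And>\<phi> x. \<phi> \<in> dual sX \<Longrightarrow> blinfun_apply \<phi> (blinfun_apply W x) = blinfun_apply (\<theta> (P \<phi>)) x"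
    using predual_operator[OF Y X rX subsetD[OF P'(3) mapW] linW nW mult_nonneg_nonneg[OF ab(1) C]] by metis
  have PN: "P \<phi> \<in> dual sX" if "\<phi> \<in> dual sX" for \<phi> using P(2,3) that by blast
  have PN': "P' \<phi> \<in> dual sY" if "\<phi> \<in> dual sY" for \<phi> using P'(2,3) that by blast
  have GN: "\<theta>' (P' \<phi>) \<in> dual sX" if "\<phi> \<in> dual sY" for \<phi> using mapG[OF that] P(3) by blast
  have WN: "\<theta> (P \<phi>) \<in> dual sY" if "\<phi> \<in> dual sX" for \<phi> using mapW[OF that] P'(3) by blast
  have RR: "R o\<^sub>L R = R"
    by (rule blinfun_eqI, rule dual_eqI[OF X]) (simp add: R(3) PN P(2,4))
  have SS: "S o\<^sub>L S = S"
    by (rule blinfun_eqI, rule dual_eqI[OF Y]) (simp add: S(3) PN' P'(2,4))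
  have WG: "W o\<^sub>L G = R"
    by (rule blinfun_eqI, rule dual_eqI[OF X])
      (simp add: R(3) W(3) G(3) WN mapW P'(4) iso(5) P(2))
  have GW: "G o\<^sub>L W = S"
    by (rule blinfun_eqI, rule dual_eqI[OF Y])
      (simp add: S(3) W(3) G(3) GN mapG P(4) iso(6) P'(2))
  have GR: "G o\<^sub>L R = G"
    by (rule blinfun_eqI, rule dual_eqI[OF Y]) (simp add: R(3) G(3) GN mapG P(4))
  have WS: "W o\<^sub>L S = W"
    by (rule blinfun_eqI, rule dual_eqI[OF X]) (simp add: S(3) W(3) WN mapW P'(4))
  have nGW: "norm G * norm W \<le> C\<^sup>2 * r"
  proof -
    have "norm G * norm W \<le> (b * C) * (a * C)"
      by (intro mult_mono G W) (use ab C in auto)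
    also have "\<dots> = C\<^sup>2 * (a * b)" by (simp add: power2_eq_square mult_ac)
    also have "\<dots> \<le> C\<^sup>2 * r" using ab by (intro mult_left_mono) auto
    finally show ?thesis .
  qed
  have FXR: "\<phi> o\<^sub>L R = \<phi>" if "\<phi> \<in> FX" for \<phi>
  proof -
    have "\<phi> \<in> N" "\<phi> \<in> dual sX" using that FXN FX(1) by auto
    then show ?thesis by (intro blinfun_eqI) (simp add: R(3) P(4))
  qed
  have FYS: "\<phi> o\<^sub>L S = \<phi>" if "\<phi> \<in> FY" for \<phi>
  proof -
    have "\<phi> \<in> N'" "\<phi> \<in> dual sY" using that FYN FY(1) by auto
    then show ?thesis by (intro blinfun_eqI) (simp add: S(3) P'(4))
  qed
  have rank: "rank_le sX R (K n)"
  proof -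
    obtain e where e: "\<And>\<phi> \<psi>. \<phi> \<in> B \<Longrightarrow> \<psi> \<in> B \<Longrightarrow> blinfun_apply \<psi> (e \<phi>) = (if \<phi> = \<psi> then 1 else 0)"
      using predual_biorthogonal[OF X B(1,2) subset_trans[OF B(5) P(3)]] by metis
    have Rx: "blinfun_apply R x = (\<Sum>\<beta>\<in>B. sX (blinfun_apply \<beta> x) (blinfun_apply R (e \<beta>)))" for x
    proof (rule dual_eqI[OF X])
      fix \<phi> assume \<phi>: "\<phi> \<in> dual sX"
      have "P \<phi> \<in> dX.span B" using P(2)[OF \<phi>] B(3) by simp
      then obtain c where c: "P \<phi> = (\<Sum>\<beta>\<in>B. dual_scale (c \<beta>) \<beta>)"
        unfolding dX.span_finite[OF B(1)] by blast
      have coeff: "blinfun_apply (P \<phi>) (e \<beta>) = c \<beta>" if \<beta>: "\<beta> \<in> B" for \<beta>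
      proof -
        have "blinfun_apply (P \<phi>) (e \<beta>) = (\<Sum>\<gamma>\<in>B. c \<gamma> * blinfun_apply \<gamma> (e \<beta>))"
          by (simp add: c blinfun.sum_left)
        also have "\<dots> = (\<Sum>\<gamma>\<in>B. if \<beta> = \<gamma> then c \<gamma> else 0)"
          by (intro sum.cong refl) (simp add: e[OF \<beta>])
        also have "\<dots> = c \<beta>" using \<beta> B(1) by simp
        finally show ?thesis .
      qed
      have sc: "blinfun_apply \<phi> (sX z v) = z * blinfun_apply \<phi> v" for z v
        using \<phi> by (simp add: dual_def bounded_ops_def)
      have "blinfun_apply \<phi> (\<Sum>\<beta>\<in>B. sX (blinfun_apply \<beta> x) (blinfun_apply R (e \<beta>)))
          = (\<Sum>\<beta>\<in>B. blinfun_apply \<beta> x * c \<beta>)"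
        unfolding blinfun.sum_right sc
        by (intro sum.cong refl) (simp add: R(3)[OF \<phi>] coeff)
      also have "\<dots> = blinfun_apply (P \<phi>) x"
        unfolding c by (simp add: blinfun.sum_left mult.commute)
      finally show "blinfun_apply \<phi> (blinfun_apply R x)
          = blinfun_apply \<phi> (\<Sum>\<beta>\<in>B. sX (blinfun_apply \<beta> x) (blinfun_apply R (e \<beta>)))"
        by (simp add: R(3)[OF \<phi>])
    qed
    have "blinfun_apply R x \<in> X.span ((\<lambda>\<beta>. blinfun_apply R (e \<beta>)) ` B)" for x
      by (subst Rx) (intro X.span_sum X.span_scale X.span_base imageI)
    moreover have "card ((\<lambda>\<beta>. blinfun_apply R (e \<beta>)) ` B) \<le> K n"
      using card_image_le[OF B(1), of "\<lambda>\<beta>. blinfun_apply R (e \<beta>)"] B(4) dims by linarith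
    ultimately show ?thesis unfolding rank_le_def using B(1) by (meson finite_imageI image_subsetI)
  qed
  have cX: "card FX \<le> K n" if "dX.independent FX"
    using dX.independent_span_bound[OF B(1) that] FXN B(3,4) dims by simp
  have cY: "card FY \<le> K n" if "dY.independent FY"
    using dY.independent_span_bound[OF B'(1) that] FYN B'(3,4) dims by simp
  show thesis
    by (rule that[OF R(1) S(1) G(1) W(1) RR SS WG GW GR WS R(2) S(2) nGW rank FXR FYS cX cY])
qed


section \<open>Factorization along a block structure\<close>

text \<open>
  \<open>R\<close> are projections of \<open>X\<close> with nested kernels, and \<open>PP\<close> are commuting projections of \<open>Y\<close>. The pair
  \<open>G0\<close>, \<open>W0\<close> identifies the ranges of the first ones. \<open>U k\<close> and \<open>U' k\<close> are mutually inverse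
  isomorphisms between the range of the projection \<open>R (k + 1) \<circ> (1 - R k)\<close>, which is called \<open>eps k\<close>
  below, and that of \<open>PP (k + 1) - PP k\<close>. The members of the dense sequence \<open>y\<close> lie
  in the ranges of the \<open>PP\<close>. In the assumption on \<open>T - A k\<close> the bound for \<open>d i\<close> with all \<open>i \<le> k\<close> is
  what the hypothesis on \<open>\<Phi>\<close> provides, as it concerns all \<open>n\<close> up to a bound.
\<close>

locale block_data =
  fixes sX :: "'k::real_or_complex \<Rightarrow> 'x::banach \<Rightarrow> 'x"
    and sY :: "'k \<Rightarrow> 'y::banach \<Rightarrow> 'y"
    and T :: "'x \<Rightarrow>\<^sub>L 'x" and A R :: "nat \<Rightarrow> 'x \<Rightarrow>\<^sub>L 'x" and PP :: "nat \<Rightarrow> 'y \<Rightarrow>\<^sub>L 'y"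
    and G0 :: "'x \<Rightarrow>\<^sub>L 'y" and W0 :: "'y \<Rightarrow>\<^sub>L 'x"
    and U :: "nat \<Rightarrow> 'x \<Rightarrow>\<^sub>L 'y" and U' :: "nat \<Rightarrow> 'y \<Rightarrow>\<^sub>L 'x"
    and y :: "nat \<Rightarrow> 'y" and C \<beta> :: real and d :: "nat \<Rightarrow> real"
  assumes X: "normed_space_over sX" and Y: "normed_space_over sY" and C: "1 \<le> C"
    and T_op: "T \<in> bounded_ops sX sX"
    and R_op: "R k \<in> bounded_ops sX sX" and R_fin: "\<exists>n. rank_le sX (R k) n"
    and G0_op: "G0 \<in> bounded_ops sX sY" and W0_op: "W0 \<in> bounded_ops sY sX"
    and U_op: "U k \<in> bounded_ops sX sY" and U'_op: "U' k \<in> bounded_ops sY sX"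
    and R_idem: "R k (R k u) = R k u" and R_next: "R k (R (Suc k) u) = R k u"
    and PP_idem: "PP k (PP k v) = PP k v"
    and PP_next: "PP k (PP (Suc k) v) = PP k v" and PP_prev: "PP (Suc k) (PP k v) = PP k v"
    and R_norm: "norm (R k) \<le> C"
    and W0G0: "W0 (G0 u) = R 0 u" and G0W0: "G0 (W0 v) = PP 0 v"
    and G0R: "G0 (R 0 u) = G0 u" and W0P: "W0 (PP 0 v) = W0 v"
    and U'U: "U' k (U k u) = R (Suc k) (u - R k u)"
    and UU': "U k (U' k v) = PP (Suc k) v - PP k v"
    and U_eps: "U k (R (Suc k) (u - R k u)) = U k u"
    and U'_Q: "U' k (PP (Suc k) v - PP k v) = U' k v"
    and U_norm: "norm (U k) \<le> C * (1 + C)"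
    and U'_norm: "norm (U' k) \<le> d k * (2 * (2 * C + 2) ^ (k + 2))"
    and A_R: "A k (R k u) = A k u"
    and TA_d: "i \<le> k \<Longrightarrow> norm (T - A k) * d i \<le> \<beta> / (2 * C + 6) ^ k"
    and TA: "norm (T - A k) \<le> \<beta> / (2 * C + 6) ^ k"
    and y_fixed: "PP (Suc k) (y k) = y k" and y_dense: "closure (range y) = UNIV"
begin

definition eps :: "nat \<Rightarrow> 'x \<Rightarrow>\<^sub>L 'x" where
  "eps k = R (Suc k) o\<^sub>L (id_blinfun - R k)"

text \<open>
  The ratio of the weights: \<open>(2 * C + 2) / l\<close>, the growth of the new terms of the right inverses, is
  \<open>2 * C + 4\<close>, and \<open>l\<close> is small enough to absorb the growth of the projections \<open>p\<close>.
\<close>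

definition l :: real where "l = (C + 1) / (C + 2)"

text \<open>
  The increment of the right inverse \<open>W\<close>. The weighted inverse isomorphism is corrected by the part of
  \<open>W\<close> that the new term \<open>U k \<circ> (1 - p)\<close> does not annihilate.
\<close>

definition corr :: "nat \<Rightarrow> ('y \<Rightarrow>\<^sub>L 'x) \<Rightarrow> ('x \<Rightarrow>\<^sub>L 'x) \<Rightarrow> ('y \<Rightarrow>\<^sub>L 'x)" where
  "corr k W p = (1 / l ^ k) *\<^sub>R U' k - (eps k o\<^sub>L (W - (p o\<^sub>L W)))"

lemma l: "0 < l" "l < 1" using C by (auto simp: l_def)

lemma eps_apply: "eps k u = R (Suc k) (u - R k u)"
  by (simp add: eps_def blinfun.diff_left)

lemma R_eps: "R k (eps k u) = 0"
  by (simp add: eps_apply R_next blinfun.diff_right R_idem)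

lemma R_Suc_eps: "R (Suc k) (eps k u) = eps k u"
  by (simp add: eps_apply R_idem)

lemma eps_U': "eps k (U' k v) = U' k v"
  using U'U[of k "U' k v"] by (simp add: eps_apply UU' U'_Q)

lemma R_U': "R k (U' k v) = 0"
  by (metis R_eps eps_U')

lemma U_eps': "U k (eps k u) = U k u"
  by (simp add: eps_apply U_eps)

lemma eps_op: "eps k \<in> bounded_ops sX sX"
  unfolding eps_def by (intro bounded_ops_compose[where t = sX] bounded_ops_diff[OF X] R_op bounded_ops_id)

lemma corr_op: "W \<in> bounded_ops sY sX \<Longrightarrow> p \<in> bounded_ops sX sX \<Longrightarrow> corr k W p \<in> bounded_ops sY sX"
  unfolding corr_def
  by (intro bounded_ops_compose[where t = sX] bounded_ops_diff[OF X] bounded_ops_scaleR[OF X] U'_op eps_op)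

lemma PP_PP: "k \<le> j \<Longrightarrow> PP k (PP j v) = PP k v" "k \<le> j \<Longrightarrow> PP j (PP k v) = PP k v"
proof -
  assume "k \<le> j"
  then show "PP k (PP j v) = PP k v"
  proof (induction j arbitrary: v rule: dec_induct)
    case (step n)
    show ?case using step.IH[of "PP (Suc n) v"] step.IH[of v] by (simp add: PP_next)
  qed (rule PP_idem)
  from \<open>k \<le> j\<close> show "PP j (PP k v) = PP k v"
  proof (induction j rule: dec_induct)
    case (step n)
    show ?case using PP_prev[of n "PP k v"] by (simp add: step.IH)
  qed (rule PP_idem)
qed

text \<open>The range of \<open>U j\<close> is annihilated by all earlier projections, so later terms of \<open>T1\<close> do not disturb
  the blocks already treated.\<close>

lemma PP_U: "k \<le> j \<Longrightarrow> PP k (U j u) = 0"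
proof -
  assume kj: "k \<le> j"
  have "U j u = PP (Suc j) (U j u) - PP j (U j u)"
    using UU'[of j "U j u"] by (simp add: U'U U_eps)
  then have "PP k (U j u) = PP k (PP (Suc j) (U j u)) - PP k (PP j (U j u))"
    by (metis blinfun.diff_right)
  then show ?thesis using kj by (simp add: PP_PP)
qed

lemma PP_Suc_U: "PP (Suc k) (U k u) = U k u"
proof -
  have "U k u = PP (Suc k) (U k u) - PP k (U k u)"
    using UU'[of k "U k u"] by (simp add: U'U U_eps)
  then show ?thesis by (simp add: PP_U)
qed

end

text \<open>
  If \<open>\<phi>\<close> norms a vector \<open>v = R v\<close>, then so does \<open>\<phi> \<circ> R\<close>. Hence the projection \<open>p\<close> can be enlarged by
  the line through \<open>v\<close> without losing \<open>p \<circ> R = p\<close>, and \<open>1 + norm p\<close> grows at most by the factor \<open>1 + C\<close>,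
  however large \<open>W\<close> and \<open>v\<close> are. The vector \<open>p (W z) + R (W z - p (W z))\<close> replaces \<open>W z\<close>: an operator
  that is unchanged by a preceding \<open>R\<close> takes the same value at both.
\<close>

lemma enlarge_projection:
  fixes sX :: "'k::real_or_complex \<Rightarrow> 'x::banach \<Rightarrow> 'x" and W :: "'y::real_normed_vector \<Rightarrow>\<^sub>L 'x"
  assumes X: "normed_space_over sX" and C: "0 \<le> C"
    and R: "R \<in> bounded_ops sX sX" "\<And>u. R (R u) = R u" "norm R \<le> C"
    and p: "p \<in> bounded_ops sX sX" "\<And>u. p (p u) = p u" "\<And>u. p (R u) = p u"
  obtains p' where "p' \<in> bounded_ops sX sX" "\<And>u. p' (p' u) = p' u" "\<And>u. p' (R u) = p' u"
    "\<And>u. p' (p u) = p u" "norm p' \<le> norm p + C * (1 + norm p)"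
    "p' (p (W z) + R (W z - p (W z))) = p (W z) + R (W z - p (W z))"
    "norm (W - (p' o\<^sub>L W)) \<le> norm (W - (p o\<^sub>L W)) + norm (R o\<^sub>L (W - (p o\<^sub>L W)))"
    "norm (R o\<^sub>L (W - (p' o\<^sub>L W))) \<le> 2 * norm (R o\<^sub>L (W - (p o\<^sub>L W)))"
    "\<And>u. p (p' u) = p u" "\<exists>\<psi> v. p' = p + rank_one sX \<psi> v"
proof -
  interpret X: normed_space_over sX by fact
  define v where "v = R (W z - p (W z))"
  show thesis
  proof (cases "v = 0")
    case True
    have "p = p + rank_one sX 0 0" by (rule blinfun_eqI) (simp add: blinfun.add_left rank_one_apply[OF X])
    then have "\<exists>\<psi> v. p = p + rank_one sX \<psi> v" by blast
    then show thesis by (intro that[of p]) (use p C True in \<open>auto simp: v_def\<close>)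
  next
    case False
    define n where "n = norm v"
    have n: "n > 0" using False by (simp add: n_def)
    obtain \<phi> where \<phi>: "\<phi> \<in> dual sX" "norm \<phi> \<le> 1" "\<phi> v = of_real n"
      using norming_functional[OF X, of v] unfolding n_def by metis
    define \<psi> where "\<psi> = \<phi> o\<^sub>L (R o\<^sub>L (id_blinfun - p))"
    have \<psi>: "\<psi> u = \<phi> (R (u - p u))" for u by (simp add: \<psi>_def blinfun.diff_left)
    have \<psi>d: "\<psi> \<in> dual sX" unfolding \<psi>_def
      by (intro dual_compose[where t = sX] \<phi> bounded_ops_compose[where t = sX] bounded_ops_diff[OF X] R p bounded_ops_id)
    define p' where "p' = p + (1 / n) *\<^sub>R rank_one sX \<psi> v"
    have p': "p' u = p u + (1 / n) *\<^sub>R sX (\<phi> (R (u - p u))) v" for u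
      by (simp add: p'_def blinfun.add_left blinfun.scaleR_left rank_one_apply[OF X] \<psi>)
    have op: "p' \<in> bounded_ops sX sX" unfolding p'_def
      by (intro bounded_ops_add[OF X] bounded_ops_scaleR[OF X] p rank_one_op[OF X] \<psi>d)
    have pv: "p v = 0" by (simp add: v_def p blinfun.diff_right)
    have Rv: "R v = v" by (simp add: v_def R)
    have p'v: "p' v = v"
      using n by (simp add: p' pv Rv \<phi>(3) X.scale_of_real)
    have p'p: "p' (p u) = p u" for u by (simp add: p' p)
    have p'p': "p' (p' u) = p' u" for u
    proof -
      have "p' (p' u) = p' (p u) + (1 / n) *\<^sub>R sX (\<phi> (R (u - p u))) (p' v)"
        unfolding p'[of u] using bounded_ops_scale[OF op]
        by (simp add: blinfun.add_right blinfun.scaleR_right)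
      then show ?thesis by (simp add: p'p p'v p'[of u])
    qed
    have p'R: "p' (R u) = p' u" for u
    proof -
      have "R (R u - p (R u)) = R (u - p u)" by (simp add: blinfun.diff_right R p)
      then show ?thesis by (simp only: p' p)
    qed
    have n\<psi>: "norm \<psi> \<le> C * (1 + norm p)"
    proof -
      have "norm (id_blinfun - p) \<le> 1 + norm p"
        using norm_triangle_ineq4[of id_blinfun p] norm_blinfun_id_le[where 'a = 'x] by linarith
      then have 1: "norm (R o\<^sub>L (id_blinfun - p)) \<le> C * (1 + norm p)"
        by (rule order_trans[OF norm_blinfun_compose mult_mono[OF R(3)]]) (use C in auto)
      have "norm \<psi> \<le> 1 * (C * (1 + norm p))" unfolding \<psi>_def
        by (rule order_trans[OF norm_blinfun_compose mult_mono[OF \<phi>(2) 1]]) auto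
      then show ?thesis by simp
    qed
    have np': "norm p' \<le> norm p + C * (1 + norm p)"
    proof -
      have "norm p' \<le> norm p + norm (rank_one sX \<psi> v) / n"
        unfolding p'_def using n norm_triangle_ineq[of p "(1 / n) *\<^sub>R rank_one sX \<psi> v"] by simp
      also have "norm (rank_one sX \<psi> v) / n \<le> norm \<psi>"
        using norm_rank_one_le[OF X, of \<psi> v] n by (simp add: n_def field_simps)
      finally show ?thesis using n\<psi> by simp
    qed
    have small: "norm ((1 / n) *\<^sub>R sX (\<phi> w) v) \<le> norm w" for w
    proof -
      have "norm ((1 / n) *\<^sub>R sX (\<phi> w) v) = norm (\<phi> w)"
        using n by (simp add: X.norm_scale n_def)
      also have "\<dots> \<le> norm \<phi> * norm w" by (rule norm_blinfun)
      also have "\<dots> \<le> 1 * norm w" by (intro mult_right_mono \<phi>) simp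
      finally show ?thesis by simp
    qed
    define b where "b = R o\<^sub>L (W - (p o\<^sub>L W))"
    have b: "b z = R (W z - p (W z))" for z by (simp add: b_def blinfun.diff_left)
    have w1: "norm (W - (p' o\<^sub>L W)) \<le> norm (W - (p o\<^sub>L W)) + norm b"
    proof (rule norm_blinfun_bound)
      fix z
      have eq: "(W - (p' o\<^sub>L W)) z = (W - (p o\<^sub>L W)) z - (1 / n) *\<^sub>R sX (\<phi> (b z)) v"
        by (simp add: blinfun.diff_left p' b)
      have "norm ((W - (p' o\<^sub>L W)) z) \<le> norm ((W - (p o\<^sub>L W)) z) + norm (b z)"
        unfolding eq using small[of "b z"] norm_triangle_ineq4[of "(W - (p o\<^sub>L W)) z" "(1 / n) *\<^sub>R sX (\<phi> (b z)) v"]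
        by linarith
      also have "\<dots> \<le> norm (W - (p o\<^sub>L W)) * norm z + norm b * norm z"
        by (intro add_mono norm_blinfun)
      finally show "norm ((W - (p' o\<^sub>L W)) z) \<le> (norm (W - (p o\<^sub>L W)) + norm b) * norm z"
        by (simp add: algebra_simps)
    qed simp
    have w2: "norm (R o\<^sub>L (W - (p' o\<^sub>L W))) \<le> 2 * norm b"
    proof (rule norm_blinfun_bound)
      fix z
      have eq: "(R o\<^sub>L (W - (p' o\<^sub>L W))) z = b z - (1 / n) *\<^sub>R sX (\<phi> (b z)) v"
        using bounded_ops_scale[OF R(1), of "\<phi> (b z)" v]
        by (simp add: blinfun.diff_left p' b blinfun.diff_right blinfun.add_right blinfun.scaleR_right Rv)
      have "norm ((R o\<^sub>L (W - (p' o\<^sub>L W))) z) \<le> norm (b z) + norm (b z)"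
        unfolding eq using small[of "b z"] norm_triangle_ineq4[of "b z" "(1 / n) *\<^sub>R sX (\<phi> (b z)) v"]
        by linarith
      also have "\<dots> \<le> norm b * norm z + norm b * norm z"
        by (intro add_mono norm_blinfun)
      finally show "norm ((R o\<^sub>L (W - (p' o\<^sub>L W))) z) \<le> (2 * norm b) * norm z"
        by (simp add: algebra_simps)
    qed simp
    have fix_z: "p' (p (W z) + R (W z - p (W z))) = p (W z) + R (W z - p (W z))"
      unfolding v_def[symmetric] by (simp only: blinfun.add_right p'p p'v)
    have pp': "p (p' u) = p u" for u
      using bounded_ops_scale[OF p(1)] by (simp add: p' blinfun.add_right blinfun.scaleR_right p pv)
    have "p' = p + rank_one sX \<psi> ((1 / n) *\<^sub>R v)"
      by (rule blinfun_eqI) (simp add: p' blinfun.add_left rank_one_apply[OF X] \<psi> X.scale_scaleR)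
    then have "\<exists>\<psi> v. p' = p + rank_one sX \<psi> v" by blast
    then show thesis
      by (rule that[OF op p'p' p'R p'p np' fix_z w1[unfolded b_def] w2[unfolded b_def] pp'])
  qed
qed

text \<open>
  \<open>W k\<close> becomes a right inverse of the \<open>k\<close>-th partial sum of \<open>T1\<close>. At the multiples of \<open>N\<close> the
  projection \<open>p\<close> is enlarged for the next member of the dense sequence, whose index is shifted by one
  because the first multiple is \<open>N\<close>. Starting with \<open>p 0 = R 0\<close> makes \<open>W 0 - p 0 \<circ> W 0\<close> vanish, so that
  the norm of \<open>W0\<close> does not enter the recursive estimates.
\<close>

locale block_recursion = block_data sX sY T A R PP G0 W0 U U' y C \<beta> d
  for sX :: "'k::real_or_complex \<Rightarrow> 'x::banach \<Rightarrow> 'x" and sY :: "'k \<Rightarrow> 'y::banach \<Rightarrow> 'y"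
    and T A R PP G0 W0 U U' y C \<beta> d +
  fixes W :: "nat \<Rightarrow> 'y::banach \<Rightarrow>\<^sub>L 'x::banach" and p :: "nat \<Rightarrow> 'x \<Rightarrow>\<^sub>L 'x" and N :: nat
  assumes N: "N > 0" and N_large: "1 + C \<le> ((2 * C + 5) / (2 * C + 4)) ^ N"
    and W_0: "W 0 = W0" and p_0: "p 0 = R 0"
    and W_op: "W k \<in> bounded_ops sY sX" and p_op: "p k \<in> bounded_ops sX sX"
    and p_idem: "p k (p k u) = p k u" and p_R: "p k (R k u) = p k u"
    and p_prev: "p (Suc k) (p k u) = p k u"
    and W_Suc: "W (Suc k) = W k + corr k (W k) (p k)"
    and p_same: "\<not> N dvd Suc k \<Longrightarrow> p (Suc k) = p k"
    and p_norm_Suc: "N dvd Suc k \<Longrightarrow> norm (p (Suc k)) \<le> norm (p k) + C * (1 + norm (p k))"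
    and p_fixes: "N dvd Suc k \<Longrightarrow> z = y (Suc k div N - 1) \<Longrightarrow>
       p (Suc k) (p k (W (Suc k) z) + R (Suc k) (W (Suc k) z - p k (W (Suc k) z)))
         = p k (W (Suc k) z) + R (Suc k) (W (Suc k) z - p k (W (Suc k) z))"
    and p_W: "N dvd Suc k \<Longrightarrow> norm (W (Suc k) - (p (Suc k) o\<^sub>L W (Suc k)))
       \<le> norm (W (Suc k) - (p k o\<^sub>L W (Suc k))) + norm (R (Suc k) o\<^sub>L (W (Suc k) - (p k o\<^sub>L W (Suc k))))"
    and p_RW: "N dvd Suc k \<Longrightarrow> norm (R (Suc k) o\<^sub>L (W (Suc k) - (p (Suc k) o\<^sub>L W (Suc k))))
       \<le> 2 * norm (R (Suc k) o\<^sub>L (W (Suc k) - (p k o\<^sub>L W (Suc k))))"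

lemma (in block_data) block_recursion_exists:
  obtains W p N where "block_recursion sX sY T A R PP G0 W0 U U' y C \<beta> d W p N"
proof -
  have "1 < (2 * C + 5) / (2 * C + 4)" using C by simp
  then obtain N0 where N0: "1 + C < ((2 * C + 5) / (2 * C + 4)) ^ N0"
    using real_arch_pow by blast
  define N where "N = Suc N0"
  have N: "N > 0" "1 + C \<le> ((2 * C + 5) / (2 * C + 4)) ^ N"
  proof -
    have "((2 * C + 5) / (2 * C + 4)) ^ N0 \<le> ((2 * C + 5) / (2 * C + 4)) ^ N"
      by (rule power_increasing) (use C in \<open>auto simp: N_def\<close>)
    then show "1 + C \<le> ((2 * C + 5) / (2 * C + 4)) ^ N" using N0 by linarith
  qed (simp add: N_def)
  define good where "good k st \<longleftrightarrow> (case st of (W :: 'y \<Rightarrow>\<^sub>L 'x, p :: 'x \<Rightarrow>\<^sub>L 'x) \<Rightarrow> W \<in> bounded_ops sY sX \<and> p \<in> bounded_ops sX sX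
      \<and> (\<forall>u. p (p u) = p u) \<and> (\<forall>u. p (R k u) = p u))" for k and st :: "('y \<Rightarrow>\<^sub>L 'x) \<times> ('x \<Rightarrow>\<^sub>L 'x)"
  define step where "step k st st' \<longleftrightarrow> (case st of (W :: 'y \<Rightarrow>\<^sub>L 'x, p :: 'x \<Rightarrow>\<^sub>L 'x) \<Rightarrow>
      case st' of (W' :: 'y \<Rightarrow>\<^sub>L 'x, p' :: 'x \<Rightarrow>\<^sub>L 'x) \<Rightarrow>
      W' = W + corr k W p \<and> (\<forall>u. p' (p u) = p u) \<and> (\<not> N dvd Suc k \<longrightarrow> p' = p) \<and>
      (N dvd Suc k \<longrightarrow> norm p' \<le> norm p + C * (1 + norm p) \<and>
         (\<forall>z. z = y (Suc k div N - 1) \<longrightarrow>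
           p' (p (W' z) + R (Suc k) (W' z - p (W' z))) = p (W' z) + R (Suc k) (W' z - p (W' z))) \<and>
         norm (W' - (p' o\<^sub>L W')) \<le> norm (W' - (p o\<^sub>L W')) + norm (R (Suc k) o\<^sub>L (W' - (p o\<^sub>L W'))) \<and>
         norm (R (Suc k) o\<^sub>L (W' - (p' o\<^sub>L W'))) \<le> 2 * norm (R (Suc k) o\<^sub>L (W' - (p o\<^sub>L W')))))"
    for k and st st' :: "('y \<Rightarrow>\<^sub>L 'x) \<times> ('x \<Rightarrow>\<^sub>L 'x)"
  have ex: "\<exists>st'. good (Suc k) st' \<and> step k st st'" if g: "good k st" for k st
  proof -
    obtain W p where st: "st = (W, p)" by (cases st)
    have W: "W \<in> bounded_ops sY sX" and p: "p \<in> bounded_ops sX sX" "\<And>u. p (p u) = p u" "\<And>u. p (R k u) = p u"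
      using g by (auto simp: good_def st)
    define W' where "W' = W + corr k W p"
    have W': "W' \<in> bounded_ops sY sX" unfolding W'_def by (intro bounded_ops_add[OF X] corr_op W p)
    have pR: "p (R (Suc k) u) = p u" for u by (metis p(3) R_next)
    show ?thesis
    proof (cases "N dvd Suc k")
      case False
      then show ?thesis
        by (intro exI[of _ "(W', p)"]) (simp add: good_def step_def st W' p pR W'_def[symmetric])
    next
      case True
      obtain p' where "p' \<in> bounded_ops sX sX" "\<And>u. p' (p' u) = p' u" "\<And>u. p' (R (Suc k) u) = p' u"
        "\<And>u. p' (p u) = p u" "norm p' \<le> norm p + C * (1 + norm p)"
        "p' (p (W' (y (Suc k div N - 1))) + R (Suc k) (W' (y (Suc k div N - 1)) - p (W' (y (Suc k div N - 1)))))
            = p (W' (y (Suc k div N - 1))) + R (Suc k) (W' (y (Suc k div N - 1)) - p (W' (y (Suc k div N - 1))))"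
        "norm (W' - (p' o\<^sub>L W')) \<le> norm (W' - (p o\<^sub>L W')) + norm (R (Suc k) o\<^sub>L (W' - (p o\<^sub>L W')))"
        "norm (R (Suc k) o\<^sub>L (W' - (p' o\<^sub>L W'))) \<le> 2 * norm (R (Suc k) o\<^sub>L (W' - (p o\<^sub>L W')))"
        by (rule enlarge_projection[OF X order_trans[OF zero_le_one C] R_op[of "Suc k"] R_idem[of "Suc k"]
              R_norm[of "Suc k"] p(1,2) pR, where W = W' and z = "y (Suc k div N - 1)"]) (rule that)
      then show ?thesis using True W'
        by (intro exI[of _ "(W', p')"]) (simp add: good_def step_def st W'_def[symmetric])
    qed
  qed
  have init: "good 0 (W0, R 0)" by (simp add: good_def W0_op R_op R_idem)
  have "\<exists>f. f 0 = (W0, R 0) \<and> (\<forall>k. good k (f k)) \<and> (\<forall>k. step k (f k) (f (Suc k)))"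
  proof -
    have "\<exists>f. \<forall>n. (good n (f n) \<and> (n = 0 \<longrightarrow> f n = (W0, R 0))) \<and> step n (f n) (f (Suc n))"
      by (rule dependent_nat_choice) (use init ex in auto)
    then show ?thesis by blast
  qed
  then obtain f where f: "f 0 = (W0, R 0)" "\<And>k. good k (f k)" "\<And>k. step k (f k) (f (Suc k))" by blast
  define W where "W k = fst (f k)" for k
  define p where "p k = snd (f k)" for k
  have fWp: "f k = (W k, p k)" for k by (simp add: W_def p_def)
  have g: "W k \<in> bounded_ops sY sX" "p k \<in> bounded_ops sX sX" "p k (p k u) = p k u" "p k (R k u) = p k u" for k u
    using f(2)[of k] unfolding good_def fWp prod.case by blast+
  have step_k: "W (Suc k) = W k + corr k (W k) (p k)" "p (Suc k) (p k u) = p k u"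
    "\<not> N dvd Suc k \<Longrightarrow> p (Suc k) = p k"
    "N dvd Suc k \<Longrightarrow> norm (p (Suc k)) \<le> norm (p k) + C * (1 + norm (p k))"
    "N dvd Suc k \<Longrightarrow> z = y (Suc k div N - 1) \<Longrightarrow>
       p (Suc k) (p k (W (Suc k) z) + R (Suc k) (W (Suc k) z - p k (W (Suc k) z)))
         = p k (W (Suc k) z) + R (Suc k) (W (Suc k) z - p k (W (Suc k) z))"
    "N dvd Suc k \<Longrightarrow> norm (W (Suc k) - (p (Suc k) o\<^sub>L W (Suc k)))
       \<le> norm (W (Suc k) - (p k o\<^sub>L W (Suc k))) + norm (R (Suc k) o\<^sub>L (W (Suc k) - (p k o\<^sub>L W (Suc k))))"
    "N dvd Suc k \<Longrightarrow> norm (R (Suc k) o\<^sub>L (W (Suc k) - (p (Suc k) o\<^sub>L W (Suc k))))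
       \<le> 2 * norm (R (Suc k) o\<^sub>L (W (Suc k) - (p k o\<^sub>L W (Suc k))))" for k u z
    using f(3)[of k] unfolding step_def fWp prod.case by blast+
  have zero: "W 0 = W0" "p 0 = R 0" using f(1) by (auto simp: W_def p_def)
  have "block_recursion sX sY T A R PP G0 W0 U U' y C \<beta> d W p N"
    by unfold_locales (rule N zero g step_k; assumption)+
  then show thesis by (rule that)
qed


context block_recursion
begin

subsection \<open>Algebra of the recursion\<close>

definition V :: "nat \<Rightarrow> 'y \<Rightarrow>\<^sub>L 'x" where "V k = corr k (W k) (p k)"

definition J :: "nat \<Rightarrow> 'x \<Rightarrow>\<^sub>L 'y" where "J k = U k o\<^sub>L (id_blinfun - p k)"

primrec G :: "nat \<Rightarrow> 'x \<Rightarrow>\<^sub>L 'y" where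
  "G 0 = G0"
| "G (Suc k) = G k + l ^ k *\<^sub>R J k"

lemma V_apply: "V k v = (1 / l ^ k) *\<^sub>R U' k v - eps k (W k v - p k (W k v))"
  by (simp add: V_def corr_def blinfun.diff_left blinfun.scaleR_left)

lemma J_apply: "J k u = U k (u - p k u)"
  by (simp add: J_def blinfun.diff_left)

lemma V_op: "V k \<in> bounded_ops sY sX"
  unfolding V_def by (intro corr_op W_op p_op)

lemma J_op: "J k \<in> bounded_ops sX sY"
  unfolding J_def by (intro bounded_ops_compose[where t = sX] bounded_ops_diff[OF X] U_op p_op bounded_ops_id)

lemma G_op: "G k \<in> bounded_ops sX sY"
  by (induction k) (auto intro: G0_op bounded_ops_add[OF Y] bounded_ops_scaleR[OF Y] J_op)

lemma eps_V: "eps k (V k v) = V k v"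
proof -
  have "eps k (eps k u) = eps k u" for u
    by (simp add: eps_apply R_idem R_next blinfun.diff_right)
  then show ?thesis by (simp add: V_apply blinfun.diff_right blinfun.scaleR_right eps_U')
qed

lemma R_V: "R k (V k v) = 0" by (metis R_eps eps_V)

lemma R_Suc_V: "R (Suc k) (V k v) = V k v" by (metis R_Suc_eps eps_V)

lemma p_V: "p k (V k v) = 0"
  by (metis R_V p_R blinfun.zero_right)

lemma p_R_Suc: "p k (R (Suc k) u) = p k u" by (metis p_R R_next)

lemma G_R: "G k (R k u) = G k u"
proof (induction k arbitrary: u)
  case 0
  then show ?case by (simp add: G0R)
next
  case (Suc k)
  have 1: "G k (R (Suc k) u) = G k u" by (metis Suc R_next)
  have "eps k (R (Suc k) u) = eps k u" by (simp add: eps_apply R_next R_idem blinfun.diff_right)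
  then have 2: "U k (R (Suc k) u) = U k u"
    using U_eps'[of k "R (Suc k) u"] U_eps'[of k u] by simp
  show ?case
    by (simp add: blinfun.add_left blinfun.scaleR_left J_apply 1 2 p_R_Suc blinfun.diff_right)
qed

lemma G_V: "G k (V k v) = 0" by (metis G_R R_V blinfun.zero_right)

text \<open>
  The correction in \<open>V k\<close> is made for this identity: it cancels the value of the new term on \<open>W k\<close>, and
  \<open>G k\<close> does not see \<open>V k\<close>.
\<close>

lemma G_W: "G k (W k v) = PP k v"
proof (induction k)
  case 0
  then show ?case by (simp add: W_0 G0W0)
next
  case (Suc k)
  have W: "W (Suc k) v = W k v + V k v" by (simp add: W_Suc V_def blinfun.add_left)
  have "U k (V k v) = (1 / l ^ k) *\<^sub>R (PP (Suc k) v - PP k v) - U k (W k v - p k (W k v))"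
    by (simp add: V_apply blinfun.diff_right[of "U k"] blinfun.scaleR_right UU' U_eps')
  then have "J k (W k v + V k v) = (1 / l ^ k) *\<^sub>R (PP (Suc k) v - PP k v)"
    by (simp add: J_apply blinfun.add_right p_V blinfun.diff_right)
  then have "l ^ k *\<^sub>R J k (W k v + V k v) = PP (Suc k) v - PP k v"
    using l by simp
  then show ?case unfolding W by (simp add: blinfun.add_left blinfun.scaleR_left blinfun.add_right[of "G k"] Suc G_V)
qed

lemma PP_J: "k \<le> j \<Longrightarrow> PP k (J j u) = 0" by (simp add: J_apply PP_U)

lemma PP_G: "PP k (G k u) = G k u"
proof (induction k)
  case 0
  have "PP 0 (G0 u) = G0 (W0 (G0 u))" by (simp add: G0W0)
  then show ?case by (simp add: W0G0 G0R)
next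
  case (Suc k)
  have "PP (Suc k) (G k u) = G k u" by (metis Suc PP_prev)
  moreover have "PP (Suc k) (J k u) = J k u" by (simp add: J_apply PP_Suc_U)
  ultimately show ?case by (simp add: blinfun.add_left blinfun.scaleR_left blinfun.add_right blinfun.scaleR_right)
qed

lemma PP_G_later: "k \<le> n \<Longrightarrow> PP k (G n u) = G k u"
proof (induction n rule: dec_induct)
  case base
  then show ?case by (rule PP_G)
next
  case (step n)
  then show ?case by (simp add: blinfun.add_left blinfun.scaleR_left blinfun.add_right blinfun.scaleR_right PP_J)
qed

text \<open>The kernels of \<open>G k\<close> and \<open>R k\<close> agree, hence \<open>T = T - A k\<close> on the kernel of \<open>G k\<close>.\<close>

lemma G_zero_imp_R_zero: "G k u = 0 \<Longrightarrow> R k u = 0"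
proof (induction k)
  case 0
  then show ?case by (metis G.simps(1) W0G0 blinfun.zero_right)
next
  case (Suc k)
  have "G k u = PP k (G (Suc k) u)" by (simp add: PP_G_later del: G.simps)
  then have Gk: "G k u = 0" using Suc.prems by simp
  then have Rk: "R k u = 0" by (rule Suc.IH)
  have "l ^ k *\<^sub>R J k u = 0" using Suc.prems Gk by (simp add: blinfun.add_left blinfun.scaleR_left)
  then have "J k u = 0" using l by simp
  moreover have "p k u = 0" by (metis Rk p_R blinfun.zero_right)
  ultimately have "U k u = 0" by (simp add: J_apply)
  then have "R (Suc k) (u - R k u) = 0" by (metis U'U blinfun.zero_right)
  then show ?case using Rk by simp
qed

lemma p_p: "k \<le> j \<Longrightarrow> p j (p k u) = p k u"
proof (induction j rule: dec_induct)
  case base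
  then show ?case by (rule p_idem)
next
  case (step n)
  then show ?case by (metis p_prev)
qed

lemma G_p: "k \<le> n \<Longrightarrow> G n (p k u) = G k (p k u)"
proof (induction n rule: dec_induct)
  case (step n)
  then show ?case by (simp add: blinfun.add_left blinfun.scaleR_left J_apply p_p)
qed simp


subsection \<open>Estimates\<close>

text \<open>\<open>\<sigma>\<close> bounds the growth that is due to the enlargements of the projections \<open>p\<close>; they take
  place once in \<open>N\<close> steps.\<close>

definition \<sigma> :: real where "\<sigma> = (2 * C + 5) / (2 * C + 4)"

definition s :: "nat \<Rightarrow> real" where "s k = (1 + C) ^ (k div N)"

lemma \<sigma>: "1 < \<sigma>" "l * \<sigma> < 1" "\<sigma> * (2 * C + 4) = 2 * C + 5"
proof -
  have "0 < 2 * C + 4" "0 < C + 2" using C by auto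
  then show "1 < \<sigma>" "\<sigma> * (2 * C + 4) = 2 * C + 5" by (auto simp: \<sigma>_def field_simps)
  have "l = (2 * C + 2) / (2 * C + 4)" using \<open>0 < C + 2\<close> by (simp add: l_def field_simps)
  then have "l * \<sigma> = ((2 * C + 2) * (2 * C + 5)) / ((2 * C + 4) * (2 * C + 4))"
    by (simp only: \<sigma>_def times_divide_times_eq)
  also have "\<dots> < 1"
  proof -
    have "(2 * C + 2) * (2 * C + 5) < (2 * C + 4) * (2 * C + 4)" using C by (simp add: algebra_simps)
    moreover have "0 < (2 * C + 4) * (2 * C + 4)" using C by simp
    ultimately show ?thesis by (simp only: divide_less_eq_1) simp
  qed
  finally show "l * \<sigma> < 1" .
qed

lemma s_0: "s 0 = 1" by (simp add: s_def)

lemma s_ge_1: "1 \<le> s k" using C by (simp add: s_def)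

lemma s_Suc: "s (Suc k) = (if N dvd Suc k then (1 + C) * s k else s k)"
  by (simp add: s_def div_Suc mod_eq_0_iff_dvd)

lemma s_le: "s k \<le> \<sigma> ^ k"
proof -
  have "s k \<le> (\<sigma> ^ N) ^ (k div N)" unfolding s_def
    by (rule power_mono) (use N_large C in \<open>auto simp: \<sigma>_def\<close>)
  also have "\<dots> = \<sigma> ^ (N * (k div N))" by (simp add: power_mult)
  also have "\<dots> \<le> \<sigma> ^ k" by (rule power_increasing) (use \<sigma> in auto)
  finally show ?thesis .
qed

lemma p_norm: "1 + norm (p k) \<le> (1 + C) * s k"
proof (induction k)
  case 0
  then show ?case using R_norm[of 0] by (simp add: p_0 s_0)
next
  case (Suc k)
  show ?case
  proof (cases "N dvd Suc k")
    case True
    have "1 + norm (p (Suc k)) \<le> (1 + C) * (1 + norm (p k))"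
      using p_norm_Suc[OF True] by (simp add: algebra_simps)
    also have "\<dots> \<le> (1 + C) * ((1 + C) * s k)" using Suc C by (intro mult_left_mono) auto
    finally show ?thesis using True by (simp add: s_Suc)
  next
    case False
    then show ?thesis using Suc by (simp add: p_same s_Suc)
  qed
qed

lemma J_norm: "norm (l ^ k *\<^sub>R J k) \<le> C * (1 + C)\<^sup>2 * (l * \<sigma>) ^ k"
proof -
  have "norm (id_blinfun - p k) \<le> 1 + norm (p k)"
    using norm_triangle_ineq4[of id_blinfun "p k"] norm_blinfun_id_le[where 'a = 'x] by linarith
  also have "\<dots> \<le> (1 + C) * \<sigma> ^ k"
    using p_norm[of k] s_le[of k] C by (meson mult_left_mono order_trans add_nonneg_nonneg zero_le_one)
  finally have 1: "norm (id_blinfun - p k) \<le> (1 + C) * \<sigma> ^ k" .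
  have "norm (J k) \<le> (C * (1 + C)) * ((1 + C) * \<sigma> ^ k)" unfolding J_def
    by (rule order_trans[OF norm_blinfun_compose mult_mono[OF U_norm 1]]) (use C in auto)
  then have "l ^ k * norm (J k) \<le> l ^ k * ((C * (1 + C)) * ((1 + C) * \<sigma> ^ k))"
    using l by (intro mult_left_mono) auto
  then show ?thesis using l by (simp add: power2_eq_square power_mult_distrib mult_ac)
qed

text \<open>Only this part of \<open>W k\<close> is carried along by the recursion, since \<open>p k \<circ> V k = 0\<close>.\<close>

definition w :: "nat \<Rightarrow> 'y \<Rightarrow>\<^sub>L 'x" where "w k = W k - (p k o\<^sub>L W k)"

text \<open>The constant in the bound for the new term \<open>U' k / l ^ k\<close>.\<close>

definition c :: real where "c = 2 * (2 * C + 2)\<^sup>2"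

lemma c: "0 \<le> c" by (simp add: c_def)

lemma U'_scaled_norm:
  assumes "d k \<le> D"
  shows "norm ((1 / l ^ k) *\<^sub>R U' k) \<le> c * D * (2 * C + 4) ^ k"
proof -
  have "norm (U' k) \<le> D * (2 * (2 * C + 2) ^ (k + 2))"
    by (rule order_trans[OF U'_norm mult_right_mono[OF assms]]) (use C in simp)
  then have "norm (U' k) / l ^ k \<le> D * (2 * (2 * C + 2) ^ (k + 2)) / l ^ k"
    using l by (intro divide_right_mono) auto
  also have "\<dots> = c * D * ((2 * C + 2) / l) ^ k"
    by (simp add: c_def power_add power2_eq_square power_divide mult_ac)
  also have "(2 * C + 2) / l = 2 * C + 4" using C by (simp add: l_def field_simps)
  finally show ?thesis using l by simp
qed

text \<open>
  Splitting \<open>w\<close> by \<open>R\<close> gives a triangular recursion: the component in the range of \<open>R\<close> is multiplied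
  by at most \<open>C\<close> in each step and receives the new term, and \<open>w\<close> itself is multiplied by at most
  \<open>1 + C\<close> and receives that component. Both factors stay below the growth \<open>2 * C + 4\<close> of the new
  terms, so the new terms dominate; each enlargement of \<open>p\<close> costs the factor that is counted by \<open>s\<close>.
\<close>

lemma w_bounds:
  assumes D: "\<And>i. i < n \<Longrightarrow> d i \<le> D" "0 \<le> D" and "k \<le> n"
  shows "norm (R k o\<^sub>L w k) \<le> s k * (c * D * (2 * C + 4) ^ k) \<and>
         norm (w k) \<le> 2 * s k * (c * D * (2 * C + 4) ^ k)"
    and "k < n \<Longrightarrow> norm (V k) \<le> (3 * C + 1) * c * D * (2 * C + 5) ^ k"
proof -
  define q where "q k = c * D * (2 * C + 4) ^ k" for k
  have q0: "0 \<le> q k" for k using c D C by (simp add: q_def)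
  have q_Suc: "q (Suc k) = (2 * C + 4) * q k" for k by (simp add: q_def)
  \<comment> \<open>the component of \<open>w\<close> in the range of \<open>R\<close> after step \<open>k\<close>, before a possible enlargement of \<open>p\<close>\<close>
  define bm where "bm k = (R (Suc k) o\<^sub>L (R k o\<^sub>L w k)) + (1 / l ^ k) *\<^sub>R U' k" for k
  have V_eq: "V k = bm k - (R (Suc k) o\<^sub>L w k)" for k
    by (rule blinfun_eqI)
      (simp add: V_apply bm_def eps_apply w_def blinfun.bilinear_simps)
  have bm_eq: "R (Suc k) o\<^sub>L (W (Suc k) - (p k o\<^sub>L W (Suc k))) = bm k" for k
  proof (rule blinfun_eqI)
    fix v
    have "R (Suc k) (V k v) = bm k v - R (Suc k) (w k v)"
      unfolding R_Suc_V by (simp add: V_eq blinfun.diff_left)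
    then show "(R (Suc k) o\<^sub>L (W (Suc k) - (p k o\<^sub>L W (Suc k)))) v = bm k v"
      by (simp add: W_Suc V_def[symmetric] w_def blinfun.bilinear_simps p_V)
  qed
  have wm_eq: "W (Suc k) - (p k o\<^sub>L W (Suc k)) = (w k - (R (Suc k) o\<^sub>L w k)) + bm k" for k
  proof (rule blinfun_eqI)
    fix v
    have "V k v = bm k v - R (Suc k) (w k v)"
      by (simp add: V_eq blinfun.diff_left)
    moreover have "(W (Suc k) - (p k o\<^sub>L W (Suc k))) v = w k v + V k v"
      by (simp add: W_Suc V_def[symmetric] w_def blinfun.bilinear_simps p_V)
    ultimately show "(W (Suc k) - (p k o\<^sub>L W (Suc k))) v = ((w k - (R (Suc k) o\<^sub>L w k)) + bm k) v"
      by (simp add: blinfun.bilinear_simps)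
  qed
  have Rw: "norm (R (Suc k) o\<^sub>L x) \<le> C * norm x" for k and x :: "'y \<Rightarrow>\<^sub>L 'x"
    by (rule order_trans[OF norm_blinfun_compose mult_right_mono[OF R_norm]]) simp
  have bm_norm: "norm (bm k) \<le> (C + 1) * (s k * q k)"
    if "k < n" "norm (R k o\<^sub>L w k) \<le> s k * q k" for k
  proof -
    have "norm (bm k) \<le> C * (s k * q k) + q k" unfolding bm_def q_def
      by (rule norm_triangle_le[OF add_mono[OF order_trans[OF Rw mult_left_mono] U'_scaled_norm]])
        (use that D C in \<open>auto simp: q_def\<close>)
    moreover have "q k \<le> s k * q k" using mult_right_mono[OF s_ge_1[of k] q0[of k]] by simp
    ultimately have "norm (bm k) \<le> C * (s k * q k) + s k * q k" by linarith
    then show ?thesis by (simp add: algebra_simps)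
  qed
  have bounds: "norm (R k o\<^sub>L w k) \<le> s k * q k \<and> norm (w k) \<le> 2 * s k * q k" if "k \<le> n" for k
    using that
  proof (induction k)
    case 0
    have "w 0 = 0"
    proof (rule blinfun_eqI)
      fix v
      have "R 0 (W0 v) = W0 v" by (metis W0G0 G0W0 W0P)
      then show "w 0 v = (0 :: 'y \<Rightarrow>\<^sub>L 'x) v" by (simp add: w_def W_0 p_0 blinfun.diff_left)
    qed
    then show ?case using q0[of 0] by (simp add: s_0)
  next
    case (Suc k)
    then have k: "k < n" and IH: "norm (R k o\<^sub>L w k) \<le> s k * q k" "norm (w k) \<le> 2 * s k * q k" by auto
    define z where "z = s k * q k"
    have z: "0 \<le> z" using s_ge_1[of k] q0[of k] by (simp add: z_def)
    have b: "norm (bm k) \<le> (C + 1) * z" using bm_norm[OF k IH(1)] by (simp add: z_def)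
    have "norm (w k - (R (Suc k) o\<^sub>L w k)) \<le> norm (w k) + C * norm (w k)"
      using norm_triangle_ineq4[of "w k" "R (Suc k) o\<^sub>L w k"] Rw[of k "w k"] by linarith
    also have "\<dots> = (1 + C) * norm (w k)" by (simp add: algebra_simps)
    also have "\<dots> \<le> (1 + C) * (2 * z)" using IH(2) C by (intro mult_left_mono) (auto simp: z_def)
    finally have wm: "norm (W (Suc k) - (p k o\<^sub>L W (Suc k))) \<le> (1 + C) * (2 * z) + (C + 1) * z"
      unfolding wm_eq using b by (intro norm_triangle_le add_mono)
    have Cz: "0 \<le> C * z" "z \<le> C * z" "0 \<le> C * (C * z)"
      using C z mult_right_mono[OF C z] by auto
    show ?case
    proof (cases "N dvd Suc k")
      case True
      have 1: "norm (R (Suc k) o\<^sub>L w (Suc k)) \<le> 2 * ((C + 1) * z)"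
        using p_RW[OF True] b unfolding w_def bm_eq by linarith
      have 2: "norm (w (Suc k)) \<le> ((1 + C) * (2 * z) + (C + 1) * z) + (C + 1) * z"
        using p_W[OF True] b wm unfolding w_def[of "Suc k"] bm_eq by linarith
      have "s (Suc k) * q (Suc k) = (1 + C) * ((2 * C + 4) * z)"
        using True by (simp add: s_Suc q_Suc z_def mult_ac)
      then show ?thesis using 1 2 Cz z by (simp add: algebra_simps)
    next
      case False
      have 1: "norm (R (Suc k) o\<^sub>L w (Suc k)) \<le> (C + 1) * z"
        using b unfolding w_def p_same[OF False] bm_eq .
      have 2: "norm (w (Suc k)) \<le> (1 + C) * (2 * z) + (C + 1) * z"
        using wm unfolding w_def[of "Suc k"] p_same[OF False] .
      have "s (Suc k) * q (Suc k) = (2 * C + 4) * z"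
        using False by (simp add: s_Suc q_Suc z_def mult_ac)
      then show ?thesis using 1 2 Cz z by (simp add: algebra_simps)
    qed
  qed
  show "norm (R k o\<^sub>L w k) \<le> s k * (c * D * (2 * C + 4) ^ k) \<and>
         norm (w k) \<le> 2 * s k * (c * D * (2 * C + 4) ^ k)"
    using bounds[OF assms(3)] by (simp only: q_def)
  assume k: "k < n"
  note bk = bounds[OF assms(3)]
  have "norm (V k) \<le> norm (bm k) + C * norm (w k)"
    unfolding V_eq using norm_triangle_ineq4[of "bm k" "R (Suc k) o\<^sub>L w k"] Rw[of k "w k"] by linarith
  also have "\<dots> \<le> (C + 1) * (s k * q k) + C * (2 * s k * q k)"
    using bm_norm[OF k] bk C by (intro add_mono mult_left_mono) auto
  also have "\<dots> = (3 * C + 1) * (s k * q k)" by (simp add: algebra_simps)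
  also have "\<dots> \<le> (3 * C + 1) * (\<sigma> ^ k * q k)"
    using s_le q0 C by (intro mult_left_mono mult_right_mono) auto
  also have "\<dots> = (3 * C + 1) * c * D * (\<sigma> * (2 * C + 4)) ^ k"
    by (simp add: q_def power_mult_distrib mult_ac)
  finally show "norm (V k) \<le> (3 * C + 1) * c * D * (2 * C + 5) ^ k" by (simp only: \<sigma>(3))
qed

subsection \<open>The two factors\<close>

definition e :: real where "e = (3 * C + 1) * c"

lemma e: "0 \<le> e" using C c by (simp add: e_def)

lemma beta: "0 \<le> \<beta>" using order_trans[OF norm_ge_zero TA[of 0]] by simp

lemma d: "0 \<le> d k"
proof -
  have "0 \<le> d k * (2 * (2 * C + 2) ^ (k + 2))" using U'_norm[of k] norm_ge_zero order_trans by blast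
  moreover have "0 < 2 * (2 * C + 2) ^ (k + 2)" using C by simp
  ultimately show ?thesis by (simp only: zero_le_mult_iff) linarith
qed

lemma TA_V_bound:
  assumes "k \<le> n"
  shows "norm (T - A n) * norm (V k) \<le> e * (\<beta> / (2 * C + 6) ^ n) * (2 * C + 5) ^ k"
proof -
  \<comment> \<open>the bounds for \<open>norm (T - A n) * d i\<close> apply to the largest \<open>d i\<close>, since it is one of them\<close>
  define D where "D = Max (d ` {..n})"
  have D: "d i \<le> D" if "i < Suc n" for i unfolding D_def using that by (intro Max_ge) auto
  have "D \<in> d ` {..n}" unfolding D_def by (intro Max_in) auto
  then have TD: "norm (T - A n) * D \<le> \<beta> / (2 * C + 6) ^ n" and D0: "0 \<le> D" using TA_d d by auto
  have "norm (V k) \<le> (3 * C + 1) * c * D * (2 * C + 5) ^ k"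
    by (rule w_bounds(2)[of "Suc n", OF D D0]) (use assms in auto)
  then have "norm (T - A n) * norm (V k) \<le> norm (T - A n) * (e * D * (2 * C + 5) ^ k)"
    by (intro mult_left_mono) (auto simp: e_def)
  also have "\<dots> = (e * (2 * C + 5) ^ k) * (norm (T - A n) * D)" by (simp add: mult_ac)
  also have "\<dots> \<le> (e * (2 * C + 5) ^ k) * (\<beta> / (2 * C + 6) ^ n)"
    using e C by (intro mult_left_mono TD) auto
  finally show ?thesis by (simp add: mult_ac)
qed

definition \<rho> :: real where "\<rho> = (2 * C + 5) / (2 * C + 6)"

lemma \<rho>: "0 < \<rho>" "\<rho> < 1" using C by (auto simp: \<rho>_def)

lemma T_V_norm: "norm (T o\<^sub>L V k) \<le> e * \<beta> * \<rho> ^ k"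
proof -
  have "T o\<^sub>L V k = (T - A k) o\<^sub>L V k"
  proof (rule blinfun_eqI)
    fix v
    have "A k (V k v) = 0" by (metis A_R R_V blinfun.zero_right)
    then show "(T o\<^sub>L V k) v = ((T - A k) o\<^sub>L V k) v" by (simp add: blinfun.diff_left)
  qed
  then have "norm (T o\<^sub>L V k) \<le> norm (T - A k) * norm (V k)" by (simp add: norm_blinfun_compose)
  also have "\<dots> \<le> e * (\<beta> / (2 * C + 6) ^ k) * (2 * C + 5) ^ k" by (rule TA_V_bound) simp
  finally show ?thesis by (simp add: \<rho>_def power_divide)
qed

lemma W_sum: "W n = W0 + (\<Sum>k<n. V k)"
  by (induction n) (auto simp: W_0 W_Suc V_def)

lemma G_sum: "G n = G0 + (\<Sum>k<n. l ^ k *\<^sub>R J k)"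
  by (induction n) auto

definition T1 :: "'x \<Rightarrow>\<^sub>L 'y" where "T1 = G0 + (\<Sum>k. l ^ k *\<^sub>R J k)"

definition T2 :: "'y \<Rightarrow>\<^sub>L 'x" where "T2 = (T o\<^sub>L W0) + (\<Sum>k. T o\<^sub>L V k)"

lemma G_limit: "G \<longlonglongrightarrow> T1"
proof -
  have "summable (\<lambda>k. l ^ k *\<^sub>R J k)"
  proof (rule summable_comparison_test')
    show "summable (\<lambda>k. C * (1 + C)\<^sup>2 * (l * \<sigma>) ^ k)"
      using l \<sigma> by (intro summable_mult summable_geometric) auto
  qed (rule J_norm)
  then show ?thesis
    unfolding T1_def G_sum[abs_def] by (intro tendsto_add tendsto_const summable_LIMSEQ)
qed

lemma TW_limit: "(\<lambda>n. T o\<^sub>L W n) \<longlonglongrightarrow> T2"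
proof -
  have "summable (\<lambda>k. T o\<^sub>L V k)"
  proof (rule summable_comparison_test')
    show "summable (\<lambda>k. e * \<beta> * \<rho> ^ k)"
      using \<rho> by (intro summable_mult summable_geometric) auto
  qed (rule T_V_norm)
  moreover have "T o\<^sub>L W n = (T o\<^sub>L W0) + (\<Sum>k<n. T o\<^sub>L V k)" for n
    by (rule blinfun_eqI) (simp add: W_sum blinfun.add_left blinfun.add_right blinfun.sum_left blinfun.sum_right)
  ultimately show ?thesis
    unfolding T2_def by (simp only:) (intro tendsto_add tendsto_const summable_LIMSEQ)
qed

lemma rank_R: "B \<in> bounded_ops sX u \<Longrightarrow> normed_space_over u \<Longrightarrow> \<exists>n. rank_le u (B o\<^sub>L R k) n"
  using R_fin[of k] rank_le_compose_left[OF X] by blast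

lemma compact_T1: "compact_op T1"
proof (rule compact_op_limit[OF G_limit])
  fix n
  have "G n = G n o\<^sub>L R n" by (rule blinfun_eqI) (simp add: G_R)
  then obtain m where "rank_le sY (G n) m" using rank_R[OF G_op Y, of n n] by auto
  then show "compact_op (G n)" by (rule compact_op_finite_rank[OF X Y G_op])
qed

lemma compact_V: "compact_op (T o\<^sub>L V k)"
proof -
  have eq: "T o\<^sub>L V k = (T o\<^sub>L R (Suc k)) o\<^sub>L V k" by (rule blinfun_eqI) (simp add: R_Suc_V)
  obtain m where "rank_le sX (T o\<^sub>L R (Suc k)) m" using rank_R[OF T_op X, of "Suc k"] by auto
  then have "rank_le sX (T o\<^sub>L V k) m" unfolding eq by (rule rank_le_compose_right)
  then show ?thesis by (rule compact_op_finite_rank[OF Y X bounded_ops_compose[OF T_op V_op]])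
qed

lemma compact_TW: "compact_op (T o\<^sub>L W n)"
proof (induction n)
  case 0
  have "R 0 (W0 v) = W0 v" for v by (metis W0G0 G0W0 W0P)
  then have eq: "T o\<^sub>L W 0 = (T o\<^sub>L R 0) o\<^sub>L W0" by (intro blinfun_eqI) (simp add: W_0)
  obtain m where "rank_le sX (T o\<^sub>L R 0) m" using rank_R[OF T_op X, of 0] by auto
  then have "rank_le sX (T o\<^sub>L W 0) m" unfolding eq by (rule rank_le_compose_right)
  then show ?case by (rule compact_op_finite_rank[OF Y X bounded_ops_compose[OF T_op W_op]])
next
  case (Suc n)
  have "T o\<^sub>L W (Suc n) = (T o\<^sub>L W n) + (T o\<^sub>L V n)"
    by (rule blinfun_eqI) (simp add: W_Suc V_def blinfun.add_left blinfun.add_right)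
  then show ?case using Suc compact_V[of n] by (simp add: compact_op_add)
qed

lemma compact_T2: "compact_op T2"
  by (rule compact_op_limit[OF TW_limit compact_TW])

lemma T1_op: "T1 \<in> bounded_ops sX sY"
  by (rule bounded_ops_limit[OF Y G_limit G_op])

lemma T2_op: "T2 \<in> bounded_ops sY sX"
  by (rule bounded_ops_limit[OF X TW_limit]) (intro bounded_ops_compose[where t = sX] T_op W_op)

lemma G_limit_apply: "(\<lambda>n. G n u) \<longlonglongrightarrow> T1 u"
  by (intro tendsto_intros G_limit)

lemma PP_T1: "PP k (T1 u) = G k u"
proof (rule LIMSEQ_unique)
  show "(\<lambda>n. PP k (G n u)) \<longlonglongrightarrow> PP k (T1 u)"
    by (intro tendsto_intros G_limit_apply)
  show "(\<lambda>n. PP k (G n u)) \<longlonglongrightarrow> G k u"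
    by (rule tendsto_eventually) (rule eventually_sequentiallyI[of k], rule PP_G_later)
qed

text \<open>All terms of \<open>T1\<close> from the \<open>k\<close>-th on annihilate the range of \<open>p k\<close>.\<close>

lemma T1_p: "T1 (p k u) = G k (p k u)"
proof (rule LIMSEQ_unique)
  show "(\<lambda>n. G n (p k u)) \<longlonglongrightarrow> T1 (p k u)" by (rule G_limit_apply)
  show "(\<lambda>n. G n (p k u)) \<longlonglongrightarrow> G k (p k u)"
    by (rule tendsto_eventually) (rule eventually_sequentiallyI[of k], rule G_p)
qed

lemma y_in_range: "y i \<in> range T1"
proof -
  define k where "k = N * Suc i - 1"
  have k: "Suc k = N * Suc i" using N by (simp add: k_def)
  then have dvd: "N dvd Suc k" and idx: "y i = y (Suc k div N - 1)" using N by auto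
  have ik: "Suc i \<le> Suc k" unfolding k using N by (cases N) auto
  \<comment> \<open>\<open>W (Suc k) (y i)\<close> is a preimage for the partial sum, and \<open>u\<close> is the one that \<open>p (Suc k)\<close> fixes\<close>
  define u where "u = p k (W (Suc k) (y i)) + R (Suc k) (W (Suc k) (y i) - p k (W (Suc k) (y i)))"
  have pu: "p (Suc k) u = u" unfolding u_def by (rule p_fixes[OF dvd idx])
  have "G (Suc k) u = G (Suc k) (W (Suc k) (y i))"
    unfolding u_def blinfun.add_right blinfun.diff_right G_R by simp
  also have "\<dots> = y i" using PP_PP(2)[OF ik, of "y i"] by (simp only: G_W y_fixed)
  finally have "T1 u = y i" using T1_p[of "Suc k" u] pu by simp
  then show ?thesis by (metis rangeI)
qed

lemma dense_T1: "closure (range T1) = UNIV"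
proof -
  have "closure (range y) \<subseteq> closure (range T1)" by (intro closure_mono) (use y_in_range in auto)
  then show ?thesis using y_dense by auto
qed

lemma TA_limits: "(\<lambda>n. norm (T - A n)) \<longlonglongrightarrow> 0" "(\<lambda>n. norm (T - A n) * norm (W n)) \<longlonglongrightarrow> 0"
proof -
  have 0: "(\<lambda>n. \<beta> / (2 * C + 6) ^ n) \<longlonglongrightarrow> 0"
  proof -
    have "(\<lambda>n. \<beta> * (1 / (2 * C + 6)) ^ n) \<longlonglongrightarrow> \<beta> * 0"
      using C by (intro tendsto_mult tendsto_const LIMSEQ_power_zero) auto
    then show ?thesis by (simp add: power_divide)
  qed
  show 1: "(\<lambda>n. norm (T - A n)) \<longlonglongrightarrow> 0"
    by (rule tendsto_sandwich[OF _ _ tendsto_const 0]) (auto simp: TA)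
  have le: "norm (T - A n) * norm (W n) \<le> \<beta> / (2 * C + 6) ^ n * norm W0 + e * \<beta> * \<rho> ^ n" for n
  proof -
    have geo: "(\<Sum>k<n. (2 * C + 5) ^ k) \<le> (2 * C + 5) ^ n"
    proof (induction n)
      case (Suc n)
      have "1 * (2 * C + 5) ^ n \<le> (2 * C + 4) * (2 * C + 5) ^ n" using C by (intro mult_right_mono) auto
      then show ?case using Suc by (simp add: algebra_simps)
    qed simp
    have "norm (W n) \<le> norm W0 + (\<Sum>k<n. norm (V k))"
      using norm_triangle_ineq[of W0 "\<Sum>k<n. V k"] norm_sum[of V "{..<n}"] by (simp only: W_sum[of n])
    then have "norm (T - A n) * norm (W n)
        \<le> norm (T - A n) * norm W0 + (\<Sum>k<n. norm (T - A n) * norm (V k))"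
      unfolding sum_distrib_left[symmetric] distrib_left[symmetric] by (rule mult_left_mono) simp
    also have "\<dots> \<le> \<beta> / (2 * C + 6) ^ n * norm W0 + (\<Sum>k<n. e * (\<beta> / (2 * C + 6) ^ n) * (2 * C + 5) ^ k)"
      by (intro add_mono mult_right_mono sum_mono TA TA_V_bound) auto
    also have "(\<Sum>k<n. e * (\<beta> / (2 * C + 6) ^ n) * (2 * C + 5) ^ k)
        = e * (\<beta> / (2 * C + 6) ^ n) * (\<Sum>k<n. (2 * C + 5) ^ k)" by (simp add: sum_distrib_left)
    also have "\<dots> \<le> e * (\<beta> / (2 * C + 6) ^ n) * (2 * C + 5) ^ n"
      using e beta C by (intro mult_left_mono geo) auto
    finally show ?thesis by (simp add: \<rho>_def power_divide)
  qed
  have "(\<lambda>n. \<beta> / (2 * C + 6) ^ n * norm W0 + e * \<beta> * \<rho> ^ n) \<longlonglongrightarrow> 0 * norm W0 + e * \<beta> * 0"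
    using \<rho> by (intro tendsto_intros 0 LIMSEQ_power_zero) auto
  then have 2: "(\<lambda>n. \<beta> / (2 * C + 6) ^ n * norm W0 + e * \<beta> * \<rho> ^ n) \<longlonglongrightarrow> 0" by simp
  show "(\<lambda>n. norm (T - A n) * norm (W n)) \<longlonglongrightarrow> 0"
    by (rule tendsto_sandwich[OF _ _ tendsto_const 2]) (simp_all only: le norm_ge_zero mult_nonneg_nonneg eventually_True)
qed

text \<open>
  The difference \<open>u - W n (T1 u)\<close> lies in the kernel of \<open>G n\<close>, on which \<open>T\<close> is as small as \<open>T - A n\<close>; this
  outweighs the growth of \<open>W n\<close>.
\<close>

lemma factorization: "T = T2 o\<^sub>L T1"
proof (rule blinfun_eqI)
  fix u
  have bound: "norm (T u - (T o\<^sub>L W n) (T1 u))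
      \<le> norm (T - A n) * norm u + norm (T - A n) * norm (W n) * norm (T1 u)" for n
  proof -
    define z where "z = u - W n (T1 u)"
    have "G n z = 0" by (simp add: z_def blinfun.diff_right G_W PP_T1)
    then have "R n z = 0" by (rule G_zero_imp_R_zero)
    then have "A n z = 0" by (metis A_R blinfun.zero_right)
    then have "T u - (T o\<^sub>L W n) (T1 u) = (T - A n) z"
      by (simp add: blinfun.diff_left) (simp add: z_def blinfun.diff_right)
    also have "norm \<dots> \<le> norm (T - A n) * norm z" by (rule norm_blinfun)
    also have "\<dots> \<le> norm (T - A n) * (norm u + norm (W n) * norm (T1 u))"
      unfolding z_def
      by (intro mult_left_mono order_trans[OF norm_triangle_ineq4] add_left_mono norm_blinfun) simp
    finally show ?thesis by (simp add: algebra_simps)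
  qed
  have "(\<lambda>n. norm (T - A n) * norm u + norm (T - A n) * norm (W n) * norm (T1 u))
      \<longlonglongrightarrow> 0 * norm u + 0 * norm (T1 u)"
    by (intro tendsto_intros TA_limits)
  then have null: "(\<lambda>n. norm (T - A n) * norm u + norm (T - A n) * norm (W n) * norm (T1 u)) \<longlonglongrightarrow> 0"
    by simp
  have "(\<lambda>n. T u - (T o\<^sub>L W n) (T1 u)) \<longlonglongrightarrow> 0"
    by (rule Lim_null_comparison[OF _ null]) (intro always_eventually allI bound)
  then have "(\<lambda>n. T u - (T u - (T o\<^sub>L W n) (T1 u))) \<longlonglongrightarrow> T u - 0"
    by (intro tendsto_diff tendsto_const)
  then have 1: "(\<lambda>n. (T o\<^sub>L W n) (T1 u)) \<longlonglongrightarrow> T u" by simp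
  have 2: "(\<lambda>n. (T o\<^sub>L W n) (T1 u)) \<longlonglongrightarrow> T2 (T1 u)"
    by (rule blinfun.tendsto[OF TW_limit tendsto_const])
  show "T u = (T2 o\<^sub>L T1) u" using LIMSEQ_unique[OF 1 2] by simp
qed

end

theorem (in block_data) block_factorization:
  "\<exists>T1\<in>bounded_ops sX sY. \<exists>T2\<in>bounded_ops sY sX.
     T = T2 o\<^sub>L T1 \<and> closure (range (blinfun_apply T1)) = UNIV \<and> compact_op T1 \<and> compact_op T2"
proof -
  obtain W p N where "block_recursion sX sY T A R PP G0 W0 U U' y C \<beta> d W p N"
    by (rule block_recursion_exists)
  then interpret block_recursion sX sY T A R PP G0 W0 U U' y C \<beta> d W p N .
  show ?thesis using T1_op T2_op factorization dense_T1 compact_T1 compact_T2 by blast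
qed


section \<open>The Banach--Mazur distance\<close>

lemma bm_dist_ge_1:
  fixes s :: "'k::real_or_complex \<Rightarrow> 'a::real_normed_vector \<Rightarrow> 'a"
    and t :: "'k \<Rightarrow> 'b::real_normed_vector \<Rightarrow> 'b"
  assumes s: "normed_space_over s" and M: "module.subspace s M" and x: "x \<in> M" "x \<noteq> 0"
  shows "1 \<le> bm_dist s t M N"
  unfolding bm_dist_def
proof (rule INF_greatest)
  fix \<psi> assume \<psi>: "\<psi> \<in> isomorphisms s t M N"
  note iso = isomorphism_inverse[OF s M \<psi>]
  define a where "a = enn2real (opnorm_on M \<psi>)"
  define b where "b = enn2real (opnorm_on N (inv_into M \<psi>))"
  have "norm x \<le> b * norm (\<psi> x)" using iso(8)[OF iso(3)[OF x(1)]] iso(5)[OF x(1)] by (simp add: b_def)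
  also have "\<dots> \<le> b * (a * norm x)" unfolding a_def by (intro mult_left_mono iso(7) x) (simp add: b_def)
  finally have "1 \<le> a * b" using x(2) by (simp add: mult_ac)
  then have "1 \<le> ennreal (a * b)" by simp
  also have "\<dots> = opnorm_on M \<psi> * opnorm_on N (inv_into M \<psi>)"
    using \<psi> by (simp add: a_def b_def ennreal_mult isomorphisms_def)
  finally show "1 \<le> opnorm_on M \<psi> * opnorm_on N (inv_into M \<psi>)" .
qed

lemma bm_dist_le_operators:
  fixes s :: "'k::real_or_complex \<Rightarrow> 'a::real_normed_vector \<Rightarrow> 'a"
    and t :: "'k \<Rightarrow> 'b::real_normed_vector \<Rightarrow> 'b"
    and U :: "'a \<Rightarrow>\<^sub>L 'b" and U' :: "'b \<Rightarrow>\<^sub>L 'a"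
  assumes U: "U \<in> bounded_ops s t"
    and M: "\<And>x. x \<in> M \<Longrightarrow> U x \<in> N" "\<And>x. x \<in> M \<Longrightarrow> U' (U x) = x"
    and N: "\<And>y. y \<in> N \<Longrightarrow> U' y \<in> M" "\<And>y. y \<in> N \<Longrightarrow> U (U' y) = y"
  shows "bm_dist s t M N \<le> ennreal (norm U * norm U')"
proof -
  let ?U = "blinfun_apply U"
  have inj: "inj_on ?U M" using M(2) by (metis inj_onI)
  have im: "?U ` M = N"
  proof
    show "?U ` M \<subseteq> N" using M(1) by blast
    show "N \<subseteq> ?U ` M" using N by (metis imageI subsetI)
  qed
  have inv: "inv_into M ?U y = U' y" if "y \<in> N" for y
    by (rule inv_into_f_eq[OF inj N(1)[OF that] N(2)[OF that]])
  have 1: "opnorm_on M ?U \<le> ennreal (norm U)" by (rule opnorm_on_le) (auto simp: norm_blinfun)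
  have 2: "opnorm_on N (inv_into M ?U) \<le> ennreal (norm U')"
    by (rule opnorm_on_le) (simp_all add: inv norm_blinfun)
  have "?U \<in> isomorphisms s t M N"
    unfolding isomorphisms_def klinear_on_def
    using inj im U le_less_trans[OF 1] le_less_trans[OF 2]
    by (auto simp: bij_betw_def blinfun.add_right bounded_ops_scale)
  then have "bm_dist s t M N \<le> opnorm_on M ?U * opnorm_on N (inv_into M ?U)"
    unfolding bm_dist_def by (rule INF_lower)
  also have "\<dots> \<le> ennreal (norm U) * ennreal (norm U')" by (rule mult_mono[OF 1 2]) auto
  also have "\<dots> = ennreal (norm U * norm U')" by (simp add: ennreal_mult)
  finally show ?thesis .
qed

text \<open>The isomorphism is normalized so that the whole distance is charged to its inverse. If it has norm
  \<open>0\<close>, then both ranges are trivial.\<close>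

lemma operators_of_bm_dist:
  fixes s :: "'k::real_or_complex \<Rightarrow> 'a::real_normed_vector \<Rightarrow> 'a"
    and t :: "'k \<Rightarrow> 'b::real_normed_vector \<Rightarrow> 'b"
  assumes s: "normed_space_over s" and t: "normed_space_over t"
    and P: "P \<in> bounded_ops s s" "\<And>x. P (P x) = P x" and Q: "Q \<in> bounded_ops t t" "\<And>y. Q (Q y) = Q y"
    and bm: "bm_dist s t (range (blinfun_apply P)) (range (blinfun_apply Q)) < ennreal r"
  obtains U U' where "U \<in> bounded_ops s t" "U' \<in> bounded_ops t s"
    "\<And>x. U' (U x) = P x" "\<And>y. U (U' y) = Q y" "\<And>x. U (P x) = U x" "\<And>y. U' (Q y) = U' y"
    "norm U \<le> norm P" "norm U' \<le> r * norm Q"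
proof -
  interpret s: normed_space_over s by fact
  interpret t: normed_space_over t by fact
  let ?M = "range (blinfun_apply P)" and ?N = "range (blinfun_apply Q)"
  obtain \<psi> where \<psi>: "\<psi> \<in> isomorphisms s t ?M ?N"
      "opnorm_on ?M \<psi> * opnorm_on ?N (inv_into ?M \<psi>) < ennreal r"
    using bm unfolding bm_dist_def INF_less_iff by blast
  define \<psi>' where "\<psi>' = inv_into ?M \<psi>"
  define a where "a = enn2real (opnorm_on ?M \<psi>)"
  define b where "b = enn2real (opnorm_on ?N \<psi>')"
  note iso = isomorphism_inverse[OF s subspace_range_op[OF s s P(1)] \<psi>(1), folded \<psi>'_def, folded a_def b_def]
  have ab: "0 \<le> a" "0 \<le> b" "a * b < r"
    using opnorm_product_less[OF \<psi>(2)] \<psi>(1) by (auto simp: a_def b_def \<psi>'_def isomorphisms_def)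
  have r: "0 < r" using ab mult_nonneg_nonneg[OF ab(1,2)] by linarith
  have PM: "P x \<in> ?M" and QN: "Q y \<in> ?N" for x y by auto
  show thesis
  proof (cases "a = 0")
    case True
    have P0: "P x = 0" for x
    proof -
      have "\<psi> (P x) = 0" using iso(7)[OF PM, of x] True by simp
      moreover have "\<psi> 0 = 0" by (rule klinear_on_zero[OF iso(1)]) (metis PM blinfun.zero_right)
      ultimately show ?thesis using iso(5)[OF PM, of x] iso(5)[of 0] by (metis PM blinfun.zero_right)
    qed
    have Q0: "Q y = 0" for y
      using iso(7)[OF iso(4)[OF QN], of y] iso(6)[OF QN, of y] True by simp
    show thesis
      by (rule that[of 0 0]) (auto simp: bounded_ops_zero s t P0 Q0 less_imp_le[OF r])
  next
    case False
    then have a: "a > 0" using ab by simp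
    define u where "u x = (1 / a) *\<^sub>R \<psi> (P x)" for x
    define u' where "u' y = a *\<^sub>R \<psi>' (Q y)" for y
    have add: "\<psi> (P x + P z) = \<psi> (P x) + \<psi> (P z)" "\<psi> (s c (P x)) = t c (\<psi> (P x))" for x z c
      using iso(1) PM unfolding klinear_on_def by blast+
    have add': "\<psi>' (Q x + Q z) = \<psi>' (Q x) + \<psi>' (Q z)" "\<psi>' (t c (Q x)) = s c (\<psi>' (Q x))" for x z c
      using iso(2) QN unfolding klinear_on_def by blast+
    have u_lin: "u (x + z) = u x + u z" "u (s c x) = t c (u x)" for x z c
      by (simp_all add: u_def blinfun.add_right add scaleR_add_right bounded_ops_scale[OF P(1)] t.scale_scaleR)
    have u'_lin: "u' (x + z) = u' x + u' z" "u' (t c x) = s c (u' x)" for x z c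
      by (simp_all add: u'_def blinfun.add_right add' scaleR_add_right bounded_ops_scale[OF Q(1)] s.scale_scaleR)
    have nu: "norm (u x) \<le> norm P * norm x" for x
    proof -
      have "norm (u x) \<le> (1 / a) * (a * norm (P x))" unfolding u_def
        using iso(7)[OF PM, of x] a by (simp add: field_simps)
      also have "\<dots> = norm (P x)" using a by simp
      also have "\<dots> \<le> norm P * norm x" by (rule norm_blinfun)
      finally show ?thesis .
    qed
    have nu': "norm (u' y) \<le> (r * norm Q) * norm y" for y
    proof -
      have "norm (u' y) \<le> a * (b * norm (Q y))" unfolding u'_def
        using iso(8)[OF QN, of y] a by simp
      also have "\<dots> = (a * b) * norm (Q y)" by simp
      also have "\<dots> \<le> r * (norm Q * norm y)"
        using ab r by (intro mult_mono norm_blinfun) auto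
      finally show ?thesis by (simp add: mult.assoc)
    qed
    have "bounded_linear u"
    proof (rule bounded_linear_intro[where K = "norm P"])
      show "u (c *\<^sub>R x) = c *\<^sub>R u x" for c x using u_lin(2)[of "of_real c" x] by (simp add: s.scale_of_real t.scale_of_real)
    qed (use u_lin nu in \<open>auto simp: mult.commute\<close>)
    then have U: "blinfun_apply (Blinfun u) = u" by (rule bounded_linear_Blinfun_apply)
    have "bounded_linear u'"
    proof (rule bounded_linear_intro[where K = "r * norm Q"])
      show "u' (c *\<^sub>R x) = c *\<^sub>R u' x" for c x using u'_lin(2)[of "of_real c" x] by (simp add: s.scale_of_real t.scale_of_real)
    qed (use u'_lin nu' in \<open>auto simp: mult.commute\<close>)
    then have U': "blinfun_apply (Blinfun u') = u'" by (rule bounded_linear_Blinfun_apply)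
    have \<psi>Q: "Q (\<psi> (P x)) = \<psi> (P x)" for x using iso(3)[OF PM, of x] Q(2) by auto
    have \<psi>P: "P (\<psi>' (Q y)) = \<psi>' (Q y)" for y using iso(4)[OF QN, of y] P(2) by auto
    have sc: "\<psi> (r *\<^sub>R P x) = r *\<^sub>R \<psi> (P x)" for r x
      using add(2)[of "of_real r" x] by (simp add: s.scale_of_real t.scale_of_real)
    have sc': "\<psi>' (r *\<^sub>R Q x) = r *\<^sub>R \<psi>' (Q x)" for r x
      using add'(2)[of "of_real r" x] by (simp add: s.scale_of_real t.scale_of_real)
    have U'U: "u' (u x) = P x" for x
    proof -
      have "u' (u x) = a *\<^sub>R \<psi>' ((1 / a) *\<^sub>R Q (\<psi> (P x)))"
        by (simp only: u_def u'_def blinfun.scaleR_right)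
      also have "\<dots> = \<psi>' (Q (\<psi> (P x)))" using a by (simp only: sc') simp
      also have "\<dots> = P x" by (simp only: \<psi>Q iso(5)[OF PM])
      finally show ?thesis .
    qed
    have UU': "u (u' y) = Q y" for y
    proof -
      have "u (u' y) = (1 / a) *\<^sub>R \<psi> (a *\<^sub>R P (\<psi>' (Q y)))"
        by (simp only: u_def u'_def blinfun.scaleR_right)
      also have "\<dots> = \<psi> (P (\<psi>' (Q y)))" using a by (simp only: sc) simp
      also have "\<dots> = Q y" by (simp only: \<psi>P iso(6)[OF QN])
      finally show ?thesis .
    qed
    show thesis
    proof (rule that[of "Blinfun u" "Blinfun u'"], unfold U U')
      show "Blinfun u \<in> bounded_ops s t" "Blinfun u' \<in> bounded_ops t s"
        by (rule bounded_opsI, simp add: U U' u_lin u'_lin)+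
      show "u' (u x) = P x" "u (u' y) = Q y" for x y by (fact U'U UU')+
      show "u (P x) = u x" "u' (Q y) = u' y" for x y by (simp_all add: u_def u'_def P Q)
      show "norm (Blinfun u) \<le> norm P" by (rule norm_blinfun_bound) (simp_all add: U nu)
      show "norm (Blinfun u') \<le> r * norm Q" by (rule norm_blinfun_bound) (use r in \<open>simp_all add: U' nu'\<close>)
    qed
  qed
qed

text \<open>Biorthogonal functionals extend the linear bijection of two bases, and its inverse, to bounded
  operators on the whole spaces.\<close>

lemma bm_dist_finite:
  fixes s :: "'k::real_or_complex \<Rightarrow> 'a::real_normed_vector \<Rightarrow> 'a"
    and t :: "'k \<Rightarrow> 'b::real_normed_vector \<Rightarrow> 'b"
  assumes s: "normed_space_over s" and t: "normed_space_over t"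
    and M: "fin_dim_subspace s M" and N: "fin_dim_subspace t N"
    and dim: "vector_space.dim s M = vector_space.dim t N"
  shows "bm_dist s t M N < \<infinity>"
proof -
  interpret s: normed_space_over s by fact
  interpret t: normed_space_over t by fact
  obtain B where B: "finite B" "s.independent B" "s.span B = M" "card B = s.dim M" "B \<subseteq> M" "s.subspace M"
    by (rule fin_dim_subspace_basis[OF s M]) (rule that)
  obtain B' where B': "finite B'" "t.independent B'" "t.span B' = N" "card B' = t.dim N" "B' \<subseteq> N" "t.subspace N"
    by (rule fin_dim_subspace_basis[OF t N]) (rule that)
  obtain f where f: "bij_betw f B B'"
    using finite_same_card_bij[OF B(1) B'(1)] B(4) B'(4) dim by auto
  obtain \<beta> where \<beta>: "\<And>b. b \<in> B \<Longrightarrow> \<beta> b \<in> dual s"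
    "\<And>b c. b \<in> B \<Longrightarrow> c \<in> B \<Longrightarrow> blinfun_apply (\<beta> b) c = (if b = c then 1 else 0)"
    using dual_biorthogonal[OF s B(1,2)] by metis
  obtain \<gamma> where \<gamma>: "\<And>b. b \<in> B' \<Longrightarrow> \<gamma> b \<in> dual t"
    "\<And>b c. b \<in> B' \<Longrightarrow> c \<in> B' \<Longrightarrow> blinfun_apply (\<gamma> b) c = (if b = c then 1 else 0)"
    using dual_biorthogonal[OF t B'(1,2)] by metis
  have fB: "f b \<in> B'" if "b \<in> B" for b using f that by (auto simp: bij_betw_def)
  have f_inj: "f b = f c \<longleftrightarrow> b = c" if "b \<in> B" "c \<in> B" for b c
    using f that by (auto simp: bij_betw_def inj_on_def)
  define U where "U = (\<Sum>b\<in>B. rank_one t (\<beta> b) (f b))"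
  define U' where "U' = (\<Sum>b\<in>B. rank_one s (\<gamma> (f b)) b)"
  have U: "U \<in> bounded_ops s t" unfolding U_def
    by (intro bounded_ops_sum[OF t] rank_one_op[OF t] \<beta>)
  have U': "U' \<in> bounded_ops t s" unfolding U'_def
    by (intro bounded_ops_sum[OF s] rank_one_op[OF s] \<gamma> fB)
  have Ub: "U c = f c" if "c \<in> B" for c
  proof -
    have "U c = (\<Sum>b\<in>B. if c = b then f b else 0)"
      unfolding U_def blinfun.sum_left
      by (intro sum.cong refl) (use \<beta>(2) that in \<open>auto simp: rank_one_apply[OF t]\<close>)
    then show ?thesis using that B(1) by simp
  qed
  have U'b: "U' (f c) = c" if "c \<in> B" for c
  proof -
    have "U' (f c) = (\<Sum>b\<in>B. if c = b then b else 0)"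
      unfolding U'_def blinfun.sum_left
      by (intro sum.cong refl) (use \<gamma>(2) fB f_inj that in \<open>auto simp: rank_one_apply[OF s]\<close>)
    then show ?thesis using that B(1) by simp
  qed
  have "bm_dist s t M N \<le> ennreal (norm U * norm U')"
  proof (rule bm_dist_le_operators[OF U])
    have sub: "s.subspace {x. U x \<in> N \<and> U' (U x) = x}"
      unfolding s.subspace_def using t.subspace_0[OF B'(6)] t.subspace_add[OF B'(6)] t.subspace_scale[OF B'(6)]
      by (simp add: blinfun.add_right bounded_ops_scale[OF U] bounded_ops_scale[OF U'])
    have "B \<subseteq> {x. U x \<in> N \<and> U' (U x) = x}" using Ub U'b fB B'(5) by auto
    then have "M \<subseteq> {x. U x \<in> N \<and> U' (U x) = x}" using s.span_minimal[OF _ sub] B(3) by blast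
    then show "U x \<in> N" "U' (U x) = x" if "x \<in> M" for x using that by auto
    have sub': "t.subspace {y. U' y \<in> M \<and> U (U' y) = y}"
      unfolding t.subspace_def using s.subspace_0[OF B(6)] s.subspace_add[OF B(6)] s.subspace_scale[OF B(6)]
      by (simp add: blinfun.add_right bounded_ops_scale[OF U] bounded_ops_scale[OF U'])
    have "B' \<subseteq> {y. U' y \<in> M \<and> U (U' y) = y}"
    proof
      fix b assume "b \<in> B'"
      then obtain c where "c \<in> B" "b = f c" using f by (auto simp: bij_betw_def)
      then show "b \<in> {y. U' y \<in> M \<and> U (U' y) = y}" using Ub U'b B(5) by auto
    qed
    then have "N \<subseteq> {y. U' y \<in> M \<and> U (U' y) = y}" using t.span_minimal[OF _ sub'] B'(3) by blast
    then show "U' y \<in> M" "U (U' y) = y" if "y \<in> N" for y using that by auto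
  qed
  also have "\<dots> < \<infinity>" by simp
  finally show ?thesis .
qed


section \<open>Direct sums and the function \<open>\<Phi>\<close>\<close>

lemma direct_sum_dim:
  assumes s: "normed_space_over s" and sum: "direct_sum s M1 M2 M"
    and M1: "fin_dim_subspace s M1" and M2: "fin_dim_subspace s M2"
  shows "vector_space.dim s M = vector_space.dim s M1 + vector_space.dim s M2"
proof -
  interpret s: normed_space_over s by fact
  obtain B where B: "finite B" "s.independent B" "s.span B = M1" "card B = s.dim M1" "B \<subseteq> M1" "s.subspace M1"
    by (rule fin_dim_subspace_basis[OF s M1]) (rule that)
  obtain D where D: "finite D" "s.independent D" "s.span D = M2" "card D = s.dim M2" "D \<subseteq> M2" "s.subspace M2"
    by (rule fin_dim_subspace_basis[OF s M2]) (rule that)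
  have int: "M1 \<inter> M2 = {0}" and M: "M = {a + b | a b. a \<in> M1 \<and> b \<in> M2}"
    using sum by (auto simp: direct_sum_def)
  have disj: "B \<inter> D = {}"
  proof -
    have "0 \<notin> B" using B(2) s.dependent_zero[of B] by auto
    moreover have "B \<inter> D \<subseteq> {0}" using Int_mono[OF B(5) D(5)] unfolding int .
    ultimately show ?thesis by auto
  qed
  have "s.independent (B \<union> D)"
  proof (rule s.independent_if_scalars_zero)
    fix f x assume 0: "(\<Sum>x\<in>B \<union> D. s (f x) x) = 0" and x: "x \<in> B \<union> D"
    let ?b = "\<Sum>x\<in>B. s (f x) x" and ?d = "\<Sum>x\<in>D. s (f x) x"
    have bd: "?b + ?d = 0" using 0 by (simp add: sum.union_disjoint[OF B(1) D(1) disj])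
    have b1: "?b \<in> M1" using B(5) by (intro s.subspace_sum[OF B(6)] s.subspace_scale[OF B(6)]) auto
    have d2: "?d \<in> M2" using D(5) by (intro s.subspace_sum[OF D(6)] s.subspace_scale[OF D(6)]) auto
    have "?b = - ?d" using bd by (simp add: eq_neg_iff_add_eq_0)
    then have "?b \<in> M2" using s.subspace_neg[OF D(6) d2] by simp
    then have b0: "?b = 0" using b1 int by blast
    then have d0: "?d = 0" using bd by simp
    from x show "f x = 0"
    proof
      assume "x \<in> B"
      then show ?thesis using s.independentD[OF B(2,1) subset_refl b0] by simp
    next
      assume "x \<in> D"
      then show ?thesis using s.independentD[OF D(2,1) subset_refl d0] by simp
    qed
  qed (use B D in auto)
  moreover have "s.span (B \<union> D) = M" using M B(3) D(3) by (simp add: s.span_Un)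
  ultimately have "s.dim M = card (B \<union> D)" using s.dim_span_eq_card_independent by metis
  also have "\<dots> = s.dim M1 + s.dim M2" using B D disj by (simp add: card_Un_disjoint)
  finally show ?thesis .
qed

lemma good_sum_projection:
  assumes s: "normed_space_over s" and M: "module.subspace s M"
    and P: "P \<in> bounded_ops s s" "\<And>x. x \<in> M \<Longrightarrow> P x \<in> M" "\<And>x. x \<in> M \<Longrightarrow> P (P x) = P x"
    and c: "norm P < c" "norm (id_blinfun - P) < c"
  shows "good_sum s c ((\<lambda>x. P x) ` M) ((\<lambda>x. x - P x) ` M) M"
proof -
  interpret s: normed_space_over s by fact
  let ?M1 = "(\<lambda>x. P x) ` M" and ?M2 = "(\<lambda>x. x - P x) ` M"
  have cpos: "0 < c" using c(1) norm_ge_zero[of P] by linarith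
  have 1: "P a = a" if "a \<in> ?M1" for a using that P(3) by auto
  have 2: "P a = 0" if "a \<in> ?M2" for a using that P(3) by (auto simp: blinfun.diff_right)
  have split: "sum_proj ?M1 ?M2 x = P x" "sum_proj ?M2 ?M1 x = x - P x" if x: "x \<in> M" for x
  proof -
    show "sum_proj ?M1 ?M2 x = P x" unfolding sum_proj_def
    proof (rule the_equality)
      show "P x \<in> ?M1 \<and> (\<exists>b\<in>?M2. x = P x + b)" using x
        by (intro conjI imageI bexI[of _ "x - P x"]) auto
      fix a assume "a \<in> ?M1 \<and> (\<exists>b\<in>?M2. x = a + b)"
      then obtain b where ab: "a \<in> ?M1" "b \<in> ?M2" "x = a + b" by (elim conjE bexE) (rule that)
      have "P x = P a + P b" by (simp only: ab(3) blinfun.add_right)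
      then show "a = P x" unfolding 1[OF ab(1)] 2[OF ab(2)] by simp
    qed
    show "sum_proj ?M2 ?M1 x = x - P x" unfolding sum_proj_def
    proof (rule the_equality)
      show "x - P x \<in> ?M2 \<and> (\<exists>b\<in>?M1. x = x - P x + b)" using x
        by (intro conjI imageI bexI[of _ "P x"]) auto
      fix a assume "a \<in> ?M2 \<and> (\<exists>b\<in>?M1. x = a + b)"
      then obtain b where ab: "a \<in> ?M2" "b \<in> ?M1" "x = a + b" by (elim conjE bexE) (rule that)
      have "P x = P a + P b" by (simp only: ab(3) blinfun.add_right)
      then show "a = x - P x" unfolding 1[OF ab(2)] 2[OF ab(1)] using ab(3) by simp
    qed
  qed
  interpret lin: Vector_Spaces.linear s s "blinfun_apply P" by (rule bounded_ops_linear[OF s s P(1)])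
  interpret lin': Vector_Spaces.linear s s "blinfun_apply (id_blinfun - P)"
    by (rule bounded_ops_linear[OF s s bounded_ops_diff[OF s bounded_ops_id P(1)]])
  have sub1: "s.subspace ?M1" by (rule lin.subspace_image[OF M])
  have sub2: "s.subspace ?M2" using lin'.subspace_image[OF M] by (simp add: blinfun.diff_left)
  have int: "?M1 \<inter> ?M2 = {0}"
  proof -
    have "x = 0" if "x \<in> ?M1" "x \<in> ?M2" for x using 1[OF that(1)] 2[OF that(2)] by simp
    then show ?thesis using s.subspace_0[OF sub1] s.subspace_0[OF sub2] by blast
  qed
  have M_eq: "M = {a + b | a b. a \<in> ?M1 \<and> b \<in> ?M2}"
  proof (intro equalityI subsetI)
    fix x assume x: "x \<in> M"
    have "x = P x + (x - P x)" by simp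
    then show "x \<in> {a + b | a b. a \<in> ?M1 \<and> b \<in> ?M2}" using x by blast
  next
    fix x assume "x \<in> {a + b | a b. a \<in> ?M1 \<and> b \<in> ?M2}"
    then obtain a b where "a \<in> M" "b \<in> M" "x = P a + (b - P b)" by blast
    then show "x \<in> M" using P(2) s.subspace_add[OF M] s.subspace_diff[OF M] by simp
  qed
  have "opnorm_on M (sum_proj ?M1 ?M2) \<le> ennreal (norm P)"
    by (rule opnorm_on_le) (simp_all add: split norm_blinfun)
  moreover have "opnorm_on M (sum_proj ?M2 ?M1) \<le> ennreal (norm (id_blinfun - P))"
  proof (rule opnorm_on_le)
    fix x assume "x \<in> M"
    then show "norm (sum_proj ?M2 ?M1 x) \<le> norm (id_blinfun - P) * norm x"
      using norm_blinfun[of "id_blinfun - P" x] by (simp add: split blinfun.diff_left)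
  qed simp
  ultimately show ?thesis
    unfolding good_sum_def direct_sum_def using sub1 sub2 int M_eq c cpos
    by (auto intro: le_less_trans ennreal_lessI)
qed

lemma Phi_upper:
  fixes s :: "'k::real_or_complex \<Rightarrow> 'a::real_normed_vector \<Rightarrow> 'a"
    and t :: "'k \<Rightarrow> 'b::real_normed_vector \<Rightarrow> 'b"
  assumes "fin_dim_subspace s M" "fin_dim_subspace t N"
    "vector_space.dim s M = vector_space.dim t N" "vector_space.dim t N \<le> n"
    "bm_dist s t M N \<le> ennreal (f n)"
    "fin_dim_subspace s M1" "M1 \<subseteq> M" "fin_dim_subspace t N1" "N1 \<subseteq> N"
    "vector_space.dim s M1 = vector_space.dim t N1" "vector_space.dim t N1 \<le> g n"
    "bm_dist s t M1 N1 \<le> ennreal (f (g n))"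
    "good_sum s (h (g n)) M1 M2 M" "good_sum t (h (g n)) N1 N2 N"
  shows "bm_dist s t M2 N2 \<le> Phi s t f g h n"
  unfolding Phi_def by (rule Sup_upper) (use assms in blast)


section \<open>Construction of the blocks\<close>

lemma rank_le_add_rank_one:
  assumes "normed_space_over t" "rank_le t A n"
  shows "rank_le t (A + rank_one t \<psi> v) (Suc n)"
proof -
  interpret t: normed_space_over t by fact
  obtain B where B: "finite B" "card B \<le> n" "range (blinfun_apply A) \<subseteq> t.span B"
    using assms(2) by (auto simp: rank_le_def)
  have "(A + rank_one t \<psi> v) x \<in> t.span (insert v B)" for x
  proof -
    have "A x \<in> t.span (insert v B)" using B(3) t.span_mono[of B "insert v B"] by auto
    moreover have "t (\<psi> x) v \<in> t.span (insert v B)" by (intro t.span_scale t.span_base) simp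
    ultimately show ?thesis unfolding blinfun.add_left rank_one_apply[OF assms(1)] by (rule t.span_add)
  qed
  moreover have "card (insert v B) \<le> Suc n" using B(1,2) by (simp add: card_insert_if)
  ultimately show ?thesis unfolding rank_le_def using B(1) by (intro exI[of _ "insert v B"]) auto
qed

text \<open>
  The projection \<open>S\<close> from \<open>local_step\<close> satisfies \<open>Q \<circ> S = Q\<close>, but its range need not contain that of \<open>Q\<close>.
  The projection \<open>P = Q + S \<circ> (1 - Q)\<close> has the kernel of \<open>S\<close> and contains the range of \<open>Q\<close>. As \<open>S\<close> and \<open>P\<close>
  have the same kernel, \<open>P \<circ> G\<close> and \<open>W\<close> are still inverse to each other between the ranges.
\<close>

lemma block_step:
  fixes sX :: "'k::real_or_complex \<Rightarrow> 'x::banach \<Rightarrow> 'x"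
    and sY :: "'k \<Rightarrow> 'y::banach \<Rightarrow> 'y"
  assumes X: "normed_space_over sX" and Y: "normed_space_over sY"
    and rX: "reflexive_space sX" and rY: "reflexive_space sY" and C: "0 \<le> C"
    and ld: "loc_dist dual_scale (dual sX) dual_scale (dual sY) K C n < ennreal r"
    and A: "A \<in> bounded_ops sX sX" "rank_le sX A i" and B: "B \<in> bounded_ops sX sX" "rank_le sX B j"
    and ij: "i + j \<le> n"
    and Q: "Q \<in> bounded_ops sY sY" "\<And>v. Q (Q v) = Q v" "rank_le sY Q n"
  obtains R P F F' where "R \<in> bounded_ops sX sX" "\<And>u. R (R u) = R u" "norm R \<le> C" "rank_le sX R (K n)"
    "\<And>u. A (R u) = A u" "\<And>u. B (R u) = B u"
    "P \<in> bounded_ops sY sY" "\<And>v. P (P v) = P v" "\<And>v. P (Q v) = Q v" "\<And>v. Q (P v) = Q v"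
    "1 + norm P \<le> (1 + C) * (1 + norm Q)"
    "F \<in> bounded_ops sX sY" "F' \<in> bounded_ops sY sX"
    "\<And>u. F' (F u) = R u" "\<And>v. F (F' v) = P v" "\<And>u. F (R u) = F u" "\<And>v. F' (P v) = F' v"
    "norm F * norm F' \<le> C\<^sup>2 * r * norm P"
proof -
  obtain F1 where F1: "finite F1" "card F1 \<le> i" "F1 \<subseteq> dual sX"
    "\<And>R :: 'x \<Rightarrow>\<^sub>L 'x. (\<And>\<phi>. \<phi> \<in> F1 \<Longrightarrow> \<phi> o\<^sub>L R = \<phi>) \<Longrightarrow> A o\<^sub>L R = A"
    using finite_rank_functionals[OF X X A] by metis
  obtain F2 where F2: "finite F2" "card F2 \<le> j" "F2 \<subseteq> dual sX"
    "\<And>R :: 'x \<Rightarrow>\<^sub>L 'x. (\<And>\<phi>. \<phi> \<in> F2 \<Longrightarrow> \<phi> o\<^sub>L R = \<phi>) \<Longrightarrow> B o\<^sub>L R = B"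
    using finite_rank_functionals[OF X X B] by metis
  obtain FY where FY: "finite FY" "card FY \<le> n" "FY \<subseteq> dual sY"
    "\<And>R :: 'y \<Rightarrow>\<^sub>L 'y. (\<And>\<phi>. \<phi> \<in> FY \<Longrightarrow> \<phi> o\<^sub>L R = \<phi>) \<Longrightarrow> Q o\<^sub>L R = Q"
    using finite_rank_functionals[OF Y Y Q(1,3)] by metis
  have FX: "F1 \<union> F2 \<subseteq> dual sX" "finite (F1 \<union> F2)" "card (F1 \<union> F2) \<le> n"
    using F1 F2 ij card_Un_le[of F1 F2] by auto
  obtain R S G W where ops: "R \<in> bounded_ops sX sX" "S \<in> bounded_ops sY sY" "G \<in> bounded_ops sX sY" "W \<in> bounded_ops sY sX"
    and eqs: "R o\<^sub>L R = R" "S o\<^sub>L S = S" "W o\<^sub>L G = R" "G o\<^sub>L W = S" "G o\<^sub>L R = G" "W o\<^sub>L S = W"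
    and norms: "norm R \<le> C" "norm S \<le> C" "norm G * norm W \<le> C\<^sup>2 * r" "rank_le sX R (K n)"
    and FXR: "\<And>\<phi>. \<phi> \<in> F1 \<union> F2 \<Longrightarrow> \<phi> o\<^sub>L R = \<phi>" and FYS: "\<And>\<phi>. \<phi> \<in> FY \<Longrightarrow> \<phi> o\<^sub>L S = \<phi>"
    by (rule local_step[OF X Y rX rY C ld FX FY(3,1,2)]) (rule that)
  have ap: "R (R u) = R u" "S (S v) = S v" "W (G u) = R u" "G (W v) = S v" "G (R u) = G u" "W (S v) = W v" for u v
    using eqs by (metis blinfun_apply_blinfun_compose)+
  have AR: "A (R u) = A u" and BR: "B (R u) = B u" for u
    using F1(4)[of R] F2(4)[of R] FXR by (metis UnCI blinfun_apply_blinfun_compose)+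
  have QS: "Q (S v) = Q v" for v
    using FY(4)[of S] FYS by (metis blinfun_apply_blinfun_compose)
  define P where "P = Q + (S o\<^sub>L (id_blinfun - Q))"
  have P: "P v = Q v + S (v - Q v)" for v by (simp add: P_def blinfun.add_left blinfun.diff_left)
  have QP: "Q (P v) = Q v" for v by (simp add: P blinfun.add_right blinfun.diff_right QS Q)
  have PQ: "P (Q v) = Q v" for v by (simp add: P Q)
  have SP: "S (P v) = S v" for v by (simp add: P blinfun.add_right blinfun.diff_right ap)
  have PS: "P (S v) = P v" for v by (simp add: P blinfun.diff_right ap QS)
  have PP: "P (P v) = P v" for v
  proof -
    have "P (P v) = Q v + (S (P v) - S (Q v))" unfolding P[of "P v"] QP blinfun.diff_right ..
    also have "\<dots> = P v" unfolding SP unfolding P[of v] blinfun.diff_right ..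
    finally show ?thesis .
  qed
  have P_op: "P \<in> bounded_ops sY sY" unfolding P_def
    by (intro bounded_ops_add[OF Y] bounded_ops_compose[where t = sY] bounded_ops_diff[OF Y] Q ops bounded_ops_id)
  have nP: "1 + norm P \<le> (1 + C) * (1 + norm Q)"
  proof -
    have 1: "norm (id_blinfun - Q) \<le> 1 + norm Q"
      using norm_triangle_ineq4[of id_blinfun Q] norm_blinfun_id_le[where 'a = 'y] by linarith
    have "norm (S o\<^sub>L (id_blinfun - Q)) \<le> C * (1 + norm Q)"
      by (rule order_trans[OF norm_blinfun_compose mult_mono[OF norms(2) 1]]) (use C in auto)
    then have "norm P \<le> norm Q + C * (1 + norm Q)" unfolding P_def
      by (intro norm_triangle_le add_left_mono)
    then show ?thesis by (simp add: algebra_simps)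
  qed
  define F where "F = P o\<^sub>L G"
  have WP: "W (P v) = W v" for v using ap(6)[of "P v"] ap(6)[of v] by (simp add: SP)
  have nF: "norm F * norm W \<le> C\<^sup>2 * r * norm P"
  proof -
    have "norm F * norm W \<le> (norm P * norm G) * norm W"
      unfolding F_def by (intro mult_right_mono norm_blinfun_compose) simp
    also have "\<dots> = norm P * (norm G * norm W)" by simp
    also have "\<dots> \<le> norm P * (C\<^sup>2 * r)" by (intro mult_left_mono norms) simp
    finally show ?thesis by (simp add: mult_ac)
  qed
  show thesis
  proof (rule that[OF ops(1) ap(1) norms(1,4) AR BR P_op PP PQ QP nP _ ops(4) _ _ _ WP nF])
    show "F \<in> bounded_ops sX sY" unfolding F_def by (intro bounded_ops_compose[where t = sY] P_op ops)
  qed (simp_all add: F_def WP ap PS)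
qed

lemma block_sequence:
  fixes sX :: "'k::real_or_complex \<Rightarrow> 'x::banach \<Rightarrow> 'x"
    and sY :: "'k \<Rightarrow> 'y::banach \<Rightarrow> 'y" and A :: "nat \<Rightarrow> 'x \<Rightarrow>\<^sub>L 'x" and y :: "nat \<Rightarrow> 'y"
  assumes X: "normed_space_over sX" and Y: "normed_space_over sY"
    and rX: "reflexive_space sX" and rY: "reflexive_space sY" and C: "1 \<le> C"
    and ld: "\<And>k. loc_dist dual_scale (dual sX) dual_scale (dual sY) K C (3 * m k) < ennreal (r k)"
    and A: "\<And>k. A k \<in> bounded_ops sX sX" "\<And>k. rank_le sX (A k) (m k)"
    and m: "\<And>k. K (3 * m k) < m (Suc k)"
  obtains R P F F' where
    "\<And>k. R k \<in> bounded_ops sX sX" "\<And>k u. R k (R k u) = R k u" "\<And>k. norm (R k) \<le> C"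
    "\<And>k. rank_le sX (R k) (K (3 * m k))"
    "\<And>k u. A k (R k u) = A k u" "\<And>k u. R k (R (Suc k) u) = R k u"
    "\<And>k. P k \<in> bounded_ops sY sY" "\<And>k v. P k (P k v) = P k v" "\<And>k v. P (Suc k) (P k v) = P k v"
    "\<And>k v. P k (P (Suc k) v) = P k v" "\<And>k. P (Suc k) (y k) = y k"
    "\<And>k. 1 + norm (P k) \<le> (2 * C + 2) ^ (k + 1)"
    "\<And>k. F k \<in> bounded_ops sX sY" "\<And>k. F' k \<in> bounded_ops sY sX"
    "\<And>k u. F' k (F k u) = R k u" "\<And>k v. F k (F' k v) = P k v" "\<And>k u. F k (R k u) = F k u"
    "\<And>k v. F' k (P k v) = F' k v"
    "\<And>k. norm (F k) * norm (F' k) \<le> C\<^sup>2 * r k * norm (P k)"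
proof -
  have C0: "0 \<le> C" using C by simp
  define good where "good k st \<longleftrightarrow> (case st of (R :: 'x \<Rightarrow>\<^sub>L 'x, P :: 'y \<Rightarrow>\<^sub>L 'y, F :: 'x \<Rightarrow>\<^sub>L 'y, F' :: 'y \<Rightarrow>\<^sub>L 'x) \<Rightarrow>
      R \<in> bounded_ops sX sX \<and> (\<forall>u. R (R u) = R u) \<and> norm R \<le> C \<and> rank_le sX R (K (3 * m k)) \<and>
      (\<forall>u. A k (R u) = A k u) \<and>
      P \<in> bounded_ops sY sY \<and> (\<forall>v. P (P v) = P v) \<and> 1 + norm P \<le> (2 * C + 2) ^ (k + 1) \<and>
      F \<in> bounded_ops sX sY \<and> F' \<in> bounded_ops sY sX \<and> (\<forall>u. F' (F u) = R u) \<and> (\<forall>v. F (F' v) = P v) \<and>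
      (\<forall>u. F (R u) = F u) \<and> (\<forall>v. F' (P v) = F' v) \<and> norm F * norm F' \<le> C\<^sup>2 * r k * norm P)" for k st
  define step where "step k st st' \<longleftrightarrow> (case st of (R :: 'x \<Rightarrow>\<^sub>L 'x, P :: 'y \<Rightarrow>\<^sub>L 'y, F :: 'x \<Rightarrow>\<^sub>L 'y, F' :: 'y \<Rightarrow>\<^sub>L 'x) \<Rightarrow>
      case st' of (R' :: 'x \<Rightarrow>\<^sub>L 'x, P' :: 'y \<Rightarrow>\<^sub>L 'y, F1 :: 'x \<Rightarrow>\<^sub>L 'y, F1' :: 'y \<Rightarrow>\<^sub>L 'x) \<Rightarrow>
      (\<forall>u. R (R' u) = R u) \<and> (\<forall>v. P' (P v) = P v) \<and> (\<forall>v. P (P' v) = P v) \<and> P' (y k) = y k)" for k st st'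
  have zero_rank: "rank_le t (0 :: 'a::real_normed_vector \<Rightarrow>\<^sub>L 'b) n"
    if "normed_space_over t" for t :: "'k \<Rightarrow> 'b::real_normed_vector \<Rightarrow> 'b" and n
  proof -
    interpret t: normed_space_over t by fact
    show ?thesis unfolding rank_le_def by (rule exI[of _ "{}"]) auto
  qed
  \<comment> \<open>the first block is a step from zero operators\<close>
  have init: "\<exists>st. good 0 st"
  proof -
    have zz: "(0 :: 'y \<Rightarrow>\<^sub>L 'y) ((0 :: 'y \<Rightarrow>\<^sub>L 'y) v) = (0 :: 'y \<Rightarrow>\<^sub>L 'y) v" for v by simp
    have le: "m 0 + 0 \<le> 3 * m 0" by simp
    obtain R P F F' where s: "R \<in> bounded_ops sX sX" "\<And>u. R (R u) = R u" "norm R \<le> C" "rank_le sX R (K (3 * m 0))"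
      "\<And>u. A 0 (R u) = A 0 u" "\<And>u. (0 :: 'x \<Rightarrow>\<^sub>L 'x) (R u) = (0 :: 'x \<Rightarrow>\<^sub>L 'x) u"
      "P \<in> bounded_ops sY sY" "\<And>v. P (P v) = P v" "\<And>v. P ((0 :: 'y \<Rightarrow>\<^sub>L 'y) v) = (0 :: 'y \<Rightarrow>\<^sub>L 'y) v"
      "\<And>v. (0 :: 'y \<Rightarrow>\<^sub>L 'y) (P v) = (0 :: 'y \<Rightarrow>\<^sub>L 'y) v"
      "1 + norm P \<le> (1 + C) * (1 + norm (0 :: 'y \<Rightarrow>\<^sub>L 'y))"
      "F \<in> bounded_ops sX sY" "F' \<in> bounded_ops sY sX"
      "\<And>u. F' (F u) = R u" "\<And>v. F (F' v) = P v" "\<And>u. F (R u) = F u" "\<And>v. F' (P v) = F' v"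
      "norm F * norm F' \<le> C\<^sup>2 * r 0 * norm P"
      by (rule block_step[OF X Y rX rY C0 ld[of 0] A(1)[of 0] A(2)[of 0] bounded_ops_zero[OF X] zero_rank[OF X, of 0] le
          bounded_ops_zero[OF Y] zz zero_rank[OF Y]]) (rule that)
    have "1 + norm P \<le> (2 * C + 2) ^ (0 + 1)" using s(11) C by simp
    then show ?thesis by (intro exI[of _ "(R, P, F, F')"]) (use s in \<open>simp add: good_def\<close>)
  qed
  have ex: "\<exists>st'. good (Suc k) st' \<and> step k st st'" if g: "good k st" for k st
  proof -
    obtain R P F F' where st: "st = (R, P, F, F')" by (cases st)
    have R: "R \<in> bounded_ops sX sX" "rank_le sX R (K (3 * m k))"
      and P: "P \<in> bounded_ops sY sY" "\<And>v. P (P v) = P v" "1 + norm P \<le> (2 * C + 2) ^ (k + 1)"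
      and F: "F \<in> bounded_ops sX sY" "F' \<in> bounded_ops sY sX"
      and FR: "\<And>v. F (F' v) = P v" "\<And>u. F (R u) = F u"
      using g by (auto simp: good_def st)
    have "P = (F o\<^sub>L R) o\<^sub>L F'" by (rule blinfun_eqI) (simp add: FR)
    then have rP: "rank_le sY P (K (3 * m k))"
      using rank_le_compose_right[OF rank_le_compose_left[OF X Y F(1) R(2)]] by metis
    \<comment> \<open>the vector \<open>y k\<close> is put into the range, by a functional that norms \<open>y k - P (y k)\<close>\<close>
    obtain Q where Q: "Q \<in> bounded_ops sY sY" "\<And>u. Q (Q u) = Q u" "\<And>u. Q (P u) = P u"
      "norm Q \<le> norm P + 1 * (1 + norm P)" "Q (P (id_blinfun (y k)) + id_blinfun (id_blinfun (y k) - P (id_blinfun (y k))))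
         = P (id_blinfun (y k)) + id_blinfun (id_blinfun (y k) - P (id_blinfun (y k)))"
      "\<And>u. P (Q u) = P u" "\<exists>\<psi> v. Q = P + rank_one sY \<psi> v"
    proof (rule enlarge_projection[OF Y zero_le_one bounded_ops_id _ norm_blinfun_id_le P(1,2),
          where W = id_blinfun and z = "y k"])
    qed (simp, simp, rule that)
    obtain \<psi> v where "Q = P + rank_one sY \<psi> v" using Q(7) by blast
    then have rQ: "rank_le sY Q (3 * m (Suc k))"
      using rank_le_mono[OF rank_le_add_rank_one[OF Y rP], of "3 * m (Suc k)"] m[of k] by simp
    have Qy: "Q (y k) = y k" using Q(5) by simp
    have le: "m (Suc k) + K (3 * m k) \<le> 3 * m (Suc k)" using m[of k] by simp
    obtain R1 P1 F1 F1' where s: "R1 \<in> bounded_ops sX sX" "\<And>u. R1 (R1 u) = R1 u" "norm R1 \<le> C"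
      "rank_le sX R1 (K (3 * m (Suc k)))"
      "\<And>u. A (Suc k) (R1 u) = A (Suc k) u" "\<And>u. R (R1 u) = R u"
      "P1 \<in> bounded_ops sY sY" "\<And>v. P1 (P1 v) = P1 v" "\<And>v. P1 (Q v) = Q v" "\<And>v. Q (P1 v) = Q v"
      "1 + norm P1 \<le> (1 + C) * (1 + norm Q)"
      "F1 \<in> bounded_ops sX sY" "F1' \<in> bounded_ops sY sX"
      "\<And>u. F1' (F1 u) = R1 u" "\<And>v. F1 (F1' v) = P1 v" "\<And>u. F1 (R1 u) = F1 u" "\<And>v. F1' (P1 v) = F1' v"
      "norm F1 * norm F1' \<le> C\<^sup>2 * r (Suc k) * norm P1"
      by (rule block_step[OF X Y rX rY C0 ld[of "Suc k"] A(1)[of "Suc k"] A(2)[of "Suc k"] R le Q(1,2) rQ]) (rule that)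
    have "(1 + C) * (1 + norm Q) \<le> (1 + C) * (2 * (1 + norm P))"
      using Q(4) C by (intro mult_left_mono) auto
    also have "\<dots> = (2 * C + 2) * (1 + norm P)" by (simp add: algebra_simps)
    also have "\<dots> \<le> (2 * C + 2) * (2 * C + 2) ^ (k + 1)" using P(3) C by (intro mult_left_mono) auto
    finally have nP1: "1 + norm P1 \<le> (2 * C + 2) ^ (Suc k + 1)" using s(11) by simp
    have 1: "P1 (P v) = P v" for v using s(9)[of "P v"] by (simp add: Q(3))
    have 2: "P (P1 v) = P v" for v using Q(6)[of "P1 v"] Q(6)[of v] by (simp add: s(10))
    have 3: "P1 (y k) = y k" using s(9)[of "y k"] by (simp add: Qy)
    show ?thesis
      by (intro exI[of _ "(R1, P1, F1, F1')"] conjI)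
        (use s nP1 1 2 3 in \<open>simp_all add: good_def step_def st\<close>)
  qed
  have "\<exists>f. \<forall>k. good k (f k) \<and> step k (f k) (f (Suc k))"
    by (rule dependent_nat_choice) (use init ex in auto)
  then obtain f where f: "\<And>k. good k (f k)" "\<And>k. step k (f k) (f (Suc k))" by blast
  define R where "R k = fst (f k)" for k
  define P where "P k = fst (snd (f k))" for k
  define F where "F k = fst (snd (snd (f k)))" for k
  define F' where "F' k = snd (snd (snd (f k)))" for k
  have fk: "f k = (R k, P k, F k, F' k)" for k by (simp add: R_def P_def F_def F'_def)
  note gk = f(1)[unfolded good_def fk prod.case]
  note sk = f(2)[unfolded step_def fk prod.case]
  show thesis
    by (rule that[of R P F F']) (use gk sk in blast)+
qed


section \<open>Lower bounds\<close>

text \<open>The subspace that contains a given nonzero functional is not trivial, so its distances are at least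
  \<open>1\<close>. Hence twice the local distance is strictly larger than it, which leaves room for an
  isomorphism that does not attain the infimum.\<close>

lemma loc_dist_ge_1:
  fixes sX :: "'k::real_or_complex \<Rightarrow> 'x::banach \<Rightarrow> 'x"
    and sY :: "'k \<Rightarrow> 'y::banach \<Rightarrow> 'y"
  assumes X: "normed_space_over sX" and x: "(x :: 'x) \<noteq> 0" and n: "1 \<le> n"
  shows "1 \<le> loc_dist dual_scale (dual sX) dual_scale (dual sY) K C n"
  unfolding loc_dist_def
proof (rule Inf_greatest)
  interpret dX: normed_space_over "dual_scale :: 'k \<Rightarrow> ('x \<Rightarrow>\<^sub>L 'k) \<Rightarrow> _"
    by (rule normed_space_over_dual_scale)
  interpret dY: normed_space_over "dual_scale :: 'k \<Rightarrow> ('y \<Rightarrow>\<^sub>L 'k) \<Rightarrow> _"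
    by (rule normed_space_over_dual_scale)
  note nX = normed_space_over_dual_scale[where 'k = 'k and 'a = 'x]
  obtain \<phi> where \<phi>: "\<phi> \<in> dual sX" "\<phi> x = of_real (norm x)"
    using norming_functional[OF X] by metis
  then have \<phi>0: "\<phi> \<noteq> 0" using x by auto
  fix z
  assume "z \<in> insert \<infinity> {ennreal r | r. 0 < r \<and>
       (\<forall>M M'. M \<subseteq> dual sX \<and> fin_dim_subspace dual_scale M \<and> dX.dim M \<le> n \<and>
               M' \<subseteq> dual sY \<and> fin_dim_subspace dual_scale M' \<and> dY.dim M' \<le> n \<longrightarrow>
          (\<exists>N N'. fin_dim_subspace dual_scale N \<and> complemented dual_scale (dual sX) C N \<and> M \<subseteq> N \<and>
                  fin_dim_subspace dual_scale N' \<and> complemented dual_scale (dual sY) C N' \<and> M' \<subseteq> N' \<and>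
                  dX.dim N = dY.dim N' \<and> dY.dim N' \<le> K n \<and>
                  bm_dist dual_scale dual_scale N N' \<le> ennreal r))}" (is "z \<in> insert \<infinity> {ennreal r | r. 0 < r \<and> ?P r}")
  then consider "z = \<infinity>" | r where "z = ennreal r" "?P r" by blast
  then show "1 \<le> z"
  proof cases
    case 2
    let ?M = "dX.span {\<phi>}" and ?M' = "dY.span {}"
    have "?M \<subseteq> dual sX" using \<phi>(1) by (intro dX.span_minimal subspace_dual) auto
    moreover have "dX.dim ?M \<le> n" using dX.dim_le_card[of ?M "{\<phi>}"] n by simp
    moreover have "fin_dim_subspace dual_scale ?M" unfolding fin_dim_subspace_def by (rule exI[of _ "{\<phi>}"]) simp
    moreover have "?M' \<subseteq> dual sY" by (intro dY.span_minimal subspace_dual) auto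
    moreover have "dY.dim ?M' \<le> n" using dY.dim_le_card[of ?M' "{}"] by simp
    moreover have "fin_dim_subspace dual_scale ?M'" unfolding fin_dim_subspace_def by (rule exI[of _ "{}"]) simp
    ultimately have "?M \<subseteq> dual sX \<and> fin_dim_subspace dual_scale ?M \<and> dX.dim ?M \<le> n \<and>
        ?M' \<subseteq> dual sY \<and> fin_dim_subspace dual_scale ?M' \<and> dY.dim ?M' \<le> n" by (intro conjI)
    from mp[OF spec[OF spec[OF 2(2), of ?M], of ?M'] this]
    obtain N and N' :: "('y \<Rightarrow>\<^sub>L 'k) set"
      where N: "fin_dim_subspace dual_scale N" "?M \<subseteq> N" "bm_dist dual_scale dual_scale N N' \<le> ennreal r"
      by (elim exE conjE) (rule that, assumption+)
    have "dX.subspace N" using N(1) dX.subspace_span unfolding fin_dim_subspace_def by metis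
    moreover have "\<phi> \<in> N" using N(2) dX.span_base[of \<phi> "{\<phi>}"] by auto
    ultimately have "1 \<le> bm_dist dual_scale dual_scale N N'" using bm_dist_ge_1[OF nX _ _ \<phi>0] by blast
    then show ?thesis unfolding 2(1) using N(3) by (rule order_trans)
  qed simp
qed

text \<open>Lines with trivial subspaces are admissible in the definition of \<open>\<Phi>\<close>. With this bound the hypothesis
  controls the approximation numbers themselves, and not only their products with distances.\<close>

lemma Phi_ge_1:
  fixes sX :: "'k::real_or_complex \<Rightarrow> 'x::banach \<Rightarrow> 'x"
    and sY :: "'k \<Rightarrow> 'y::banach \<Rightarrow> 'y"
  assumes X: "normed_space_over sX" and Y: "normed_space_over sY"
    and x0: "(x0 :: 'x) \<noteq> 0" and y0: "(y0 :: 'y) \<noteq> 0" and n: "1 \<le> n" and f: "1 \<le> f n" and h: "1 < h (g n)"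
  shows "1 \<le> Phi sX sY f g h n"
proof -
  interpret X: normed_space_over sX by fact
  interpret Y: normed_space_over sY by fact
  define x where "x = (1 / norm x0) *\<^sub>R x0"
  define y where "y = (1 / norm y0) *\<^sub>R y0"
  have nx: "norm x = 1" and ny: "norm y = 1" using x0 y0 by (auto simp: x_def y_def)
  obtain \<phi> where \<phi>: "\<phi> \<in> dual sX" "norm \<phi> \<le> 1" "\<phi> x = of_real (norm x)" using norming_functional[OF X] by metis
  obtain \<psi> where \<psi>: "\<psi> \<in> dual sY" "norm \<psi> \<le> 1" "\<psi> y = of_real (norm y)" using norming_functional[OF Y] by metis
  define U where "U = rank_one sY \<phi> y"
  define U' where "U' = rank_one sX \<psi> x"
  let ?M = "X.span {x}" and ?N = "Y.span {y}"
  have U: "U (sX c x) = sY c y" and U': "U' (sY c y) = sX c x" for c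
    using \<phi> \<psi> nx ny by (simp_all add: U_def U'_def rank_one_apply[OF X] rank_one_apply[OF Y] dual_def bounded_ops_def)
  have MN: "bm_dist sX sY ?M ?N \<le> ennreal (f n)"
  proof -
    have "bm_dist sX sY ?M ?N \<le> ennreal (norm U * norm U')"
      by (rule bm_dist_le_operators[OF rank_one_op[OF Y \<phi>(1), of y, folded U_def]])
        (auto simp: X.span_singleton Y.span_singleton U U')
    also have "norm U * norm U' \<le> 1 * 1"
    proof (rule mult_mono)
      show "norm U \<le> 1" using norm_rank_one_le[OF Y, of \<phi> y] \<phi> ny by (simp add: U_def)
      show "norm U' \<le> 1" using norm_rank_one_le[OF X, of \<psi> x] \<psi> nx by (simp add: U'_def)
    qed auto
    finally show ?thesis using f by (metis ennreal_leI mult.right_neutral order_trans)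
  qed
  have zero: "bm_dist sX sY {0} {0} \<le> ennreal (f (g n))"
  proof -
    have "bm_dist sX sY {0} {0} \<le> ennreal (norm (0 :: 'x \<Rightarrow>\<^sub>L 'y) * norm (0 :: 'y \<Rightarrow>\<^sub>L 'x))"
      by (rule bm_dist_le_operators[OF bounded_ops_zero[OF Y]]) auto
    then show ?thesis by simp
  qed
  have f0: "fin_dim_subspace sX {0}" "fin_dim_subspace sY {0}"
    unfolding fin_dim_subspace_def by (rule exI[of _ "{}"], simp)+
  have fM: "fin_dim_subspace sX ?M" "fin_dim_subspace sY ?N"
    unfolding fin_dim_subspace_def by (rule exI[of _ "{x}"], simp) (rule exI[of _ "{y}"], simp)
  have "x \<noteq> 0" "y \<noteq> 0" using nx ny by auto
  then have d1: "X.dim ?M = 1" "Y.dim ?N = 1"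
    using X.dim_span_eq_card_independent[of "{x}"] Y.dim_span_eq_card_independent[of "{y}"] by auto
  have d0: "X.dim {0} = 0" "Y.dim {0} = 0"
    using X.dim_le_card[of "{0}" "{}"] Y.dim_le_card[of "{0}" "{}"] by auto
  have "good_sum sX (h (g n)) ((\<lambda>x. (0 :: 'x \<Rightarrow>\<^sub>L 'x) x) ` ?M) ((\<lambda>x. x - (0 :: 'x \<Rightarrow>\<^sub>L 'x) x) ` ?M) ?M"
    by (rule good_sum_projection[OF X X.subspace_span bounded_ops_zero[OF X]])
      (use h norm_blinfun_id_le[where 'a = 'x] in \<open>auto simp: X.span_zero intro: le_less_trans\<close>)
  then have gM: "good_sum sX (h (g n)) {0} ?M ?M" using X.span_zero[of "{x}"] by (auto simp: image_constant_conv split: if_splits)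
  have "good_sum sY (h (g n)) ((\<lambda>x. (0 :: 'y \<Rightarrow>\<^sub>L 'y) x) ` ?N) ((\<lambda>x. x - (0 :: 'y \<Rightarrow>\<^sub>L 'y) x) ` ?N) ?N"
    by (rule good_sum_projection[OF Y Y.subspace_span bounded_ops_zero[OF Y]])
      (use h norm_blinfun_id_le[where 'a = 'y] in \<open>auto simp: Y.span_zero intro: le_less_trans\<close>)
  then have gN: "good_sum sY (h (g n)) {0} ?N ?N" using Y.span_zero[of "{y}"] by (auto simp: image_constant_conv split: if_splits)
  have "1 \<le> bm_dist sX sY ?M ?N"
    by (rule bm_dist_ge_1[OF X X.subspace_span _ \<open>x \<noteq> 0\<close>]) (simp add: X.span_base)
  also have "\<dots> \<le> Phi sX sY f g h n"
    by (rule Phi_upper[where f = f and g = g and h = h and n = n, OF fM _ _ MN f0(1) _ f0(2) _ _ _ zero gM gN])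
      (use n d1 d0 X.span_zero[of "{x}"] Y.span_zero[of "{y}"] in auto)
  finally show ?thesis .
qed


section \<open>Isomorphisms of the complements\<close>

lemma dim_range_le:
  fixes sX :: "'k::real_or_complex \<Rightarrow> 'a::real_normed_vector \<Rightarrow> 'a"
    and sY :: "'k \<Rightarrow> 'b::real_normed_vector \<Rightarrow> 'b"
    and S :: "'c::real_normed_vector \<Rightarrow>\<^sub>L 'a" and A :: "'d::real_normed_vector \<Rightarrow>\<^sub>L 'b" and D :: "'d \<Rightarrow>\<^sub>L 'c"
  assumes X: "normed_space_over sX" and Y: "normed_space_over sY" and Z: "normed_space_over sZ"
    and A: "A \<in> bounded_ops sZ sY" and B: "B \<in> bounded_ops sX sY"
    and S: "fin_dim_subspace sX (range (blinfun_apply S))" and eq: "\<And>u. A u = B (S (D u))"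
  shows "vector_space.dim sY (range (blinfun_apply A)) \<le> vector_space.dim sX (range (blinfun_apply S))"
proof -
  have "A = (B o\<^sub>L S) o\<^sub>L D" by (rule blinfun_eqI) (simp add: eq)
  then have "rank_le sY A (vector_space.dim sX (range (blinfun_apply S)))"
    using rank_le_compose_right[OF rank_le_compose_left[OF X Y B rank_le_dim_range[OF X S]]] by metis
  then show ?thesis by (rule rank_le_dim(2)[OF Z Y A])
qed

text \<open>
  The admissible pairs are the ranges of \<open>R1\<close> and \<open>P1\<close>, with the subspaces \<open>R1 (range R0)\<close> and the range
  of \<open>P0\<close>. The range of \<open>R0\<close> need not lie in that of \<open>R1\<close>; its image under \<open>R1\<close> does, and \<open>R1 \<circ> R0\<close> is
  a projection onto it with norm at most \<open>C\<^sup>2\<close>. The second conclusion is needed where nothing bounds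
  \<open>\<Phi>\<close>; it follows from a count of dimensions.
\<close>

lemma block_isomorphism:
  fixes sX :: "'k::real_or_complex \<Rightarrow> 'x::banach \<Rightarrow> 'x"
    and sY :: "'k \<Rightarrow> 'y::banach \<Rightarrow> 'y" and R0 R1 :: "'x \<Rightarrow>\<^sub>L 'x" and P0 P1 :: "'y \<Rightarrow>\<^sub>L 'y"
  assumes X: "normed_space_over sX" and Y: "normed_space_over sY" and C: "1 \<le> C"
    and R0: "R0 \<in> bounded_ops sX sX" "\<And>u. R0 (R0 u) = R0 u" "norm R0 \<le> C" "rank_le sX R0 (g n)"
    and R1: "R1 \<in> bounded_ops sX sX" "\<And>u. R1 (R1 u) = R1 u" "norm R1 \<le> C" "rank_le sX R1 n"
    and R01: "\<And>u. R0 (R1 u) = R0 u"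
    and P0: "P0 \<in> bounded_ops sY sY" "\<And>v. P0 (P0 v) = P0 v"
    and P1: "P1 \<in> bounded_ops sY sY" "\<And>v. P1 (P1 v) = P1 v"
    and P01: "\<And>v. P1 (P0 v) = P0 v" "\<And>v. P0 (P1 v) = P0 v"
    and F0: "F0 \<in> bounded_ops sX sY" "F0' \<in> bounded_ops sY sX" "\<And>u. F0' (F0 u) = R0 u"
      "\<And>v. F0 (F0' v) = P0 v" "\<And>u. F0 (R0 u) = F0 u" "\<And>v. F0' (P0 v) = F0' v"
    and F1: "F1 \<in> bounded_ops sX sY" "F1' \<in> bounded_ops sY sX" "\<And>u. F1' (F1 u) = R1 u"
      "\<And>v. F1 (F1' v) = P1 v" "\<And>u. F1 (R1 u) = F1 u" "\<And>v. F1' (P1 v) = F1' v"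
    and f1: "norm F1 * norm F1' \<le> f n" and f0: "C * (norm F0 * norm F0') \<le> f (g n)"
    and h: "C\<^sup>2 + 1 < h (g n)" "1 + norm P0 < h (g n)"
  shows "bm_dist sX sY (range (blinfun_apply (R1 o\<^sub>L (id_blinfun - R0)))) (range (blinfun_apply (P1 - P0)))
       \<le> Phi sX sY f g h n"
    and "bm_dist sX sY (range (blinfun_apply (R1 o\<^sub>L (id_blinfun - R0)))) (range (blinfun_apply (P1 - P0))) < \<infinity>"
proof -
  interpret X: normed_space_over sX by fact
  interpret Y: normed_space_over sY by fact
  define p where "p = R1 o\<^sub>L R0"
  define E where "E = R1 o\<^sub>L (id_blinfun - R0)"
  define Q where "Q = P1 - P0"
  let ?M = "range (blinfun_apply R1)" and ?N = "range (blinfun_apply P1)"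
  let ?M1 = "range (blinfun_apply p)" and ?N1 = "range (blinfun_apply P0)"
  let ?M2 = "range (blinfun_apply E)" and ?N2 = "range (blinfun_apply Q)"
  have p: "p u = R1 (R0 u)" for u by (simp add: p_def)
  have E: "E u = R1 u - R1 (R0 u)" for u by (simp add: E_def blinfun.diff_left blinfun.diff_right)
  have Q: "Q v = P1 v - P0 v" for v by (simp add: Q_def blinfun.diff_left)
  have p_op: "p \<in> bounded_ops sX sX" and E_op: "E \<in> bounded_ops sX sX" and Q_op: "Q \<in> bounded_ops sY sY"
    unfolding p_def E_def Q_def
    by (intro bounded_ops_compose[where t = sX] bounded_ops_diff[OF X] bounded_ops_diff[OF Y] R0 R1 P0 P1 bounded_ops_id)+
  have pR1: "p (R1 u) = p u" and pp: "p (p u) = p u" and R1p: "R1 (p u) = p u" for u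
    by (simp_all add: p R01 R0 R1)
  have fin: "fin_dim_subspace sX ?M" "X.dim ?M \<le> n" by (rule rank_le_dim[OF X X R1(1,4)])+
  have finR0: "fin_dim_subspace sX (range (blinfun_apply R0))" "X.dim (range (blinfun_apply R0)) \<le> g n"
    by (rule rank_le_dim[OF X X R0(1,4)])+
  have rank_p: "rank_le sX p (g n)"
    unfolding p_def by (rule rank_le_compose_left[OF X X R1(1) R0(4)])
  note fin_p = rank_le_dim[OF X X p_op rank_p]
  have rank_P1: "rank_le sY P1 n"
  proof -
    have "P1 = (F1 o\<^sub>L R1) o\<^sub>L F1'" by (rule blinfun_eqI) (simp add: F1)
    then show ?thesis using rank_le_compose_right[OF rank_le_compose_left[OF X Y F1(1) R1(4)]] by metis
  qed
  have rank_P0: "rank_le sY P0 (g n)"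
  proof -
    have "P0 = (F0 o\<^sub>L R0) o\<^sub>L F0'" by (rule blinfun_eqI) (simp add: F0)
    then show ?thesis using rank_le_compose_right[OF rank_le_compose_left[OF X Y F0(1) R0(4)]] by metis
  qed
  note fin_P1 = rank_le_dim[OF Y Y P1(1) rank_P1]
  note fin_P0 = rank_le_dim[OF Y Y P0(1) rank_P0]
  have dim1: "X.dim ?M = Y.dim ?N"
  proof (rule antisym)
    show "X.dim ?M \<le> Y.dim ?N"
      by (rule dim_range_le[OF Y X X R1(1) F1(2) fin_P1(1), where D = F1]) (simp add: F1)
    show "Y.dim ?N \<le> X.dim ?M"
      by (rule dim_range_le[OF X Y Y P1(1) F1(1) fin(1), where D = F1']) (simp add: F1)
  qed
  have F0p: "F0 (p u) = F0 u" for u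
  proof -
    have "F0 (p u) = F0 (R0 (R1 (R0 u)))" by (simp only: p F0)
    also have "\<dots> = F0 u" by (simp only: R01 R0 F0)
    finally show ?thesis .
  qed
  have dim0: "X.dim ?M1 = Y.dim ?N1"
  proof (rule antisym)
    have "p u = (R1 o\<^sub>L F0') (P0 (F0 u))" for u by (simp add: p F0)
    then show "X.dim ?M1 \<le> Y.dim ?N1"
      by (rule dim_range_le[OF Y X X p_op bounded_ops_compose[OF R1(1) F0(2)] fin_P0(1)])
    show "Y.dim ?N1 \<le> X.dim ?M1"
      by (rule dim_range_le[OF X Y Y P0(1) F0(1) fin_p(1), where D = F0']) (simp add: F0p F0)
  qed
  have bm1: "bm_dist sX sY ?M ?N \<le> ennreal (f n)"
  proof -
    have "bm_dist sX sY ?M ?N \<le> ennreal (norm F1 * norm F1')"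
    proof (rule bm_dist_le_operators[OF F1(1)])
      fix x assume "x \<in> ?M"
      then have x: "R1 x = x" using R1(2) by auto
      have "F1 x = P1 (F1 x)" using F1(4)[of "F1 x"] F1(3)[of x] by (simp add: x)
      then show "F1 x \<in> ?N" by (metis rangeI)
      show "F1' (F1 x) = x" by (simp add: F1 x)
    next
      fix y assume "y \<in> ?N"
      then have y: "P1 y = y" using P1(2) by auto
      have "F1' y = R1 (F1' y)" using F1(3)[of "F1' y"] F1(4)[of y] by (simp add: y)
      then show "F1' y \<in> ?M" by (metis rangeI)
      show "F1 (F1' y) = y" by (simp add: F1 y)
    qed
    then show ?thesis using f1 by (meson ennreal_leI order_trans)
  qed
  have bm0: "bm_dist sX sY ?M1 ?N1 \<le> ennreal (f (g n))"
  proof -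
    have "bm_dist sX sY ?M1 ?N1 \<le> ennreal (norm F0 * norm (R1 o\<^sub>L F0'))"
    proof (rule bm_dist_le_operators[OF F0(1)])
      fix x assume "x \<in> ?M1"
      then have x: "p x = x" using pp by auto
      have "F0 x = P0 (F0 x)" using F0(4)[of "F0 x"] F0(3)[of x] F0(5)[of x] by simp
      then show "F0 x \<in> ?N1" by (metis rangeI)
      show "(R1 o\<^sub>L F0') (F0 x) = x" using x by (simp add: F0 p)
    next
      fix y assume "y \<in> ?N1"
      then have y: "P0 y = y" using P0(2) by auto
      have "F0' y = R0 (F0' y)" using F0(3)[of "F0' y"] F0(4)[of y] by (simp add: y)
      then have eq: "(R1 o\<^sub>L F0') y = p (F0' y)" by (simp add: p)
      then show "(R1 o\<^sub>L F0') y \<in> ?M1" by (metis rangeI)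
      show "F0 ((R1 o\<^sub>L F0') y) = y" unfolding eq by (simp add: F0p F0 y)
    qed
    also have "norm F0 * norm (R1 o\<^sub>L F0') \<le> norm F0 * (C * norm F0')"
      by (intro mult_left_mono order_trans[OF norm_blinfun_compose] mult_right_mono R1) auto
    also have "\<dots> = C * (norm F0 * norm F0')" by simp
    finally show ?thesis using f0 by (meson ennreal_leI order_trans)
  qed
  have gM: "good_sum sX (h (g n)) ?M1 ?M2 ?M"
  proof -
    have np: "norm p \<le> C * C" unfolding p_def
      by (rule order_trans[OF norm_blinfun_compose mult_mono[OF R1(3) R0(3)]]) (use C in auto)
    have "good_sum sX (h (g n)) ((\<lambda>x. p x) ` ?M) ((\<lambda>x. x - p x) ` ?M) ?M"
    proof (rule good_sum_projection[OF X subspace_range_op[OF X X R1(1)] p_op])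
      show "p x \<in> ?M" for x unfolding p by simp
      show "norm p < h (g n)" using np h(1) by (simp add: power2_eq_square)
      have "norm (id_blinfun - p) \<le> 1 + norm p"
        using norm_triangle_ineq4[of id_blinfun p] norm_blinfun_id_le[where 'a = 'x] by linarith
      then show "norm (id_blinfun - p) < h (g n)" using np h(1) by (simp add: power2_eq_square)
    qed (rule pp)
    moreover have "(\<lambda>x. p x) ` ?M = ?M1" by (auto simp: pR1 image_image)
    moreover have "(\<lambda>x. x - p x) ` ?M = ?M2"
      by (auto simp: image_image pR1 E p[symmetric])
    ultimately show ?thesis by simp
  qed
  have gN: "good_sum sY (h (g n)) ?N1 ?N2 ?N"
  proof -
    have "good_sum sY (h (g n)) ((\<lambda>x. P0 x) ` ?N) ((\<lambda>x. x - P0 x) ` ?N) ?N"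
    proof (rule good_sum_projection[OF Y subspace_range_op[OF Y Y P1(1)] P0(1)])
      show "P0 x \<in> ?N" for x by (metis P01(1) rangeI)
      show "norm P0 < h (g n)" using h(2) by simp
      have "norm (id_blinfun - P0) \<le> 1 + norm P0"
        using norm_triangle_ineq4[of id_blinfun P0] norm_blinfun_id_le[where 'a = 'y] by linarith
      then show "norm (id_blinfun - P0) < h (g n)" using h(2) by simp
    qed (rule P0)
    moreover have "(\<lambda>x. P0 x) ` ?N = ?N1" by (auto simp: P01 image_image)
    moreover have "(\<lambda>x. x - P0 x) ` ?N = ?N2" by (auto simp: image_image P01 Q)
    ultimately show ?thesis by simp
  qed
  have sub: "?M1 \<subseteq> ?M" "?N1 \<subseteq> ?N" using R1p P01(1) by (metis image_subsetI rangeI)+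
  show "bm_dist sX sY ?M2 ?N2 \<le> Phi sX sY f g h n"
    by (rule Phi_upper[where f = f and g = g and h = h and n = n, OF fin(1) fin_P1(1) dim1 fin_P1(2) bm1 fin_p(1) sub(1) fin_P0(1) sub(2) dim0 fin_P0(2) bm0 gM gN])
  have "E = R1 o\<^sub>L (id_blinfun - R0)" by (simp add: E_def)
  then have "rank_le sX E n" using rank_le_compose_right[OF R1(4)] by metis
  note fin_E = rank_le_dim(1)[OF X X E_op this]
  have "Q = P1 o\<^sub>L Q" by (rule blinfun_eqI) (simp add: Q blinfun.diff_right P1 P01)
  then have "rank_le sY Q n" using rank_le_compose_right[OF rank_P1] by metis
  note fin_Q = rank_le_dim(1)[OF Y Y Q_op this]
  have "X.dim ?M = X.dim ?M1 + X.dim ?M2"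
    by (rule direct_sum_dim[OF X _ fin_p(1) fin_E]) (use gM in \<open>simp add: good_sum_def\<close>)
  moreover have "Y.dim ?N = Y.dim ?N1 + Y.dim ?N2"
    by (rule direct_sum_dim[OF Y _ fin_P0(1) fin_Q]) (use gN in \<open>simp add: good_sum_def\<close>)
  ultimately have "X.dim ?M2 = Y.dim ?N2" using dim1 dim0 by simp
  then show "bm_dist sX sY ?M2 ?N2 < \<infinity>" by (rule bm_dist_finite[OF X Y fin_E fin_Q])
qed


section \<open>The parameter functions\<close>

lemma block_index_eq:
  assumes "strict_mono m" "1 \<le> k"
  shows "block_index m (m k) = k"
  unfolding block_index_def
proof (rule Least_equality)
  show "1 \<le> k \<and> m (k - 1) < m k \<and> m k \<le> m k"
    using assms strict_monoD[OF assms(1), of "k - 1" k] by auto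
  show "k \<le> j" if "1 \<le> j \<and> m (j - 1) < m k \<and> m k \<le> m j" for j
    using that strict_mono_less_eq[OF assms(1), of k j] by simp
qed

text \<open>
  The greatest function exists: it is \<open>n \<mapsto> min n (m (j n))\<close>, where \<open>j n\<close> is the first index \<open>i \<ge> 1\<close> with
  \<open>n \<le> m (i + 1)\<close>.
\<close>

lemma g_fun_eq:
  assumes m: "strict_mono m" and m0: "1 \<le> m 0" and k: "1 \<le> k"
  shows "g_fun m (m (k + 1)) = m k"
proof -
  define Pr where "Pr g \<longleftrightarrow> mono g \<and> (\<forall>k\<ge>1. 1 \<le> g k) \<and> (\<forall>k. g k \<le> k) \<and> (\<forall>k\<ge>1. g (m (k + 1)) = m k)"
    for g :: "nat \<Rightarrow> nat"
  define j where "j n = (LEAST i. 1 \<le> i \<and> n \<le> m (i + 1))" for n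
  have ex: "1 \<le> Suc n \<and> n \<le> m (Suc n + 1)" for n
    using strict_mono_imp_increasing[OF m, of "Suc n + 1"] by simp
  have j: "1 \<le> j n" "n \<le> m (j n + 1)" for n
    using LeastI[of "\<lambda>i. 1 \<le> i \<and> n \<le> m (i + 1)", OF ex] by (auto simp: j_def)
  have j_le: "j n \<le> i" if "1 \<le> i" "n \<le> m (i + 1)" for n i
    unfolding j_def by (rule Least_le) (use that in simp)
  have m1: "1 \<le> m i" for i using m0 strict_mono_less_eq[OF m, of 0 i] by simp
  define G where "G n = min n (m (j n))" for n
  have j_m: "j (m (i + 1)) = i" if "1 \<le> i" for i
  proof (rule antisym)
    show "j (m (i + 1)) \<le> i" by (rule j_le[OF that order_refl])
    show "i \<le> j (m (i + 1))" using j(2)[of "m (i + 1)"] strict_mono_less_eq[OF m] by simp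
  qed
  have "Pr G"
    unfolding Pr_def
  proof (intro conjI allI impI)
    show "mono G"
    proof (rule monoI)
      fix a b :: nat assume ab: "a \<le> b"
      have "j a \<le> j b" by (rule j_le[OF j(1) order_trans[OF ab j(2)]])
      then have "m (j a) \<le> m (j b)" using strict_mono_less_eq[OF m] by simp
      then show "G a \<le> G b" using ab by (auto simp: G_def)
    qed
    show "1 \<le> G i" if "1 \<le> i" for i using that m1[of "j i"] by (simp add: G_def)
    show "G i \<le> i" for i by (simp add: G_def)
    show "G (m (i + 1)) = m i" if "1 \<le> i" for i
      using strict_monoD[OF m, of i "i + 1"] j_m[OF that] by (simp add: G_def)
  qed
  moreover have "g \<le> G" if g: "Pr g" for g
  proof (rule le_funI)
    fix n
    have "g n \<le> g (m (j n + 1))" using g j(2)[of n] by (auto simp: Pr_def dest: monoD)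
    then show "g n \<le> G n" using g j(1)[of n] by (auto simp: Pr_def G_def)
  qed
  ultimately have "Pr (Greatest Pr)" by (rule GreatestI2_order)
  then show ?thesis using k unfolding Pr_def g_fun_def by blast
qed


section \<open>Finite-dimensional spaces\<close>

text \<open>If finitely many functionals separate points, the projections that preserve them are identities,
  and \<open>local_step\<close> gives an isomorphism of the two spaces.\<close>

lemma factorization_if_total:
  fixes sX :: "'k::real_or_complex \<Rightarrow> 'x::banach \<Rightarrow> 'x"
    and sY :: "'k \<Rightarrow> 'y::banach \<Rightarrow> 'y"
  assumes X: "normed_space_over sX" and Y: "normed_space_over sY"
    and rX: "reflexive_space sX" and rY: "reflexive_space sY" and C: "0 \<le> C"
    and ld: "loc_dist dual_scale (dual sX) dual_scale (dual sY) K C n < \<infinity>"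
    and FX: "FX \<subseteq> dual sX" "finite FX" "card FX \<le> n" "\<forall>x. (\<forall>\<phi>\<in>FX. \<phi> x = 0) \<longrightarrow> x = 0"
    and FY: "FY \<subseteq> dual sY" "finite FY" "card FY \<le> n" "\<forall>y. (\<forall>\<phi>\<in>FY. \<phi> y = 0) \<longrightarrow> y = 0"
    and T: "T \<in> bounded_ops sX sX"
  shows "\<exists>T1\<in>bounded_ops sX sY. \<exists>T2\<in>bounded_ops sY sX.
     T = T2 o\<^sub>L T1 \<and> closure (range (blinfun_apply T1)) = UNIV \<and> compact_op T1 \<and> compact_op T2"
proof -
  have "loc_dist dual_scale (dual sX) dual_scale (dual sY) K C n
      < ennreal (enn2real (loc_dist dual_scale (dual sX) dual_scale (dual sY) K C n) + 1)"
    using ld by (subst ennreal_plus) (auto simp: ennreal_enn2real_if)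
  then obtain R S G W where ops: "R \<in> bounded_ops sX sX" "S \<in> bounded_ops sY sY"
      "G \<in> bounded_ops sX sY" "W \<in> bounded_ops sY sX"
    and eqs: "R o\<^sub>L R = R" "S o\<^sub>L S = S" "W o\<^sub>L G = R" "G o\<^sub>L W = S" "G o\<^sub>L R = G" "W o\<^sub>L S = W"
    and norms: "norm R \<le> C" "norm S \<le> C" and rank: "rank_le sX R (K n)"
    and FXR: "\<And>\<phi>. \<phi> \<in> FX \<Longrightarrow> \<phi> o\<^sub>L R = \<phi>" and FYS: "\<And>\<phi>. \<phi> \<in> FY \<Longrightarrow> \<phi> o\<^sub>L S = \<phi>"
    using local_step[OF X Y rX rY C _ FX(1-3) FY(1-3)] by metis
  have Rx: "R x = x" for x
  proof -
    have "x - R x = 0"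
    proof (rule FX(4)[rule_format])
      fix \<phi> assume "\<phi> \<in> FX"
      then have "\<phi> (R x) = \<phi> x" using FXR by (metis blinfun_apply_blinfun_compose)
      then show "\<phi> (x - R x) = 0" by (simp add: blinfun.diff_right)
    qed
    then show ?thesis by simp
  qed
  have Sy: "S y = y" for y
  proof -
    have "y - S y = 0"
    proof (rule FY(4)[rule_format])
      fix \<phi> assume "\<phi> \<in> FY"
      then have "\<phi> (S y) = \<phi> y" using FYS by (metis blinfun_apply_blinfun_compose)
      then show "\<phi> (y - S y) = 0" by (simp add: blinfun.diff_right)
    qed
    then show ?thesis by simp
  qed
  have WG: "W (G x) = x" for x using eqs(3) Rx by (metis blinfun_apply_blinfun_compose)
  have GW: "G (W y) = y" for y using eqs(4) Sy by (metis blinfun_apply_blinfun_compose)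
  have cG: "compact_op G"
    using compact_op_finite_rank[OF X Y ops(3)] rank_le_compose_left[OF X Y ops(3) rank] eqs(5) by metis
  have cTW: "compact_op (T o\<^sub>L W)"
  proof -
    have "T o\<^sub>L W = (T o\<^sub>L R) o\<^sub>L W" by (rule blinfun_eqI) (simp add: Rx)
    then have "rank_le sX (T o\<^sub>L W) (K n)"
      using rank_le_compose_right[OF rank_le_compose_left[OF X X T rank]] by metis
    then show ?thesis by (rule compact_op_finite_rank[OF Y X bounded_ops_compose[OF T ops(4)]])
  qed
  have "range (blinfun_apply G) = UNIV" using GW by (metis surjI)
  moreover have "T = (T o\<^sub>L W) o\<^sub>L G" by (rule blinfun_eqI) (simp add: WG)
  ultimately show ?thesis
    using ops(3) bounded_ops_compose[OF T ops(4)] cG cTW by (metis closure_UNIV)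
qed

lemma total_functionals_if_bounded:
  fixes s :: "'k::real_or_complex \<Rightarrow> 'a::real_normed_vector \<Rightarrow> 'a"
  assumes s: "normed_space_over s"
    and bound: "\<And>F. F \<subseteq> dual s \<Longrightarrow> finite F \<Longrightarrow> card F = n \<Longrightarrow> module.dependent dual_scale F"
  obtains F where "F \<subseteq> dual s" "finite F" "card F \<le> n" "\<forall>x. (\<forall>\<phi>\<in>F. blinfun_apply \<phi> x = 0) \<longrightarrow> x = 0"
proof -
  interpret d: normed_space_over "dual_scale :: 'k \<Rightarrow> ('a \<Rightarrow>\<^sub>L 'k) \<Rightarrow> _"
    by (rule normed_space_over_dual_scale)
  obtain F where F: "F \<subseteq> dual s" "d.independent F" "dual s \<subseteq> d.span F"
    by (rule d.basis_exists[of "dual s"]) (rule that)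
  have no: "\<not> (E \<subseteq> F \<and> finite E \<and> card E = n)" for E
    using bound[of E] F(1) d.independent_mono[OF F(2), of E] by blast
  have fin: "finite F"
  proof (rule ccontr)
    assume "infinite F"
    then show False using infinite_arbitrarily_large[of F n] no by blast
  qed
  have le: "card F \<le> n"
  proof (rule ccontr)
    assume "\<not> card F \<le> n"
    then obtain E where "E \<subseteq> F" "card E = n" using obtain_subset_with_card_n[of n F] by auto
    then show False using no[of E] finite_subset[OF _ fin] by blast
  qed
  have "x = 0" if x: "\<And>\<phi>. \<phi> \<in> F \<Longrightarrow> blinfun_apply \<phi> x = 0" for x
  proof (rule dual_eqI[OF s])
    fix \<phi> assume "\<phi> \<in> dual s"
    then obtain c where c: "\<phi> = (\<Sum>\<psi>\<in>F. dual_scale (c \<psi>) \<psi>)"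
      using F(3) unfolding d.span_finite[OF fin] by blast
    show "blinfun_apply \<phi> x = blinfun_apply \<phi> 0"
      unfolding c blinfun.sum_left by (simp add: x)
  qed
  then have "\<forall>x. (\<forall>\<phi>\<in>F. blinfun_apply \<phi> x = 0) \<longrightarrow> x = 0" by blast
  then show thesis by (rule that[OF F(1) fin le])
qed


section \<open>The factorization theorem\<close>

text \<open>The left side collects the losses in the distances of the ranges of the projections; the right side
  is the factor in the definition of \<open>f_fun\<close>.\<close>

lemma parameter_bound:
  fixes C :: real
  assumes C: "1 \<le> C" and "i \<le> 3"
  shows "C ^ i * (2 * (2 * C + 2) ^ (k + 1)) \<le> 16 * ((2 * (C + 3)) ^ (k + 2))\<^sup>2"
proof -
  let ?b = "2 * (C + 3)"
  have "C ^ i \<le> C ^ 3" by (rule power_increasing[OF assms(2) C])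
  also have "\<dots> \<le> ?b ^ 3" using C by (intro power_mono) auto
  finally have 1: "C ^ i \<le> ?b ^ 3" .
  have 2: "(2 * C + 2) ^ (k + 1) \<le> ?b ^ (k + 1)" using C by (intro power_mono) auto
  have "C ^ i * (2 * C + 2) ^ (k + 1) \<le> ?b ^ 3 * ?b ^ (k + 1)"
    using C by (intro mult_mono 1 2) auto
  also have "\<dots> = ?b ^ (3 + (k + 1))" by (rule power_add[symmetric])
  also have "\<dots> \<le> ?b ^ (2 * (k + 2))" using C by (intro power_increasing) auto
  also have "\<dots> = (?b ^ (k + 2))\<^sup>2" by (simp only: power_mult[symmetric] mult.commute)
  finally have "C ^ i * (2 * C + 2) ^ (k + 1) \<le> (?b ^ (k + 2))\<^sup>2" .
  moreover have "0 \<le> (?b ^ (k + 2))\<^sup>2" by simp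
  ultimately show ?thesis by linarith
qed

theorem theorem2p14:
  fixes sX :: "'k::real_or_complex \<Rightarrow> 'x::banach \<Rightarrow> 'x"
    and sY :: "'k \<Rightarrow> 'y::banach \<Rightarrow> 'y"
    and T :: "'x \<Rightarrow>\<^sub>L 'x"
    and K m :: "nat \<Rightarrow> nat"
    and C C' :: real
  assumes "normed_space_over sX" and "normed_space_over sY"
    and "separable_space (euclidean :: 'x topology)"
    and "separable_space (euclidean :: 'y topology)"
    and "reflexive_space sX" and "reflexive_space sY"
    and "1 \<le> C"
    and "\<forall>n\<ge>1. 1 \<le> K n" and "mono_on {1..} K"
    and "\<forall>n\<ge>1. loc_dist dual_scale (dual sX) dual_scale (dual sY) K C n < \<infinity>"
    and "T \<in> bounded_ops sX sX" and "compact_op T"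
    and "m 0 = 2" and "\<forall>k\<ge>1. K (3 * m (k - 1) + 2) + 1 \<le> m k"
    and "\<forall>k\<ge>1. \<forall>n. 1 \<le> n \<and> n \<le> m (k + 1) \<longrightarrow>
           Phi sX sY (f_fun m C (loc_dist dual_scale (dual sX) dual_scale (dual sY) K C))
               (g_fun m) (h_fun m C) n
             \<le> ennreal (1 / (real k + 1) ^ 3 * C' * (1 / Gam C (k + 1)))
               * inverse (ennreal (approx_number sX sX (m (k - 1)) T))"
  shows "\<exists>T1\<in>bounded_ops sX sY. \<exists>T2\<in>bounded_ops sY sX.
           T = T2 o\<^sub>L T1 \<and> closure (range (blinfun_apply T1)) = UNIV \<and>
           compact_op T1 \<and> compact_op T2"
proof -
  note X = assms(1) and Y = assms(2) and rX = assms(5) and rY = assms(6) and C = assms(7)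
  let ?ld = "loc_dist dual_scale (dual sX) dual_scale (dual sY) K C"
  let ?f = "f_fun m C ?ld" and ?g = "g_fun m" and ?h = "h_fun m C"
  interpret X: normed_space_over sX by (rule X)
  interpret Y: normed_space_over sY by (rule Y)
  have C0: "0 \<le> C" using C by simp
  have ld_fin: "?ld n < \<infinity>" if "1 \<le> n" for n using assms(10) that by blast
  have bigger: "?ld n < ennreal (enn2real (?ld n) + 1)" if "1 \<le> n" for n
    using ld_fin[OF that] by (subst ennreal_plus) (auto simp: ennreal_enn2real_if)
  consider (small) n where "1 \<le> n" "K n < n" | (trivial) "(\<forall>x::'x. x = 0) \<or> (\<forall>y::'y. y = 0)"
    | (large) x0 :: 'x and y0 :: 'y where "x0 \<noteq> 0" "y0 \<noteq> 0" "\<forall>n\<ge>1. n \<le> K n"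
    using not_le by blast
  then show ?thesis
  proof cases
    case small
    \<comment> \<open>at most \<open>K n < n\<close> functionals are independent, so the spaces are finite-dimensional\<close>
    have indep: "card F \<le> K n" if F: "F \<subseteq> dual sX" "finite F" "card F \<le> n" "\<not> module.dependent dual_scale F" for F
      by (rule local_step[OF X Y rX rY C0 bigger[OF small(1)] F(1-3), of "{}"]) (use F(4) in auto)
    have indep': "card F \<le> K n" if F: "F \<subseteq> dual sY" "finite F" "card F \<le> n" "\<not> module.dependent dual_scale F" for F
      by (rule local_step[OF X Y rX rY C0 bigger[OF small(1)] _ _ _ F(1-3), of "{}"]) (use F(4) in auto)
    have depX: "module.dependent dual_scale F" if "F \<subseteq> dual sX" "finite F" "card F = n" for F
      using indep[of F] that small(2) by (metis linorder_not_le order_refl)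
    obtain FX where FX: "FX \<subseteq> dual sX" "finite FX" "card FX \<le> n" "\<forall>x. (\<forall>\<phi>\<in>FX. \<phi> x = 0) \<longrightarrow> x = 0"
      by (rule total_functionals_if_bounded[OF X, of n], rule depX, assumption+)
    have depY: "module.dependent dual_scale F" if "F \<subseteq> dual sY" "finite F" "card F = n" for F
      using indep'[of F] that small(2) by (metis linorder_not_le order_refl)
    obtain FY where FY: "FY \<subseteq> dual sY" "finite FY" "card FY \<le> n" "\<forall>y. (\<forall>\<phi>\<in>FY. \<phi> y = 0) \<longrightarrow> y = 0"
      by (rule total_functionals_if_bounded[OF Y, of n], rule depY, assumption+)
    show ?thesis by (rule factorization_if_total[OF X Y rX rY C0 ld_fin[OF small(1)] FX FY assms(11)])
  next
    case trivial
    \<comment> \<open>a nonzero functional on one space would factor through the other space\<close>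
    have "(\<forall>x::'x. x = 0) \<and> (\<forall>y::'y. y = 0)"
    proof (intro conjI allI; rule ccontr)
      fix x :: 'x assume x: "x \<noteq> 0"
      then have Y0: "y = 0" for y :: 'y using trivial by blast
      obtain \<phi> where \<phi>: "\<phi> \<in> dual sX" "\<phi> x = of_real (norm x)" using norming_functional[OF X] by metis
      have "\<phi> x = 0"
      proof (rule local_step[OF X Y rX rY C0 bigger[OF order_refl], of "{\<phi>}" "{}"])
        fix R and G :: "'x \<Rightarrow>\<^sub>L 'y" and W :: "'y \<Rightarrow>\<^sub>L 'x"
        assume "W o\<^sub>L G = R" "\<And>\<psi>. \<psi> \<in> {\<phi>} \<Longrightarrow> \<psi> o\<^sub>L R = \<psi>"
        then have "\<phi> x = \<phi> (W (G x))" by (metis blinfun_apply_blinfun_compose singletonI)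
        then show "\<phi> x = 0" using Y0[of "G x"] by simp
      qed (use \<phi> in auto)
      then show False using \<phi>(2) x by simp
    next
      fix y :: 'y assume y: "y \<noteq> 0"
      then have X0: "x = 0" for x :: 'x using trivial by blast
      obtain \<phi> where \<phi>: "\<phi> \<in> dual sY" "\<phi> y = of_real (norm y)" using norming_functional[OF Y] by metis
      have "\<phi> y = 0"
      proof (rule local_step[OF X Y rX rY C0 bigger[OF order_refl], of "{}" "{\<phi>}"])
        fix S and G :: "'x \<Rightarrow>\<^sub>L 'y" and W :: "'y \<Rightarrow>\<^sub>L 'x"
        assume "G o\<^sub>L W = S" "\<And>\<psi>. \<psi> \<in> {\<phi>} \<Longrightarrow> \<psi> o\<^sub>L S = \<psi>"
        then have "\<phi> y = \<phi> (G (W y))" by (metis blinfun_apply_blinfun_compose singletonI)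
        then show "\<phi> y = 0" using X0[of "W y"] by simp
      qed (use \<phi> in auto)
      then show False using \<phi>(2) y by simp
    qed
    then show ?thesis
      by (intro factorization_if_total[OF X Y rX rY C0 ld_fin[OF order_refl] _ _ _ _ _ _ _ _ assms(11), of "{}" "{}"]) auto
  next
    case large
    have m_Suc: "K (3 * m k + 2) + 1 \<le> m (Suc k)" for k
      using assms(14)[rule_format, of "Suc k"] by simp
    have m_less: "m k < m (Suc k)" for k
      using m_Suc[of k] large(3)[rule_format, of "3 * m k + 2"] by linarith
    then have m_mono: "strict_mono m" by (rule strict_monoI_Suc)
    have m_ge: "2 \<le> m k" for k using assms(13) strict_mono_less_eq[OF m_mono, of 0 k] by simp
    have m_gt: "2 < m (Suc k)" for k using m_ge[of k] m_less[of k] by simp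
    have K_m: "K (3 * m k) < m (Suc k)" for k
    proof -
      have "K (3 * m k) \<le> K (3 * m k + 2)"
        by (rule mono_onD[OF assms(9)]) (use m_ge[of k] in auto)
      then show ?thesis using m_Suc[of k] by simp
    qed
    define r where "r k = 2 * enn2real (?ld (3 * m k))" for k
    have ld1: "1 \<le> ?ld (3 * m k)" for k
      by (rule loc_dist_ge_1[OF X large(1)]) (use m_ge[of k] in simp)
    have ld_eq: "?ld (3 * m k) = ennreal (enn2real (?ld (3 * m k)))" for k
      using ld_fin[of "3 * m k"] m_ge[of k] by simp
    have ld1': "1 \<le> enn2real (?ld (3 * m k))" for k
      using ld1[of k] ld_eq[of k] by (metis ennreal_1 ennreal_le_iff enn2real_nonneg)
    have ld_r: "?ld (3 * m k) < ennreal (r k)" for k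
      using ld1'[of k] by (subst ld_eq) (simp add: r_def ennreal_lessI)
    have f_m: "?f (m (Suc k)) = 16 * ((2 * (C + 3)) ^ (k + 2))\<^sup>2 * enn2real (?ld (3 * m k))" for k
      using m_gt[of k] block_index_eq[OF m_mono, of "Suc k"] by (simp add: f_fun_def Gam_def)
    have g_m: "?g (m (Suc (Suc k))) = m (Suc k)" for k
      using g_fun_eq[OF m_mono _, of "Suc k"] m_ge[of 0] by simp
    have h_m: "?h (m (Suc k)) = (2 * (C + 3)) ^ (k + 2) + 1" for k
      using m_gt[of k] block_index_eq[OF m_mono, of "Suc k"] by (simp add: h_fun_def Gam_def)
    let ?a = "\<lambda>k. approx_number sX sX (m k) T"
    have m_pos: "0 < m k" for k using m_ge[of k] by simp
    \<comment> \<open>a vanishing approximation number has to be attained: the hypothesis does not bound \<open>\<Phi>\<close> then\<close>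
    have ex_A: "\<exists>A. A \<in> bounded_ops sX sX \<and> rank_le sX A (m k) \<and> norm (T - A) \<le> 2 * ?a k" for k
    proof (cases "?a k = 0")
      case True
      have "rank_le sX T (m k)"
        using rank_le_mono[OF approx_number_zero_imp_rank[OF X X assms(11) m_pos True]] by simp
      then show ?thesis using assms(11) True by (intro exI[of _ T]) simp
    next
      case False
      then have "0 < ?a k" using approx_number_nonneg[OF X X m_pos, of k T] by linarith
      then obtain S where "S \<in> bounded_ops sX sX" "rank_le sX S (m k - 1)" "norm (T - S) < ?a k + ?a k"
        using approx_number_approx(2)[OF X X m_pos] by blast
      then show ?thesis using rank_le_mono[of sX S "m k - 1" "m k"] by (intro exI[of _ S]) simp
    qed
    then obtain A where A: "\<And>k. A k \<in> bounded_ops sX sX" "\<And>k. rank_le sX (A k) (m k)"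
      "\<And>k. norm (T - A k) \<le> 2 * ?a k" by metis
    obtain D where D: "countable D" "closure D = (UNIV :: 'y set)"
      using assms(4) by (auto simp: separable_space_def)
    have "D \<noteq> {}" using D(2) by auto
    then have y_dense: "closure (range (from_nat_into D)) = UNIV" using D by simp
    obtain R P F F' where R: "\<And>k. R k \<in> bounded_ops sX sX" "\<And>k u. R k (R k u) = R k u" "\<And>k. norm (R k) \<le> C"
      "\<And>k. rank_le sX (R k) (K (3 * m k))"
      "\<And>k u. A k (R k u) = A k u" "\<And>k u. R k (R (Suc k) u) = R k u"
      and P: "\<And>k. P k \<in> bounded_ops sY sY" "\<And>k v. P k (P k v) = P k v" "\<And>k v. P (Suc k) (P k v) = P k v"
      "\<And>k v. P k (P (Suc k) v) = P k v" "\<And>k. P (Suc k) (from_nat_into D k) = from_nat_into D k"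
      "\<And>k. 1 + norm (P k) \<le> (2 * C + 2) ^ (k + 1)"
      and F: "\<And>k. F k \<in> bounded_ops sX sY" "\<And>k. F' k \<in> bounded_ops sY sX"
      "\<And>k u. F' k (F k u) = R k u" "\<And>k v. F k (F' k v) = P k v" "\<And>k u. F k (R k u) = F k u"
      "\<And>k v. F' k (P k v) = F' k v"
      "\<And>k. norm (F k) * norm (F' k) \<le> C\<^sup>2 * r k * norm (P k)"
      by (rule block_sequence[where K = K and m = m and r = r and A = A and y = "from_nat_into D",
            OF X Y rX rY C ld_r A(1,2) K_m]) (rule that)
    have FF: "C * (norm (F k) * norm (F' k)) \<le> ?f (m (Suc k))" "norm (F k) * norm (F' k) \<le> ?f (m (Suc k))" for k
    proof -
      let ?L = "enn2real (?ld (3 * m k))"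
      have L: "0 \<le> ?L" by simp
      have "norm (P k) \<le> (2 * C + 2) ^ (k + 1)" using P(6)[of k] by simp
      then have "C\<^sup>2 * r k * norm (P k) \<le> C\<^sup>2 * r k * (2 * C + 2) ^ (k + 1)"
        by (intro mult_left_mono) (auto simp: r_def)
      then have 1: "norm (F k) * norm (F' k) \<le> C\<^sup>2 * (2 * (2 * C + 2) ^ (k + 1)) * ?L"
        using F(7)[of k] by (simp add: r_def mult_ac)
      show "norm (F k) * norm (F' k) \<le> ?f (m (Suc k))"
        unfolding f_m using 1 mult_right_mono[OF parameter_bound[OF C, of 2 k] L] by linarith
      have "C * (norm (F k) * norm (F' k)) \<le> C * (C\<^sup>2 * (2 * (2 * C + 2) ^ (k + 1)) * ?L)"
        by (intro mult_left_mono 1 C0)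
      also have "\<dots> = C ^ 3 * (2 * (2 * C + 2) ^ (k + 1)) * ?L"
        by (simp add: power2_eq_square power3_eq_cube mult_ac)
      also have "\<dots> \<le> ?f (m (Suc k))"
        unfolding f_m by (rule mult_right_mono[OF parameter_bound[OF C, of 3 k] L]) simp
      finally show "C * (norm (F k) * norm (F' k)) \<le> ?f (m (Suc k))" .
    qed
    have h_large: "C\<^sup>2 + 1 < ?h (m (Suc k))" "1 + norm (P k) < ?h (m (Suc k))" for k
    proof -
      have "C\<^sup>2 < (2 * (C + 3)) ^ 2" using C by (intro power_strict_mono) auto
      also have "\<dots> \<le> (2 * (C + 3)) ^ (k + 2)" using C by (intro power_increasing) auto
      finally show "C\<^sup>2 + 1 < ?h (m (Suc k))" by (simp add: h_m)
      have "(2 * C + 2) ^ (k + 1) \<le> (2 * (C + 3)) ^ (k + 1)" using C by (intro power_mono) auto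
      also have "\<dots> \<le> (2 * (C + 3)) ^ (k + 2)" using C by (intro power_increasing) auto
      finally show "1 + norm (P k) < ?h (m (Suc k))" using P(6)[of k] by (simp add: h_m)
    qed
    define E where "E k = R (Suc k) o\<^sub>L (id_blinfun - R k)" for k
    define Q where "Q k = P (Suc k) - P k" for k
    define bm where "bm k = bm_dist sX sY (range (blinfun_apply (E k))) (range (blinfun_apply (Q k)))" for k
    have bm: "bm k \<le> Phi sX sY ?f ?g ?h (m (Suc (Suc k)))" "bm k < \<infinity>" for k
    proof -
      have rk: "rank_le sX (R k) (?g (m (Suc (Suc k))))"
        unfolding g_m by (rule rank_le_mono[OF R(4) less_imp_le[OF K_m]])
      have rk1: "rank_le sX (R (Suc k)) (m (Suc (Suc k)))"
        by (rule rank_le_mono[OF R(4) less_imp_le[OF K_m]])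
      have at_g: "C * (norm (F k) * norm (F' k)) \<le> ?f (?g (m (Suc (Suc k))))"
        "C\<^sup>2 + 1 < ?h (?g (m (Suc (Suc k))))" "1 + norm (P k) < ?h (?g (m (Suc (Suc k))))"
        unfolding g_m by (rule FF(1) h_large)+
      note iso = block_isomorphism[where f = ?f and g = ?g and h = ?h and n = "m (Suc (Suc k))"
          and ?R0.0 = "R k" and ?R1.0 = "R (Suc k)" and ?P0.0 = "P k" and ?P1.0 = "P (Suc k)"
          and ?F0.0 = "F k" and ?F1.0 = "F (Suc k)" and F0' = "F' k" and F1' = "F' (Suc k)",
          OF X Y C R(1-3) rk R(1-3) rk1 R(6) P(1,2) P(1,2) P(3,4) F(1-6) F(1-6) FF(2) at_g]
      show "bm k \<le> Phi sX sY ?f ?g ?h (m (Suc (Suc k)))" "bm k < \<infinity>"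
        unfolding bm_def E_def Q_def by (fact iso)+
    qed
    have Phi1: "1 \<le> Phi sX sY ?f ?g ?h (m (Suc (Suc k)))" for k
    proof (rule Phi_ge_1[OF X Y large(1,2)])
      have "1 * 1 \<le> 16 * ((2 * (C + 3)) ^ (Suc k + 2))\<^sup>2 * enn2real (?ld (3 * m (Suc k)))"
        using C ld1'[of "Suc k"] by (intro mult_mono one_le_power mult_ge1_I) auto
      then show "1 \<le> ?f (m (Suc (Suc k)))" by (simp add: f_m)
      show "1 < ?h (?g (m (Suc (Suc k))))" unfolding g_m h_m using C by simp
    qed (use m_ge[of "Suc (Suc k)"] in simp)
    \<comment> \<open>at least \<open>1\<close>, also for trivial complements, and at most \<open>2 * \<Phi>\<close> by the bound for lines\<close>
    define d where "d k = 2 * enn2real (max 1 (bm k))" for k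
    have max_fin: "max 1 (bm k) < \<infinity>" for k using bm(2)[of k] by simp
    have max_eq: "max 1 (bm k) = ennreal (enn2real (max 1 (bm k)))" for k using max_fin[of k] by simp
    have max_ge: "1 \<le> enn2real (max 1 (bm k))" for k
      using max_eq[of k] by (metis ennreal_1 ennreal_le_iff enn2real_nonneg max.cobounded1)
    have bm_d: "bm k < ennreal (d k)" for k
    proof -
      have "bm k \<le> ennreal (enn2real (max 1 (bm k)))" using max_eq[of k] by (metis max.cobounded2)
      also have "\<dots> < ennreal (d k)" using max_ge[of k] by (simp add: d_def ennreal_lessI)
      finally show ?thesis .
    qed
    have d_ge: "1 \<le> d k" for k using max_ge[of k] by (simp add: d_def)
    have E: "E k u = R (Suc k) (u - R k u)" for k u by (simp add: E_def blinfun.diff_left)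
    have Q: "Q k v = P (Suc k) v - P k v" for k v by (simp add: Q_def blinfun.diff_left)
    have E_op: "E k \<in> bounded_ops sX sX" and Q_op: "Q k \<in> bounded_ops sY sY" for k
      unfolding E_def Q_def
      by (intro bounded_ops_compose[where t = sX] bounded_ops_diff[OF X] bounded_ops_diff[OF Y] R P bounded_ops_id)+
    have EE: "E k (E k u) = E k u" for k u by (simp add: E blinfun.diff_right R)
    have QQ: "Q k (Q k v) = Q k v" for k v by (simp add: Q blinfun.diff_right P)
    have ex_U: "\<exists>p. fst p \<in> bounded_ops sX sY \<and> snd p \<in> bounded_ops sY sX \<and>
        (\<forall>u. snd p (fst p u) = E k u) \<and> (\<forall>v. fst p (snd p v) = Q k v) \<and>
        (\<forall>u. fst p (E k u) = fst p u) \<and> (\<forall>v. snd p (Q k v) = snd p v) \<and>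
        norm (fst p) \<le> norm (E k) \<and> norm (snd p) \<le> d k * norm (Q k)" for k
    proof -
      obtain U U' where "U \<in> bounded_ops sX sY" "U' \<in> bounded_ops sY sX"
        "\<And>u. U' (U u) = E k u" "\<And>v. U (U' v) = Q k v" "\<And>u. U (E k u) = U u" "\<And>v. U' (Q k v) = U' v"
        "norm U \<le> norm (E k)" "norm U' \<le> d k * norm (Q k)"
        by (rule operators_of_bm_dist[OF X Y E_op EE Q_op QQ bm_d[unfolded bm_def]]) (rule that)
      then show ?thesis by (intro exI[of _ "(U, U')"]) simp
    qed
    then obtain p where p: "\<And>k. fst (p k) \<in> bounded_ops sX sY \<and> snd (p k) \<in> bounded_ops sY sX \<and>
        (\<forall>u. snd (p k) (fst (p k) u) = E k u) \<and> (\<forall>v. fst (p k) (snd (p k) v) = Q k v) \<and>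
        (\<forall>u. fst (p k) (E k u) = fst (p k) u) \<and> (\<forall>v. snd (p k) (Q k v) = snd (p k) v) \<and>
        norm (fst (p k)) \<le> norm (E k) \<and> norm (snd (p k)) \<le> d k * norm (Q k)" by metis
    have U: "fst (p k) \<in> bounded_ops sX sY" "snd (p k) \<in> bounded_ops sY sX"
      "snd (p k) (fst (p k) u) = E k u" "fst (p k) (snd (p k) v) = Q k v"
      "fst (p k) (E k u) = fst (p k) u" "snd (p k) (Q k v) = snd (p k) v"
      "norm (fst (p k)) \<le> norm (E k)" "norm (snd (p k)) \<le> d k * norm (Q k)" for k u v
      using p by blast+
    have nE: "norm (E k) \<le> C * (1 + C)" for k
    proof -
      have 1: "norm (id_blinfun - R k) \<le> 1 + C"
        using norm_triangle_ineq4[of id_blinfun "R k"] norm_blinfun_id_le[where 'a = 'x] R(3)[of k] by linarith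
      show ?thesis unfolding E_def
        by (rule order_trans[OF norm_blinfun_compose mult_mono[OF R(3) 1]]) (use C in auto)
    qed
    have nQ: "norm (Q k) \<le> 2 * (2 * C + 2) ^ (k + 2)" for k
    proof -
      have "(2 * C + 2) ^ (k + 1) \<le> (2 * C + 2) ^ (k + 2)" using C by (intro power_increasing) auto
      moreover have "norm (P (Suc k)) \<le> (2 * C + 2) ^ (k + 2)" using P(6)[of "Suc k"] by simp
      moreover have "norm (P k) \<le> (2 * C + 2) ^ (k + 1)" using P(6)[of k] by simp
      ultimately show ?thesis unfolding Q_def using norm_triangle_ineq4[of "P (Suc k)" "P k"] by linarith
    qed
    define \<beta> where "\<beta> = 4 * \<bar>C'\<bar>"
    have TA: "norm (T - A j) * d i \<le> \<beta> / (2 * C + 6) ^ j" if ij: "i \<le> j" for i j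
    proof -
      let ?Phi = "Phi sX sY ?f ?g ?h (m (Suc (Suc i)))"
      define B where "B = 1 / (real (Suc j) + 1) ^ 3 * C' * (1 / Gam C (Suc j + 1))"
      have "m (Suc (Suc i)) \<le> m (Suc j + 1)" using ij strict_mono_less_eq[OF m_mono] by simp
      then have le: "?Phi \<le> ennreal B * inverse (ennreal (?a j))"
        using assms(15)[rule_format, of "Suc j" "m (Suc (Suc i))"] m_ge[of "Suc (Suc i)"] by (simp add: B_def)
      \<comment> \<open>otherwise the right side of the hypothesis is \<open>0\<close>, even if the inverse is infinite\<close>
      have B: "0 < B"
      proof (rule ccontr)
        assume "\<not> 0 < B"
        then have "ennreal B = 0" by (simp add: ennreal_neg)
        then show False using le Phi1[of i] by simp
      qed
      have B_le: "4 * B \<le> \<beta> / (2 * C + 6) ^ j"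
      proof -
        have "1 * (2 * C + 6) ^ j \<le> (real (Suc j) + 1) ^ 3 * (2 * C + 6) ^ (j + 3)"
          using C by (intro mult_mono one_le_power power_increasing) auto
        then have "\<bar>C'\<bar> / ((real (Suc j) + 1) ^ 3 * (2 * C + 6) ^ (j + 3)) \<le> \<bar>C'\<bar> / (2 * C + 6) ^ j"
          using C by (intro divide_left_mono mult_pos_pos) auto
        moreover have "B \<le> \<bar>C'\<bar> / ((real (Suc j) + 1) ^ 3 * (2 * C + 6) ^ (j + 3))"
          unfolding B_def Gam_def using C by (simp add: divide_right_mono distrib_left numeral_3_eq_3)
        ultimately show ?thesis by (simp add: \<beta>_def)
      qed
      show ?thesis
      proof (cases "?a j = 0")
        case True
        then have "norm (T - A j) = 0" using A(3)[of j] by simp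
        moreover have "0 \<le> \<beta> / (2 * C + 6) ^ j"
          unfolding \<beta>_def using C by (intro divide_nonneg_nonneg zero_le_power) auto
        ultimately show ?thesis by simp
      next
        case False
        then have a: "0 < ?a j" using approx_number_nonneg[OF X X m_pos, of j T] by linarith
        have "max 1 (bm i) \<le> ?Phi" using Phi1[of i] bm(1)[of i] by simp
        also have "\<dots> \<le> ennreal (B / ?a j)"
          using le a B by (simp add: inverse_ennreal ennreal_mult[symmetric] divide_inverse)
        finally have "enn2real (max 1 (bm i)) \<le> B / ?a j"
          using a B by (metis divide_nonneg_pos enn2real_leI less_imp_le)
        then have d_le: "d i \<le> 2 * (B / ?a j)" by (simp add: d_def)
        have "norm (T - A j) * d i \<le> (2 * ?a j) * (2 * (B / ?a j))"
          using A(3)[of j] d_le d_ge[of i] a by (intro mult_mono) auto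
        also have "\<dots> = 4 * B" using a by simp
        finally show ?thesis using B_le by linarith
      qed
    qed
    have TA': "norm (T - A j) \<le> \<beta> / (2 * C + 6) ^ j" for j
      using TA[OF order_refl, of j] mult_left_mono[OF d_ge[of j] norm_ge_zero[of "T - A j"]] by simp
    have nU': "norm (snd (p k)) \<le> d k * (2 * (2 * C + 2) ^ (k + 2))" for k
      using U(8)[of k] mult_left_mono[OF nQ[of k], of "d k"] d_ge[of k] by linarith
    have R_fin: "\<exists>n. rank_le sX (R k) n" for k using R(4) by blast
    have "block_data sX sY T A R P (F 0) (F' 0) (\<lambda>k. fst (p k)) (\<lambda>k. snd (p k)) (from_nat_into D) C \<beta> d"
      by (rule block_data.intro[OF X Y C assms(11) R(1) R_fin F(1,2) U(1,2) R(2,6) P(2,4,3) R(3) F(3,4,5,6)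
            U(3)[unfolded E] U(4)[unfolded Q] U(5)[unfolded E] U(6)[unfolded Q] order_trans[OF U(7) nE] nU'
            R(5) TA TA' P(5) y_dense])
    then show ?thesis by (rule block_data.block_factorization)
  qed
qed

end
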